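(* Let $(X,\varphi)$ be a Stone system. If $(X,\varphi)$ is infinite and minimal, then every continuous action of the group $\mathsf{T}(\varphi)$ on the circle $\mathbb S^1$ (that is, every action by homeomorphisms of $\mathbb S^1$) has a fixed point, i.e. a point of $\mathbb S^1$ fixed by all elements of $\mathsf{T}(\varphi)$.
   Context: A Stone system $(X,\varphi)$ is a non-empty totally disconnected compact Hausdorff space $X$ together with a self-homeomorphism $\varphi$ of $X$. It is minimal if every $\varphi$-orbit is dense in $X$, and infinite if $X$ is infinite. The group $\mathsf{T}(\varphi)$ is considered as a discrete group. Suspension: $Y^\varphi=(X\times\mathbb R)/\mathbb Z$, the quotient by the $\mathbb Z$-action $n\cdot(x,t)=(\varphi^n(x),t-n)$; $[x,t]$ is the class of $(x,t)$, and the suspension flow is $\Phi^t([x,s])=[x,s+t]$. $\mathsf{H}_0(\varphi)$ is the group of homeomorphisms of $Y^\varphi$ that are isotopic to the identity; equivalently (Boyle–Carlsen–Eilers), the homeomorphisms $g$ of $Y^\varphi$ for which there is a continuous $\tau\colon Y^\varphi\to\mathbb R$ with $g(y)=\Phi^{\tau(y)}(y)$ for all $y$. Charts: for a clopen $C\subset X$ put $\tau_C=\min\{n\ge1:\exists x\in C,\ \varphi^n(x)\in C\}\in\mathbb N\cup\{\infty\}$. For an open interval $J\subset\mathbb R$ of length $|J|<\tau_C$, the map $\pi_{C,J}\colon C\times J\to Y^\varphi$, $(x,t)\mapsto[x,t]$, is injective; it is called a chart and its image is denoted $U_{C\times J}$ (a domain). A dyadic rational is a number $p/2^q$ with $p,q\in\mathbb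 Z$; an interval is dyadic if it is bounded with dyadic rational endpoints; a chart $\pi_{C,J}$ is dyadic if $J$ is. A piecewise linear (PL) homeomorphism between intervals is a homeomorphism that is piecewise affine with finitely many breakpoints; it is dyadic if both intervals are dyadic, the breakpoints are dyadic rationals, and each affine piece has the form $x\mapsto2^mx+b$ with $m\in\mathbb Z$, $b$ a dyadic rational. $\mathsf{T}(\varphi)$ is the group of all $g\in\mathsf{H}_0(\varphi)$ such that for every $y\in Y^\varphi$ there are a dyadic chart $\pi_{C,J}$ with $y\in U_{C\times J}$ and a dyadic PL homeomorphism $f\colon J\to f(J)\subset\mathbb R$ such that $g(U_{C\times J})=U_{C\times f(J)}$ and $\pi_{C,f(J)}^{-1}\circ g\circ\pi_{C,J}$ is the map $(x,t)\mapsto(x,f(t))$. *)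

theory Defs
  imports "HOL-Analysis.Analysis" "HOL-Algebra.Bij"
begin

section \<open>Stone systems\<close>

definition totally_disconnected_top :: "'a topology \<Rightarrow> bool" where
  "totally_disconnected_top X \<longleftrightarrow> (\<forall>S. connectedin X S \<longrightarrow> (\<exists>a. S \<subseteq> {a}))"

definition stone_system :: "'a topology \<Rightarrow> ('a \<Rightarrow> 'a) \<Rightarrow> bool" where
  "stone_system X \<phi> \<longleftrightarrow>
     topspace X \<noteq> {} \<and> compact_space X \<and> Hausdorff_space X \<and> totally_disconnected_top X \<and>
     homeomorphic_map X X \<phi>"

text \<open>Integer iterates of a self-homeomorphism of \<open>X\<close>. Since \<open>\<phi>\<close> is unconstrained off
  \<open>topspace X\<close>, its inverse is taken relative to \<open>topspace X\<close>.\<close>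

definition int_iter :: "'a topology \<Rightarrow> ('a \<Rightarrow> 'a) \<Rightarrow> int \<Rightarrow> 'a \<Rightarrow> 'a" where
  "int_iter X \<phi> n =
     (if 0 \<le> n then \<phi> ^^ nat n else inv_into (topspace X) \<phi> ^^ nat (- n))"

definition minimal_system :: "'a topology \<Rightarrow> ('a \<Rightarrow> 'a) \<Rightarrow> bool" where
  "minimal_system X \<phi> \<longleftrightarrow>
     (\<forall>x\<in>topspace X. X closure_of (range (\<lambda>n. int_iter X \<phi> n x)) = topspace X)"

section \<open>The suspension\<close>

definition susp_act :: "'a topology \<Rightarrow> ('a \<Rightarrow> 'a) \<Rightarrow> int \<Rightarrow> 'a \<times> real \<Rightarrow> 'a \<times> real" where
  "susp_act X \<phi> n = (\<lambda>(x, t). (int_iter X \<phi> n x, t - of_int n))"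

text \<open>The class \<open>[x,t]\<close> is represented as the \<open>\<int>\<close>-orbit of \<open>(x,t)\<close>.\<close>

definition susp_class :: "'a topology \<Rightarrow> ('a \<Rightarrow> 'a) \<Rightarrow> 'a \<times> real \<Rightarrow> ('a \<times> real) set" where
  "susp_class X \<phi> p = range (\<lambda>n. susp_act X \<phi> n p)"

definition suspension :: "'a topology \<Rightarrow> ('a \<Rightarrow> 'a) \<Rightarrow> ('a \<times> real) set topology" where
  "suspension X \<phi> = topology (\<lambda>U.
     U \<subseteq> susp_class X \<phi> ` (topspace X \<times> UNIV) \<and>
     openin (prod_topology X euclideanreal) {p \<in> topspace X \<times> UNIV. susp_class X \<phi> p \<in> U})"

lemma openin_suspension:
  "openin (suspension X \<phi>) U \<longleftrightarrow>
     U \<subseteq> susp_class X \<phi> ` (topspace X \<times> UNIV) \<and>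
     openin (prod_topology X euclideanreal) {p \<in> topspace X \<times> UNIV. susp_class X \<phi> p \<in> U}"
proof -
  let ?P = "\<lambda>U. {p \<in> topspace X \<times> UNIV. susp_class X \<phi> p \<in> U}"
  let ?Q = "\<lambda>U. U \<subseteq> susp_class X \<phi> ` (topspace X \<times> UNIV) \<and>
    openin (prod_topology X euclideanreal) (?P U)"
  have "istopology ?Q"
    unfolding istopology_def
  proof (intro conjI allI impI)
    fix S T assume "?Q S" "?Q T"
    moreover have "?P (S \<inter> T) = ?P S \<inter> ?P T"
      by blast
    ultimately show "openin (prod_topology X euclideanreal) (?P (S \<inter> T))"
      by (metis (no_types, lifting) openin_Int)
  next
    fix K assume "\<forall>U\<in>K. ?Q U"
    moreover have "?P (\<Union>K) = \<Union>(?P ` K)"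
      by blast
    ultimately show "openin (prod_topology X euclideanreal) (?P (\<Union>K))"
      by (metis (no_types, lifting) image_iff openin_Union)
  qed blast+
  then show ?thesis
    by (simp add: suspension_def topology_inverse')
qed

lemma topspace_suspension:
  "topspace (suspension X \<phi>) = susp_class X \<phi> ` (topspace X \<times> UNIV)"
proof
  show "topspace (suspension X \<phi>) \<subseteq> susp_class X \<phi> ` (topspace X \<times> UNIV)"
    using openin_suspension openin_topspace by blast
  have "{p \<in> topspace X \<times> UNIV. susp_class X \<phi> p \<in> susp_class X \<phi> ` (topspace X \<times> UNIV)}
      = topspace (prod_topology X euclideanreal)"
    by auto
  then have "openin (suspension X \<phi>) (susp_class X \<phi> ` (topspace X \<times> UNIV))"
    unfolding openin_suspension by (metis (lifting) openin_topspace order_refl)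
  then show "susp_class X \<phi> ` (topspace X \<times> UNIV) \<subseteq> topspace (suspension X \<phi>)"
    by (rule openin_subset)
qed

lemma quotient_map_susp_class:
  "quotient_map (prod_topology X euclideanreal) (suspension X \<phi>) (susp_class X \<phi>)"
  by (auto simp: quotient_map_def topspace_suspension openin_suspension)

section \<open>Homeomorphism groups\<close>

text \<open>As in \<^const>\<open>BijGroup\<close>, group elements are the maps extensional on \<open>topspace X\<close>, so that
  distinct elements are distinct as homeomorphisms.\<close>

definition homeo_group :: "'a topology \<Rightarrow> ('a \<Rightarrow> 'a) monoid" where
  "homeo_group X =
     BijGroup (topspace X)\<lparr>carrier := {g \<in> Bij (topspace X). homeomorphic_map X X g}\<rparr>"

lemma group_homeo_group: "group (homeo_group X)"
proof -
  interpret B: group "BijGroup (topspace X)"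
    by (rule group_BijGroup)
  have "subgroup {g \<in> Bij (topspace X). homeomorphic_map X X g} (BijGroup (topspace X))"
  proof (rule B.subgroupI)
    show "{g \<in> Bij (topspace X). homeomorphic_map X X g} \<subseteq> carrier (BijGroup (topspace X))"
      by (auto simp: BijGroup_def)
    have "homeomorphic_map X X (\<lambda>x\<in>topspace X. x)"
      by (rule homeomorphic_map_eq[OF homeomorphic_map_id[THEN iffD2]]) auto
    then show "{g \<in> Bij (topspace X). homeomorphic_map X X g} \<noteq> {}"
      using id_Bij by blast
  next
    fix g assume g: "g \<in> {g \<in> Bij (topspace X). homeomorphic_map X X g}"
    then obtain h where h: "homeomorphic_maps X X g h"
      by (auto simp: homeomorphic_map_maps)
    have "bij_betw g (topspace X) (topspace X)"
      using g by (auto simp: Bij_def)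
    then have "h x = restrict (inv_into (topspace X) g) (topspace X) x" if "x \<in> topspace X" for x
      using h that unfolding homeomorphic_maps_def bij_betw_def
      by (metis continuous_map_image_subset_topspace image_subset_iff inv_into_f_f restrict_apply')
    then have "homeomorphic_map X X (restrict (inv_into (topspace X) g) (topspace X))"
      using h homeomorphic_map_eq homeomorphic_map_maps homeomorphic_maps_sym by metis
    then show "inv\<^bsub>BijGroup (topspace X)\<^esub> g \<in> {g \<in> Bij (topspace X). homeomorphic_map X X g}"
      using g by (simp add: inv_BijGroup restrict_inv_into_Bij)
  next
    fix g h
    assume g: "g \<in> {g \<in> Bij (topspace X). homeomorphic_map X X g}"
      and h: "h \<in> {g \<in> Bij (topspace X). homeomorphic_map X X g}"
    have "homeomorphic_map X X (compose (topspace X) g h)"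
      by (rule homeomorphic_map_eq[OF homeomorphic_map_compose[of X X h X g]])
        (use g h in \<open>auto simp: compose_def\<close>)
    then show "g \<otimes>\<^bsub>BijGroup (topspace X)\<^esub> h \<in> {g \<in> Bij (topspace X). homeomorphic_map X X g}"
      using g h by (simp add: BijGroup_def compose_Bij)
  qed
  then show ?thesis
    unfolding homeo_group_def by (rule subgroup.subgroup_is_group[OF _ group_BijGroup])
qed

definition isotopic_to_id :: "'a topology \<Rightarrow> ('a \<Rightarrow> 'a) \<Rightarrow> bool" where
  "isotopic_to_id Y g \<longleftrightarrow> homotopic_with (homeomorphic_map Y Y) Y Y id g"

definition H0 :: "'a topology \<Rightarrow> ('a \<Rightarrow> 'a) \<Rightarrow> (('a \<times> real) set \<Rightarrow> ('a \<times> real) set) set" where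
  "H0 X \<phi> = {g \<in> carrier (homeo_group (suspension X \<phi>)). isotopic_to_id (suspension X \<phi>) g}"

section \<open>Charts\<close>

text \<open>\<open>Inf {} = \<infinity>\<close> in \<^typ>\<open>enat\<close>.\<close>

definition return_time :: "('a \<Rightarrow> 'a) \<Rightarrow> 'a set \<Rightarrow> enat" where
  "return_time \<phi> C = Inf {enat n |n. 1 \<le> n \<and> (\<exists>x\<in>C. (\<phi> ^^ n) x \<in> C)}"

text \<open>The interval \<open>J\<close> of a chart is \<open>{a<..<b}\<close>; only bounded intervals are needed, because
  dyadic intervals are bounded.\<close>

definition is_chart :: "'a topology \<Rightarrow> ('a \<Rightarrow> 'a) \<Rightarrow> 'a set \<Rightarrow> real \<Rightarrow> real \<Rightarrow> bool" where
  "is_chart X \<phi> C a b \<longleftrightarrow>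
     openin X C \<and> closedin X C \<and> a < b \<and> ereal (b - a) < ereal_of_enat (return_time \<phi> C)"

abbreviation domain_of ::
    "'a topology \<Rightarrow> ('a \<Rightarrow> 'a) \<Rightarrow> 'a set \<Rightarrow> real \<Rightarrow> real \<Rightarrow> ('a \<times> real) set set" where
  "domain_of X \<phi> C a b \<equiv> susp_class X \<phi> ` (C \<times> {a<..<b})"

section \<open>Dyadic piecewise linear homeomorphisms\<close>

definition dyadic_rats :: "real set" where
  "dyadic_rats = {of_int p / 2 powi q |p q. True}"

text \<open>\<open>f\<close> is a dyadic PL homeomorphism from \<open>{a<..<b}\<close> onto \<open>{c<..<d}\<close>; the finite set
  \<open>B\<close> contains the breakpoints, and the affine pieces are the components of its complement.\<close>

definition dyadic_PL_homeo :: "real \<Rightarrow> real \<Rightarrow> real \<Rightarrow> real \<Rightarrow> (real \<Rightarrow> real) \<Rightarrow> bool" where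
  "dyadic_PL_homeo a b c d f \<longleftrightarrow>
     {a, b, c, d} \<subseteq> dyadic_rats \<and> a < b \<and> c < d \<and>
     homeomorphic_map (top_of_set {a<..<b}) (top_of_set {c<..<d}) f \<and>
     (\<exists>B. finite B \<and> B \<subseteq> dyadic_rats \<and>
        (\<forall>K \<in> components ({a<..<b} - B).
           \<exists>m::int. \<exists>\<beta>\<in>dyadic_rats. \<forall>t\<in>K. f t = 2 powi m * t + \<beta>))"

section \<open>The group \<open>T(\<phi>)\<close>\<close>

definition T_carrier ::
    "'a topology \<Rightarrow> ('a \<Rightarrow> 'a) \<Rightarrow> (('a \<times> real) set \<Rightarrow> ('a \<times> real) set) set" where
  "T_carrier X \<phi> = {g \<in> H0 X \<phi>.
     \<forall>y \<in> topspace (suspension X \<phi>).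
       \<exists>C a b c d f.
         is_chart X \<phi> C a b \<and> y \<in> domain_of X \<phi> C a b \<and>
         dyadic_PL_homeo a b c d f \<and> is_chart X \<phi> C c d \<and>
         g ` domain_of X \<phi> C a b = domain_of X \<phi> C c d \<and>
         (\<forall>x\<in>C. \<forall>t\<in>{a<..<b}.
            inv_into (C \<times> {c<..<d}) (susp_class X \<phi>) (g (susp_class X \<phi> (x, t))) = (x, f t))}"

definition T_group ::
    "'a topology \<Rightarrow> ('a \<Rightarrow> 'a) \<Rightarrow> (('a \<times> real) set \<Rightarrow> ('a \<times> real) set) monoid" where
  "T_group X \<phi> = homeo_group (suspension X \<phi>)\<lparr>carrier := T_carrier X \<phi>\<rparr>"

abbreviation circle :: "complex topology" where
  "circle \<equiv> top_of_set (sphere 0 1)"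

end

theory Submission
  imports Defs
begin

text \<open>
  An element of \<open>T(\<phi>)\<close> moves each point along its leaf, so it is a family \<open>F x\<close> of dyadic PL
  homeomorphisms of the line, locally constant in \<open>x\<close> and equivariant. For a point \<open>y\<close> of the
  suspension let \<open>K\<^sub>y\<close> be the group of the elements that are the identity near \<open>y\<close>.

  Cutting the suspension along a small clopen transversal through \<open>y\<close> shows that \<open>K\<^sub>y\<close> is perfect
  and that each of its finite subsets has arbitrarily many commuting conjugates. If \<open>w\<close> is a product
  of \<open>m\<close> commutators of lifts to the line, then so is the product of \<open>N\<close> commuting conjugates of
  \<open>w\<close>, which therefore displaces points by at most \<open>2m\<close>; hence \<open>w\<close> cannot displace all points by
  \<open>1\<close>. So the commutator subgroup of the lifts of \<open>K\<^sub>y\<close> has bounded orbits, and \<open>K\<^sub>y\<close> fixes a point of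
  the circle. In particular each element of \<open>K\<^sub>y\<close> has a canonical lift, the one with a fixed point.

  Let \<open>y\<^sub>1\<close>, \<open>y\<^sub>2\<close>, \<open>y\<^sub>3\<close> lie in different leaves. Since the segment from \<open>y\<^sub>3\<close> to its image under \<open>g\<close> lies
  in a leaf that avoids \<open>y\<^sub>1\<close> and \<open>y\<^sub>2\<close>, each \<open>g\<close> factors as \<open>k k'\<close> with \<open>k\<close> in \<open>K\<close> of \<open>y\<^sub>1\<close> and of \<open>y\<^sub>2\<close>, and
  \<open>k'\<close> in \<open>K\<close> of \<open>y\<^sub>3\<close>. This makes the product of the canonical lifts of \<open>k\<close> and \<open>k'\<close> independent of
  the choices and of the order of the three points. The canonical lifts thus extend to a homomorphic
  lift of the whole group with displacements at most \<open>2\<close>, and a bounded orbit gives a fixed point.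
\<close>

section \<open>Dyadic piecewise linear homeomorphisms of the line\<close>

text \<open>Perfectness is the delicate point. Thompson's group \<open>F\<close> of dyadic PL
  homeomorphisms of an interval is not perfect: the slopes at the two ends survive in its
  abelianization. Supports are therefore kept away from the ends of intervals, and
  \<open>K\<^sub>y\<close> asks for the identity near \<open>y\<close>, not merely at
  \<open>y\<close>. The compactly supported maps of the line form a perfect group because the
  doublings of unit intervals, Thompson's generators, are congruent to each other modulo
  commutators.

  The action is not assumed to preserve orientation. Products of commutators preserve it, and the
  factorization into elements of perfect groups spreads this to the whole group.

  The third point is the free slot that lets the factors from the other two groups exchange places,
  as is required to multiply two factorizations. Three leaves exist because an infinite minimal
  system has no isolated point and is thus uncountable, by Baire.

  The computations take place in a group of families of maps of the line that maps onto T(phi), and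
  the action is pulled back to it.\<close>

abbreviation "D \<equiv> dyadic_rats"

abbreviation finv :: "('b \<Rightarrow> 'c) \<Rightarrow> 'c \<Rightarrow> 'b" where
  "finv \<equiv> inv_into UNIV"

section \<open>Arithmetic of the dyadic rationals\<close>

lemma dyadic_ratsI: "of_int p / 2 powi q \<in> D"
  by (auto simp: dyadic_rats_def)

lemma dyadic_rats_nat_denominator:
  assumes "x \<in> D" obtains p k where "x = of_int p / 2 ^ k"
proof -
  obtain p q where x: "x = of_int p / 2 powi q"
    using assms by (auto simp: dyadic_rats_def)
  show ?thesis
  proof (cases "0 \<le> q")
    case True
    then show ?thesis using that[of p "nat q"] x by (simp add: power_int_def)
  next
    case False
    then have "x = of_int (p * 2 ^ nat (- q)) / 2 ^ 0"
      using x by (simp add: power_int_def field_simps)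
    then show ?thesis using that by blast
  qed
qed

lemma dyadic_rats_common_denominator:
  assumes "finite A" "A \<subseteq> D"
  obtains k where "\<And>x. x \<in> A \<Longrightarrow> x * 2 ^ k \<in> \<int>"
proof -
  have "\<exists>k. \<forall>x\<in>A. x * 2 ^ k \<in> \<int>"
    using assms
  proof (induction A)
    case (insert a A)
    then obtain k where k: "\<forall>x\<in>A. x * 2 ^ k \<in> \<int>" by auto
    obtain p l where a: "a = of_int p / 2 ^ l"
      using insert.prems dyadic_rats_nat_denominator by blast
    have "a * 2 ^ (l + k) = of_int p * 2 ^ k"
      by (simp add: a power_add)
    moreover have "x * 2 ^ (l + k) = (x * 2 ^ k) * 2 ^ l" for x :: real
      by (simp add: power_add)
    ultimately have "\<forall>x\<in>insert a A. x * 2 ^ (l + k) \<in> \<int>"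
      using k by (metis Ints_mult Ints_numeral Ints_of_int Ints_power insert_iff)
    then show ?case by blast
  qed auto
  then show ?thesis using that by blast
qed

lemma dyadic_rats_iff: "x \<in> D \<longleftrightarrow> (\<exists>k. x * 2 ^ k \<in> \<int>)"
proof
  assume "x \<in> D"
  then obtain p k where "x = of_int p / 2 ^ k" by (rule dyadic_rats_nat_denominator)
  then have "x * 2 ^ k = of_int p" by simp
  then show "\<exists>k. x * 2 ^ k \<in> \<int>" by (metis Ints_of_int)
next
  assume "\<exists>k. x * 2 ^ k \<in> \<int>"
  then obtain k p where "x * 2 ^ k = of_int p" by (auto elim: Ints_cases)
  then have "x = of_int p / 2 powi int k" by (simp add: field_simps)
  then show "x \<in> D" using dyadic_ratsI by blast
qed

lemma dyadic_rats_add [intro, simp]: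
  assumes "x \<in> D" "y \<in> D" shows "x + y \<in> D"
proof -
  obtain k where "x * 2 ^ k \<in> \<int>" "y * 2 ^ k \<in> \<int>"
    using assms by (rule_tac dyadic_rats_common_denominator[of "{x, y}"]) auto
  then have "(x + y) * 2 ^ k \<in> \<int>" by (simp add: distrib_right)
  then show ?thesis using dyadic_rats_iff by blast
qed

lemma dyadic_rats_mult [intro, simp]:
  assumes "x \<in> D" "y \<in> D" shows "x * y \<in> D"
proof -
  obtain k where "x * 2 ^ k \<in> \<int>" "y * 2 ^ k \<in> \<int>"
    using assms by (rule_tac dyadic_rats_common_denominator[of "{x, y}"]) auto
  then have "(x * 2 ^ k) * (y * 2 ^ k) \<in> \<int>" by (rule Ints_mult)
  then have "(x * y) * 2 ^ (k + k) \<in> \<int>" by (simp add: power_add mult_ac)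
  then show ?thesis using dyadic_rats_iff by blast
qed

lemma dyadic_rats_minus [intro, simp]: "x \<in> D \<Longrightarrow> - x \<in> D"
  by (simp add: dyadic_rats_iff)

lemma dyadic_rats_diff [intro, simp]: "x \<in> D \<Longrightarrow> y \<in> D \<Longrightarrow> x - y \<in> D"
  using dyadic_rats_add[of x "- y"] by simp

lemma dyadic_rats_of_int [intro, simp]: "of_int n \<in> D"
  using dyadic_ratsI[of n 0] by simp

lemma dyadic_rats_of_nat [intro, simp]: "of_nat n \<in> D"
  using dyadic_rats_of_int[of "int n"] by simp

lemma dyadic_rats_numeral [intro, simp]: "0 \<in> D" "1 \<in> D" "numeral n \<in> D"
  using dyadic_rats_of_nat[of 0] dyadic_rats_of_nat[of 1] dyadic_rats_of_nat[of "numeral n"]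
  by simp_all

lemma dyadic_rats_powi [intro, simp]: "2 powi m \<in> D"
  using dyadic_ratsI[of 1 "- m"] by (simp add: power_int_minus field_simps)

lemma dyadic_rats_between:
  assumes "a < b" obtains x where "x \<in> D" "a < x" "x < b"
proof -
  obtain k where k: "(1/2::real) ^ k < b - a"
    using real_arch_pow_inv[of "b - a" "1/2"] assms by auto
  define p where "p = \<lfloor>a * 2 ^ k\<rfloor> + 1"
  have 1: "a * 2 ^ k < p" "p \<le> a * 2 ^ k + 1"
    unfolding p_def by linarith+
  have "1 < (b - a) * 2 ^ k"
    using k by (simp add: power_one_over field_simps)
  with 1 have "of_int p < b * 2 ^ k" by (simp add: left_diff_distrib)
  with 1 have "a < of_int p / 2 powi int k" "of_int p / 2 powi int k < b"
    by (simp_all add: field_simps)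
  then show ?thesis using that dyadic_ratsI by blast
qed

section \<open>Dyadic germs and the dyadic homeomorphisms of the line\<close>

text \<open>A pointwise form of \<open>dyadic_PL_homeo\<close>. It allows infinitely many
  breakpoints as long as they do not accumulate, as happens along a whole leaf. Both affine formulas
  hold at \<open>t\<close> itself, which forces continuity, and the last clause lets the formula
  change only at dyadic points.\<close>

definition dyadic_germ :: "(real \<Rightarrow> real) \<Rightarrow> real \<Rightarrow> bool" where
  "dyadic_germ f t \<longleftrightarrow> (\<exists>e>0. \<exists>m m'::int. \<exists>\<beta>\<in>D. \<exists>\<beta>'\<in>D.
     (\<forall>s. t - e < s \<and> s \<le> t \<longrightarrow> f s = 2 powi m * s + \<beta>) \<and>
     (\<forall>s. t \<le> s \<and> s < t + e \<longrightarrow> f s = 2 powi m' * s + \<beta>') \<and>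
     (t \<in> D \<or> m = m' \<and> \<beta> = \<beta>'))"

text \<open>The germs have positive slopes, which makes these maps strictly increasing. Surjectivity
  does not follow from the germs, since the slopes may decay fast enough to bound the image.\<close>

definition PLD :: "(real \<Rightarrow> real) set" where
  "PLD = {f. surj f \<and> (\<forall>t. dyadic_germ f t)}"

lemma dyadic_germI:
  assumes "0 < e" "\<beta> \<in> D" "\<beta>' \<in> D"
    and "\<And>s. t - e < s \<Longrightarrow> s \<le> t \<Longrightarrow> f s = 2 powi m * s + \<beta>"
    and "\<And>s. t \<le> s \<Longrightarrow> s < t + e \<Longrightarrow> f s = 2 powi m' * s + \<beta>'"
    and "t \<in> D \<or> m = m' \<and> \<beta> = \<beta>'"
  shows "dyadic_germ f t"
  unfolding dyadic_germ_def using assms by blast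

lemma dyadic_germE:
  assumes "dyadic_germ f t"
  obtains e m m' \<beta> \<beta>' where "0 < e" "\<beta> \<in> D" "\<beta>' \<in> D"
    "\<And>s. t - e < s \<Longrightarrow> s \<le> t \<Longrightarrow> f s = 2 powi m * s + \<beta>"
    "\<And>s. t \<le> s \<Longrightarrow> s < t + e \<Longrightarrow> f s = 2 powi m' * s + \<beta>'"
    "t \<in> D \<or> m = m' \<and> \<beta> = \<beta>'"
  using assms unfolding dyadic_germ_def by blast

lemma dyadic_germ_cong:
  assumes "dyadic_germ f t" "0 < d" "\<And>s. \<bar>s - t\<bar> < d \<Longrightarrow> g s = f s"
  shows "dyadic_germ g t"
proof -
  obtain e m m' \<beta> \<beta>' where *: "0 < e" "\<beta> \<in> D" "\<beta>' \<in> D"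
    "\<And>s. t - e < s \<Longrightarrow> s \<le> t \<Longrightarrow> f s = 2 powi m * s + \<beta>"
    "\<And>s. t \<le> s \<Longrightarrow> s < t + e \<Longrightarrow> f s = 2 powi m' * s + \<beta>'"
    "t \<in> D \<or> m = m' \<and> \<beta> = \<beta>'"
    using assms(1) by (rule dyadic_germE) blast
  show ?thesis
    by (rule dyadic_germI[of "min e d" \<beta> \<beta>' t g m m']) (use * assms in auto)
qed

lemma dyadic_germ_affine:
  assumes "\<beta> \<in> D" shows "dyadic_germ (\<lambda>s. 2 powi m * s + \<beta>) t"
  by (rule dyadic_germI[of 1 \<beta> \<beta> t _ m m]) (use assms in auto)

lemma dyadic_germ_id: "dyadic_germ (\<lambda>s. s) t"
  using dyadic_germ_affine[of 0 0 t] by simp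

lemma powi_pos [simp]: "0 < (2::real) powi m"
  by (simp add: zero_less_power_int)

lemma dyadic_germ_strict_mono_near:
  assumes "dyadic_germ f t"
  obtains e where "0 < e" "\<And>r s. t - e < r \<Longrightarrow> r < s \<Longrightarrow> s < t + e \<Longrightarrow> f r < f s"
proof -
  obtain e m m' \<beta> \<beta>' where *: "0 < e"
    "\<And>s. t - e < s \<Longrightarrow> s \<le> t \<Longrightarrow> f s = 2 powi m * s + \<beta>"
    "\<And>s. t \<le> s \<Longrightarrow> s < t + e \<Longrightarrow> f s = 2 powi m' * s + \<beta>'"
    using assms by (rule dyadic_germE) blast
  have l: "f r < f s" if "t - e < r" "r < s" "s \<le> t" for r s
    using that *(2)[of r] *(2)[of s] by simp
  have r: "f r < f s" if "t \<le> r" "r < s" "s < t + e" for r s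
    using that *(3)[of r] *(3)[of s] by simp
  have "f r < f s" if "t - e < r" "r < s" "s < t + e" for r s
  proof (cases "s \<le> t \<or> t \<le> r")
    case False
    then show ?thesis using l[of r t] r[of t s] that by fastforce
  qed (use l r that in blast)
  then show ?thesis using that * by blast
qed

lemma dyadic_germs_strict_mono:
  assumes "\<And>t. dyadic_germ f t" shows "strict_mono f"
proof
  fix a b :: real assume "a < b"
  then have "a \<le> b" by simp
  \<comment> \<open>The local clause of the bisection principle includes degenerate intervals; the
    guard \<open>a < b\<close> makes the claim vacuous for them.\<close>
  then have "a < b \<longrightarrow> f a < f b"
  proof (induction rule: Bolzano)
    case (trans a b c)
    then show ?case by (metis less_le_trans less_trans order_le_less)
  next
    case (local x)
    obtain e where e: "0 < e" "\<And>r s. x - e < r \<Longrightarrow> r < s \<Longrightarrow> s < x + e \<Longrightarrow> f r < f s"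
      using dyadic_germ_strict_mono_near assms by metis
    show ?case
      by (rule exI[of _ e]) (use e in auto)
  qed
  then show "f a < f b" using \<open>a < b\<close> by simp
qed

lemma PLD_surj: "f \<in> PLD \<Longrightarrow> surj f"
  and PLD_germ: "f \<in> PLD \<Longrightarrow> dyadic_germ f t"
  and PLD_strict_mono: "f \<in> PLD \<Longrightarrow> strict_mono f"
  using dyadic_germs_strict_mono by (auto simp: PLD_def)

lemma PLD_inj: "f \<in> PLD \<Longrightarrow> inj f"
  and PLD_bij: "f \<in> PLD \<Longrightarrow> bij f"
  using PLD_strict_mono PLD_surj by (auto simp: bij_def strict_mono_imp_inj_on)

lemma PLD_less_iff [simp]: "f \<in> PLD \<Longrightarrow> f x < f y \<longleftrightarrow> x < y"
  and PLD_le_iff [simp]: "f \<in> PLD \<Longrightarrow> f x \<le> f y \<longleftrightarrow> x \<le> y"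
  and PLD_eq_iff [simp]: "f \<in> PLD \<Longrightarrow> f x = f y \<longleftrightarrow> x = y"
  using PLD_strict_mono
  by (auto simp: strict_mono_less strict_mono_less_eq strict_mono_eq)

lemma PLD_inv_f [simp]: "f \<in> PLD \<Longrightarrow> finv f (f x) = x"
  and PLD_f_inv [simp]: "f \<in> PLD \<Longrightarrow> f (finv f x) = x"
  using PLD_inj PLD_surj by (auto simp: surj_f_inv_f)

lemma PLD_continuous: "f \<in> PLD \<Longrightarrow> continuous_on UNIV f"
  by (rule continuous_onI_mono) (auto simp: PLD_surj)

lemma PLD_id [simp]: "id \<in> PLD" "(\<lambda>x. x) \<in> PLD"
  using dyadic_germ_id by (auto simp: PLD_def id_def)

lemma PLD_affine:
  assumes "\<beta> \<in> D" shows "(\<lambda>s. 2 powi m * s + \<beta>) \<in> PLD"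
proof -
  have "surj (\<lambda>s. 2 powi m * s + \<beta>)"
    by (rule surjI[of _ "\<lambda>y. (y - \<beta>) / 2 powi m"]) simp
  then show ?thesis using dyadic_germ_affine[OF assms] unfolding PLD_def by blast
qed

lemma PLD_translation: "\<beta> \<in> D \<Longrightarrow> (\<lambda>s. s + \<beta>) \<in> PLD"
  using PLD_affine[of \<beta> 0] by simp

lemma dyadic_rats_affine_iff:
  assumes "\<beta> \<in> D" shows "2 powi m * t + \<beta> \<in> D \<longleftrightarrow> t \<in> D"
proof
  assume "2 powi m * t + \<beta> \<in> D"
  then have "2 powi (- m) * (2 powi m * t + \<beta> - \<beta>) \<in> D" using assms by blast
  moreover have "2 powi (- m) * (2 powi m * t + \<beta> - \<beta>) = t"
    by (simp add: power_int_minus field_simps)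
  ultimately show "t \<in> D" by metis
qed (use assms in auto)

lemma dyadic_germ_value: "dyadic_germ f t \<Longrightarrow> f t \<in> D \<longleftrightarrow> t \<in> D"
  by (elim dyadic_germE) (simp add: dyadic_rats_affine_iff)

lemma PLD_dyadic_iff [simp]: "f \<in> PLD \<Longrightarrow> f t \<in> D \<longleftrightarrow> t \<in> D"
  by (simp add: PLD_germ dyadic_germ_value)

lemma dyadic_germ_comp:
  assumes f: "f \<in> PLD" and g: "dyadic_germ g (f t)"
  shows "dyadic_germ (g \<circ> f) t"
proof -
  obtain e m m' \<beta> \<beta>' where *: "0 < e" "\<beta> \<in> D" "\<beta>' \<in> D"
    "\<And>s. t - e < s \<Longrightarrow> s \<le> t \<Longrightarrow> f s = 2 powi m * s + \<beta>"
    "\<And>s. t \<le> s \<Longrightarrow> s < t + e \<Longrightarrow> f s = 2 powi m' * s + \<beta>'"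
    "t \<in> D \<or> m = m' \<and> \<beta> = \<beta>'"
    using PLD_germ[OF f, of t] by (rule dyadic_germE) blast
  obtain d n n' \<gamma> \<gamma>' where **: "0 < d" "\<gamma> \<in> D" "\<gamma>' \<in> D"
    "\<And>s. f t - d < s \<Longrightarrow> s \<le> f t \<Longrightarrow> g s = 2 powi n * s + \<gamma>"
    "\<And>s. f t \<le> s \<Longrightarrow> s < f t + d \<Longrightarrow> g s = 2 powi n' * s + \<gamma>'"
    "f t \<in> D \<or> n = n' \<and> \<gamma> = \<gamma>'"
    using g by (rule dyadic_germE) blast
  have "isCont f t"
    using PLD_continuous[OF f] by (simp add: continuous_on_eq_continuous_at)
  then obtain c where c: "0 < c" "\<And>s. \<bar>s - t\<bar> < c \<Longrightarrow> \<bar>f s - f t\<bar> < d"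
    using **(1) unfolding continuous_at_real_range by (metis real_norm_def)
  show ?thesis
  proof (rule dyadic_germI[of "min c e" "2 powi n * \<beta> + \<gamma>" "2 powi n' * \<beta>' + \<gamma>'" t _ "n + m" "n' + m'"])
    fix s assume s: "t - min c e < s" "s \<le> t"
    then have "\<bar>f s - f t\<bar> < d" "f s \<le> f t" using c(2)[of s] f by auto
    then show "(g \<circ> f) s = 2 powi (n + m) * s + (2 powi n * \<beta> + \<gamma>)"
      using **(4)[of "f s"] *(4)[of s] s by (simp add: power_int_add algebra_simps)
  next
    fix s assume s: "t \<le> s" "s < t + min c e"
    then have "\<bar>f s - f t\<bar> < d" "f t \<le> f s" using c(2)[of s] f by auto
    then show "(g \<circ> f) s = 2 powi (n' + m') * s + (2 powi n' * \<beta>' + \<gamma>')"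
      using **(5)[of "f s"] *(5)[of s] s by (simp add: power_int_add algebra_simps)
  next
    show "t \<in> D \<or> n + m = n' + m' \<and> 2 powi n * \<beta> + \<gamma> = 2 powi n' * \<beta>' + \<gamma>'"
      using *(6) **(6) PLD_germ[OF f] dyadic_germ_value by blast
  qed (use * ** c in auto)
qed

lemma PLD_I: "surj f \<Longrightarrow> (\<And>t. dyadic_germ f t) \<Longrightarrow> f \<in> PLD"
  unfolding PLD_def by blast

lemma PLD_comp [intro, simp]:
  assumes "f \<in> PLD" "g \<in> PLD" shows "g \<circ> f \<in> PLD"
proof (rule PLD_I)
  show "surj (g \<circ> f)" using assms by (intro comp_surj PLD_surj)
  show "dyadic_germ (g \<circ> f) t" for t
    using assms by (intro dyadic_germ_comp PLD_germ)
qed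

lemma PLD_inv [intro, simp]:
  assumes f: "f \<in> PLD" shows "finv f \<in> PLD"
proof -
  have "dyadic_germ (finv f) u" for u
  proof -
    define t where "t = finv f u"
    have u: "u = f t" using f by (simp add: t_def)
    obtain e m m' \<beta> \<beta>' where *: "0 < e" "\<beta> \<in> D" "\<beta>' \<in> D"
      "\<And>s. t - e < s \<Longrightarrow> s \<le> t \<Longrightarrow> f s = 2 powi m * s + \<beta>"
      "\<And>s. t \<le> s \<Longrightarrow> s < t + e \<Longrightarrow> f s = 2 powi m' * s + \<beta>'"
      "t \<in> D \<or> m = m' \<and> \<beta> = \<beta>'"
      using PLD_germ[OF f, of t] by (rule dyadic_germE) blast
    define d where "d = min (f t - f (t - e)) (f (t + e) - f t)"
    show ?thesis
    proof (rule dyadic_germI[of d "- (2 powi (-m) * \<beta>)" "- (2 powi (-m') * \<beta>')" u _ "-m" "-m'"])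
      show "0 < d" using PLD_strict_mono[OF f] *(1) by (simp add: d_def strict_monoD)
      fix s assume s: "u - d < s" "s \<le> u"
      define r where "r = finv f s"
      have r: "s = f r" using f by (simp add: r_def)
      have "f (t - e) < f r" "f r \<le> f t" using s by (auto simp: d_def r u)
      then have "t - e < r" "r \<le> t" using f by auto
      then have s': "s = 2 powi m * r + \<beta>" using * r by metis
      have "r = 2 powi (- m) * s + - (2 powi (- m) * \<beta>)"
        unfolding s' by (simp add: power_int_minus field_simps)
      then show "finv f s = 2 powi (- m) * s + - (2 powi (- m) * \<beta>)"
        by (simp add: r_def)
    next
      fix s assume s: "u \<le> s" "s < u + d"
      define r where "r = finv f s"
      have r: "s = f r" using f by (simp add: r_def)
      have "f r < f (t + e)" "f t \<le> f r" using s by (auto simp: d_def r u)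
      then have "r < t + e" "t \<le> r" using f by auto
      then have s': "s = 2 powi m' * r + \<beta>'" using * r by metis
      have "r = 2 powi (- m') * s + - (2 powi (- m') * \<beta>')"
        unfolding s' by (simp add: power_int_minus field_simps)
      then show "finv f s = 2 powi (- m') * s + - (2 powi (- m') * \<beta>')"
        by (simp add: r_def)
    qed (use * u f in auto)
  qed
  then show ?thesis
    using f PLD_inj by (auto simp: PLD_def inj_imp_surj_inv)
qed

lemma PLD_glue:
  assumes f: "f \<in> PLD" and g: "g \<in> PLD" and p: "p \<in> D" "f p = g p"
  shows "(\<lambda>t. if t \<le> p then f t else g t) \<in> PLD" (is "?h \<in> PLD")
proof -
  have "dyadic_germ ?h t" for t
  proof (cases t p rule: linorder_cases)
    case less
    then show ?thesis
      by (intro dyadic_germ_cong[OF PLD_germ[OF f], of "p - t"]) auto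
  next
    case greater
    then show ?thesis
      by (intro dyadic_germ_cong[OF PLD_germ[OF g], of "t - p"]) auto
  next
    case equal
    obtain e m \<beta> where *: "0 < e" "\<beta> \<in> D"
      "\<And>s. t - e < s \<Longrightarrow> s \<le> t \<Longrightarrow> f s = 2 powi m * s + \<beta>"
      using PLD_germ[OF f, of t] by (rule dyadic_germE) blast
    obtain d m' \<beta>' where **: "0 < d" "\<beta>' \<in> D"
      "\<And>s. t \<le> s \<Longrightarrow> s < t + d \<Longrightarrow> g s = 2 powi m' * s + \<beta>'"
      using PLD_germ[OF g, of t] by (rule dyadic_germE) blast
    show ?thesis
      by (rule dyadic_germI[of "min e d" \<beta> \<beta>' t _ m m'])
        (use * ** equal p in \<open>auto simp: min_def split: if_splits\<close>)
  qed
  moreover have "\<exists>t. y = ?h t" for y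
  proof (cases "y \<le> f p")
    case True
    then have "finv f y \<le> p" using f True PLD_le_iff[OF f, of "finv f y" p] by simp
    then have "y = ?h (finv f y)" using f by simp
    then show ?thesis by (rule exI)
  next
    case False
    then have "p < finv g y" using g p False PLD_less_iff[OF g, of p "finv g y"] by simp
    then have "y = ?h (finv g y)" using g by simp
    then show ?thesis by (rule exI)
  qed
  ultimately show ?thesis unfolding PLD_def surj_def by (intro CollectI conjI allI)
qed

text \<open>Thompson's generators, realized on the line with breakpoints at integers. They lengthen
  an interval \<open>[0, n]\<close> that contains \<open>[i, i + 1]\<close> by exactly 1, which
  serves first for interpolation and later for counting words.\<close>

definition unit_doubling :: "int \<Rightarrow> real \<Rightarrow> real" where
  "unit_doubling i t = (if t \<le> of_int i then t else if t \<le> of_int i + 1 then 2 * t - of_int i else t + 1)"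

lemma unit_doubling_PLD [simp]: "unit_doubling i \<in> PLD"
proof -
  have "(\<lambda>t. 2 powi 1 * t + (- of_int i)) \<in> PLD" "(\<lambda>t. t + 1) \<in> PLD"
    by (rule PLD_affine PLD_translation; simp)+
  then have "(\<lambda>t. 2 * t - of_int i) \<in> PLD" "(\<lambda>t. t + 1) \<in> PLD"
    by simp_all
  then have "(\<lambda>t. if t \<le> of_int i + 1 then 2 * t - of_int i else t + 1) \<in> PLD"
    by (rule PLD_glue) auto
  then have "(\<lambda>t. if t \<le> of_int i then t else (if t \<le> of_int i + 1 then 2 * t - of_int i else t + 1)) \<in> PLD"
    by (rule PLD_glue[OF PLD_id(2)]) auto
  then show ?thesis by (simp add: unit_doubling_def[abs_def])
qed

text \<open>Clearing denominators by a power of 2 turns the intervals into \<open>[0, n]\<close> and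
  \<open>[0, m]\<close> with integers \<open>n\<close> and \<open>m\<close>, and
  \<open>m - n\<close> doublings of \<open>[0, 1]\<close> stretch the first to the second. The
  contracting case is the inverse of an expanding one.\<close>

lemma PLD_two_point:
  assumes D: "a \<in> D" "b \<in> D" "c \<in> D" "d \<in> D" and lt: "a < b" "c < d"
  obtains f where "f \<in> PLD" "f a = c" "f b = d"
proof -
  have main: "\<exists>f\<in>PLD. f a = c \<and> f b = d"
    if D: "a \<in> D" "b \<in> D" "c \<in> D" "d \<in> D" and lt: "a < b" "c < d" "b - a \<le> d - c" for a b c d
  proof -
    obtain k where k: "(b - a) * 2 ^ k \<in> \<int>" "(d - c) * 2 ^ k \<in> \<int>"
      using D by (rule_tac dyadic_rats_common_denominator[of "{b - a, d - c}"]) auto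
    obtain n m where n: "(b - a) * 2 ^ k = of_int n" and m: "(d - c) * 2 ^ k = of_int m"
      using k by (meson Ints_cases)
    have "0 < (b - a) * 2 ^ k" using lt by simp
    then have n0: "1 \<le> n" using n by simp
    have "(b - a) * 2 ^ k \<le> (d - c) * 2 ^ k" using lt by simp
    then have nm: "n \<le> m" using n m by simp
    define g where "g = (\<lambda>t. 2 powi (int k) * t + - (2 powi (int k) * a))"
    define h where "h = (\<lambda>t. 2 powi (- int k) * t + c)"
    define l where "l j = (unit_doubling 0) ^^ j" for j
    have l: "l j \<in> PLD \<and> l j 0 = 0 \<and> l j (of_int n) = of_int (n + j)" for j
    proof (induction j)
      case 0
      then show ?case by (simp add: l_def)
    next
      case (Suc j)
      have "l (Suc j) = unit_doubling 0 \<circ> l j" by (simp add: l_def)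
      moreover have "unit_doubling 0 0 = 0" "unit_doubling 0 (of_int (n + j)) = of_int (n + Suc j)"
        using n0 by (simp_all add: unit_doubling_def)
      moreover have "unit_doubling 0 \<circ> l j \<in> PLD" using Suc by (intro PLD_comp) auto
      ultimately show ?case using Suc by (metis comp_apply)
    qed
    have "g \<in> PLD" "h \<in> PLD" unfolding g_def h_def by (rule PLD_affine, use D in blast)+
    then have "h \<circ> l (nat (m - n)) \<circ> g \<in> PLD" using l by auto
    moreover have "g a = 0" "g b = n" using n by (simp_all add: g_def algebra_simps)
    moreover have "h 0 = c" "h m = d"
      unfolding m[symmetric] by (simp_all add: h_def power_int_minus field_simps)
    ultimately show ?thesis using l nm by (intro bexI[of _ "h \<circ> l (nat (m - n)) \<circ> g"]) auto
  qed
  show ?thesis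
  proof (cases "b - a \<le> d - c")
    case True
    then show ?thesis using main[OF D lt] that by blast
  next
    case False
    then obtain f where "f \<in> PLD" "f c = a" "f d = b"
      using main[OF D(3,4,1,2) lt(2,1)] by auto
    then show ?thesis using that[of "finv f"] by auto
  qed
qed

definition supp_in :: "(real \<Rightarrow> real) \<Rightarrow> real \<Rightarrow> real \<Rightarrow> bool" where
  "supp_in f a b \<longleftrightarrow> (\<forall>t. t \<le> a \<or> b \<le> t \<longrightarrow> f t = t)"

text \<open>Two-point interpolation on \<open>[u, a]\<close> and \<open>[b, v]\<close> joins
  \<open>F\<close> to the identity. The glueing points must be dyadic, which is why applications
  first choose dyadic \<open>a\<close>, \<open>b\<close>, \<open>u\<close>,
  \<open>v\<close>.\<close>

lemma PLD_extend:
  assumes F: "F \<in> PLD" and D: "a \<in> D" "b \<in> D" "u \<in> D" "v \<in> D"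
    and "u < a" "u < F a" "a \<le> b" "b < v" "F b < v"
  obtains h where "h \<in> PLD" "\<And>t. a \<le> t \<Longrightarrow> t \<le> b \<Longrightarrow> h t = F t" "supp_in h u v"
proof -
  obtain G where G: "G \<in> PLD" "G u = u" "G a = F a"
    using PLD_two_point[of u a u "F a"] assms by auto
  obtain H where H: "H \<in> PLD" "H b = F b" "H v = v"
    using PLD_two_point[of b v "F b" v] assms by auto
  have "(\<lambda>t. if t \<le> v then H t else t) \<in> PLD" (is "?h1 \<in> _")
    using H D by (intro PLD_glue[of H]) auto
  then have "(\<lambda>t. if t \<le> b then F t else ?h1 t) \<in> PLD" (is "?h2 \<in> _")
    using H D F assms by (intro PLD_glue[of F]) auto
  then have "(\<lambda>t. if t \<le> a then G t else ?h2 t) \<in> PLD" (is "?h3 \<in> _")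
    using G D F assms by (intro PLD_glue[of G]) auto
  then have "(\<lambda>t. if t \<le> u then t else ?h3 t) \<in> PLD" (is "?h4 \<in> _")
    using G D assms by (intro PLD_glue[OF PLD_id(2)]) auto
  then show ?thesis
    by (rule that) (use assms G H in \<open>auto simp: supp_in_def\<close>)
qed

section \<open>Perfectness of the compactly supported dyadic group\<close>

text \<open>Formulated for an arbitrary set of functions, because it is applied both to groups of PL
  maps and to sets of lifts of circle maps.\<close>

inductive_set commprod :: "(real \<Rightarrow> real) set \<Rightarrow> (real \<Rightarrow> real) set" for P where
  id: "id \<in> commprod P"
| step: "a \<in> P \<Longrightarrow> b \<in> P \<Longrightarrow> w \<in> commprod P \<Longrightarrow> a \<circ> b \<circ> finv a \<circ> finv b \<circ> w \<in> commprod P"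

lemma commprod_comp: "w \<in> commprod P \<Longrightarrow> w' \<in> commprod P \<Longrightarrow> w \<circ> w' \<in> commprod P"
proof (induction rule: commprod.induct)
  case (step a b w)
  then have "a \<circ> b \<circ> finv a \<circ> finv b \<circ> (w \<circ> w') \<in> commprod P"
    by (intro commprod.step)
  then show ?case by (simp only: o_assoc)
qed auto

lemma commprod_commutator: "a \<in> P \<Longrightarrow> b \<in> P \<Longrightarrow> a \<circ> b \<circ> finv a \<circ> finv b \<in> commprod P"
  using commprod.step[OF _ _ commprod.id, of a P b] by simp

lemma commprod_mono:
  assumes "w \<in> commprod P" "P \<subseteq> P'" shows "w \<in> commprod P'"
  using assms by induction (auto intro: commprod.intros)

text \<open>The inverse of the commutator of \<open>a\<close> and \<open>b\<close> is the commutator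
  of \<open>b\<close> and \<open>a\<close>.\<close>

lemma commprod_finv:
  assumes "w \<in> commprod P" and bij: "\<And>a. a \<in> P \<Longrightarrow> bij a"
  shows "bij w \<and> finv w \<in> commprod P"
  using assms(1)
proof induction
  case id
  show ?case by (simp only: inv_id bij_id commprod.id)
next
  case (step a b w)
  have b: "bij a" "bij b" "bij (finv a)" "bij (finv b)"
    using step bij by (auto simp: bij_imp_bij_inv)
  have "finv (a \<circ> b \<circ> finv a \<circ> finv b \<circ> w) = finv w \<circ> (b \<circ> a \<circ> finv b \<circ> finv a)"
    using b step by (simp add: o_inv_distrib bij_comp inv_inv_eq o_assoc)
  moreover have "finv w \<circ> (b \<circ> a \<circ> finv b \<circ> finv a) \<in> commprod P"
    using step by (intro commprod_comp commprod_commutator) auto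
  moreover have "bij (a \<circ> b \<circ> finv a \<circ> finv b \<circ> w)"
    using b step by (intro bij_comp) auto
  ultimately show ?case by metis
qed

lemma commprod_conj:
  assumes "w \<in> commprod P" and c: "bij c"
    and P: "\<And>a. a \<in> P \<Longrightarrow> bij a" "\<And>a. a \<in> P \<Longrightarrow> c \<circ> a \<circ> finv c \<in> P'"
  shows "c \<circ> w \<circ> finv c \<in> commprod P'"
  using assms(1)
proof induction
  case id
  have "c \<circ> id \<circ> finv c = id" using c by (auto simp: bij_is_surj surj_f_inv_f fun_eq_iff)
  then show ?case using commprod.id by metis
next
  case (step a b w)
  let ?A = "c \<circ> a \<circ> finv c" and ?B = "c \<circ> b \<circ> finv c"
  have inv: "finv (c \<circ> a \<circ> finv c) = c \<circ> finv a \<circ> finv c" if "a \<in> P" for a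
    using c P(1)[OF that] by (simp add: o_inv_distrib bij_comp bij_imp_bij_inv inv_inv_eq o_assoc)
  have "finv c (c x) = x" for x using c by (simp add: bij_is_inj)
  then have "c \<circ> (a \<circ> b \<circ> finv a \<circ> finv b \<circ> w) \<circ> finv c
      = ?A \<circ> ?B \<circ> finv ?A \<circ> finv ?B \<circ> (c \<circ> w \<circ> finv c)"
    using inv step(1,2) by (simp add: fun_eq_iff)
  moreover have "?A \<circ> ?B \<circ> finv ?A \<circ> finv ?B \<circ> (c \<circ> w \<circ> finv c) \<in> commprod P'"
    using step P by (intro commprod.step)
  ultimately show ?case by metis
qed

section \<open>Supports and truncation\<close>

definition PLD_within :: "real \<Rightarrow> real \<Rightarrow> (real \<Rightarrow> real) set" where
  "PLD_within u v = {f \<in> PLD. \<exists>a b. u < a \<and> b < v \<and> supp_in f a b}"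

definition PLDc :: "(real \<Rightarrow> real) set" where
  "PLDc = {f \<in> PLD. \<exists>a b. supp_in f a b}"

lemma supp_in_mono: "supp_in f a b \<Longrightarrow> a' \<le> a \<Longrightarrow> b \<le> b' \<Longrightarrow> supp_in f a' b'"
  by (auto simp: supp_in_def)

lemma supp_in_comp: "supp_in f a b \<Longrightarrow> supp_in g a b \<Longrightarrow> supp_in (f \<circ> g) a b"
  by (auto simp: supp_in_def)

lemma supp_in_finv:
  assumes "f \<in> PLD" "supp_in f a b" shows "supp_in (finv f) a b"
  unfolding supp_in_def
proof (intro allI impI)
  fix t assume "t \<le> a \<or> b \<le> t"
  then have "f t = t" using assms by (auto simp: supp_in_def)
  then show "finv f t = t" using assms(1) by (metis PLD_inv_f)
qed

lemma supp_in_conj: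
  assumes "c \<in> PLD" "supp_in f a b" shows "supp_in (c \<circ> f \<circ> finv c) (c a) (c b)"
  unfolding supp_in_def
proof (intro allI impI)
  fix t assume "t \<le> c a \<or> c b \<le> t"
  then have "finv c t \<le> a \<or> b \<le> finv c t"
    using assms(1) PLD_le_iff[OF assms(1), of "finv c t" a] PLD_le_iff[OF assms(1), of b "finv c t"] by auto
  then show "(c \<circ> f \<circ> finv c) t = t" using assms by (auto simp: supp_in_def)
qed

lemma PLDcD: "f \<in> PLDc \<Longrightarrow> f \<in> PLD" by (simp add: PLDc_def)
lemma PLD_withinD: "f \<in> PLD_within u v \<Longrightarrow> f \<in> PLD" by (simp add: PLD_within_def)

lemma PLDc_bij: "f \<in> PLDc \<Longrightarrow> bij f"
  and PLD_within_bij: "f \<in> PLD_within u v \<Longrightarrow> bij f"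
  using PLDcD PLD_withinD PLD_bij by auto

lemma PLDc_conj:
  assumes "c \<in> PLD" "f \<in> PLDc" shows "c \<circ> f \<circ> finv c \<in> PLDc"
proof -
  have "c \<circ> f \<circ> finv c \<in> PLD" using assms PLDcD by (intro PLD_comp PLD_inv) auto
  then show ?thesis using supp_in_conj[OF assms(1)] assms(2) unfolding PLDc_def by blast
qed

lemma PLDc_finv: "f \<in> PLDc \<Longrightarrow> finv f \<in> PLDc"
  using supp_in_finv unfolding PLDc_def by blast

lemma PLD_within_finv: "f \<in> PLD_within u v \<Longrightarrow> finv f \<in> PLD_within u v"
  using supp_in_finv unfolding PLD_within_def by blast

lemma PLD_within_comp:
  assumes "f \<in> PLD_within u v" "g \<in> PLD_within u v" shows "f \<circ> g \<in> PLD_within u v"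
proof -
  obtain a b a' b' where *: "u < a" "b < v" "supp_in f a b" "u < a'" "b' < v" "supp_in g a' b'"
    using assms unfolding PLD_within_def by blast
  then have "supp_in f (min a a') (max b b')" "supp_in g (min a a') (max b b')"
    by (auto intro: supp_in_mono)
  then have "supp_in (f \<circ> g) (min a a') (max b b')" by (rule supp_in_comp)
  moreover have "u < min a a'" "max b b' < v" using * by auto
  moreover have "f \<circ> g \<in> PLD" using assms PLD_withinD by (intro PLD_comp) auto
  ultimately show ?thesis unfolding PLD_within_def by blast
qed

lemma PLD_within_id: "id \<in> PLD_within u v"
  unfolding PLD_within_def supp_in_def
  by (intro CollectI conjI exI[of _ "u + 1"] exI[of _ "v - 1"] PLD_id(1)) auto

lemma PLD_within_mono: "u' \<le> u \<Longrightarrow> v \<le> v' \<Longrightarrow> PLD_within u v \<subseteq> PLD_within u' v'"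
  unfolding PLD_within_def by (blast intro: le_less_trans less_le_trans)

lemma commprod_PLDc_conj:
  assumes "w \<in> commprod PLDc" "c \<in> PLD" shows "c \<circ> w \<circ> finv c \<in> commprod PLDc"
  using assms by (intro commprod_conj[of w PLDc]) (auto simp: PLD_bij PLDc_bij PLDc_conj)

lemma truncate_PLD:
  assumes f: "f \<in> PLD" and D: "a \<in> D" "b \<in> D" "a \<le> b"
  obtains p where "p \<in> PLDc" "\<And>t. a \<le> t \<Longrightarrow> t \<le> b \<Longrightarrow> p t = f t"
proof -
  define u where "u = real_of_int (\<lfloor>min a (f a)\<rfloor> - 1)"
  define v where "v = real_of_int (\<lceil>max b (f b)\<rceil> + 1)"
  have "u < min a (f a)" "max b (f b) < v" unfolding u_def v_def by linarith+
  then have "u < a" "u < f a" "b < v" "f b < v" by auto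
  moreover have "u \<in> D" "v \<in> D" unfolding u_def v_def by blast+
  ultimately obtain p where "p \<in> PLD" "\<And>t. a \<le> t \<Longrightarrow> t \<le> b \<Longrightarrow> p t = f t" "supp_in p u v"
    using PLD_extend[OF f D(1,2), of u v] D(3) by blast
  then show ?thesis using that unfolding PLDc_def by blast
qed

text \<open>Conjugating \<open>y\<close> only uses the values of the conjugator on the support of
  \<open>y\<close>. A doubling or an affine contraction can therefore be replaced by a compactly
  supported map with the same effect.\<close>

lemma conj_eq_if_agree_on_support:
  assumes f: "f \<in> PLD" and p: "p \<in> PLD" and y: "y \<in> PLD" "supp_in y a b"
    and eq: "\<And>t. a \<le> t \<Longrightarrow> t \<le> b \<Longrightarrow> p t = f t"
  shows "p \<circ> y \<circ> finv p = f \<circ> y \<circ> finv f"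
proof
  fix x
  have ab: "a \<le> y s" "y s \<le> b" if "a \<le> s" "s \<le> b" for s
  proof -
    have "y a \<le> y s" "y s \<le> y b" using that y by auto
    then show "a \<le> y s" "y s \<le> b" using y(2) by (auto simp: supp_in_def)
  qed
  define s where "s = finv p x"
  have x: "x = p s" using p by (simp add: s_def)
  show "(p \<circ> y \<circ> finv p) x = (f \<circ> y \<circ> finv f) x"
  proof (cases "a \<le> s \<and> s \<le> b")
    case True
    then have "finv f x = s" using x eq f by auto
    then show ?thesis using True ab[of s] eq s_def by auto
  next
    case False
    then have 1: "y s = s" using y(2) by (auto simp: supp_in_def)
    define r where "r = finv f x"
    have r: "x = f r" using f by (simp add: r_def)
    have "\<not> (a \<le> r \<and> r \<le> b)"
    proof
      assume "a \<le> r \<and> r \<le> b"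
      then have "p r = p s" using eq x r by auto
      then show False using p False \<open>a \<le> r \<and> r \<le> b\<close> by simp
    qed
    then have "y r = r" using y(2) by (auto simp: supp_in_def)
    then have "(f \<circ> y \<circ> finv f) x = x" using r f by (simp flip: r_def)
    moreover have "(p \<circ> y \<circ> finv p) x = x" using 1 x p by (simp flip: s_def)
    ultimately show ?thesis by simp
  qed
qed

section \<open>Doublings modulo commutators\<close>

text \<open>As \<open>i < j\<close>, the map \<open>unit_doubling i\<close> pushes
  \<open>[j, j + 1]\<close> to \<open>[j + 1, j + 2]\<close>, and this interval may be doubled
  before or after the push.\<close>

lemma unit_doubling_relation:
  assumes "i < j"
  shows "unit_doubling i \<circ> unit_doubling j = unit_doubling (j + 1) \<circ> unit_doubling i"
proof
  fix t :: real
  have "real_of_int i + 1 \<le> of_int j" using assms by linarith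
  then show "(unit_doubling i \<circ> unit_doubling j) t = (unit_doubling (j + 1) \<circ> unit_doubling i) t"
    by (auto simp: unit_doubling_def)
qed

text \<open>The \<open>unit_doubling i\<close> satisfy the relations of Thompson's group, hence are
  pairwise congruent modulo commutators; the relation
  \<open>x\<^sub>i y\<^sub>i x\<^sub>i\<inverse> = y\<^sub>i y\<^sub>i\<^sub>+\<^sub>1\<close> for \<open>y\<^sub>i = x\<^sub>i\<inverse> x\<^sub>i\<^sub>+\<^sub>1\<close> exhibits \<open>y\<^sub>i\<^sub>+\<^sub>1\<close> as a commutator of
  compactly supported elements.\<close>

lemma unit_doubling_quotient_Suc:
  "finv (unit_doubling i) \<circ> unit_doubling (i + 1) \<in> commprod PLDc"
proof -
  let ?x = unit_doubling
  define y where "y j = finv (?x j) \<circ> ?x (j + 1)" for j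
  have yPL: "y j \<in> PLD" for j
    unfolding y_def by (intro PLD_comp PLD_inv unit_doubling_PLD)
  have supp: "supp_in (y j) (of_int j) (of_int (j + 2))" for j
    unfolding supp_in_def
  proof (intro allI impI)
    fix t assume "t \<le> real_of_int j \<or> real_of_int (j + 2) \<le> t"
    then have "?x (j + 1) t = ?x j t" by (auto simp: unit_doubling_def)
    then show "y j t = t" by (simp add: y_def)
  qed
  \<comment> \<open>The quotient wanted is \<open>y (j + 1)\<close>. Indices are integers, so each
    one has a predecessor and no first quotient is left out.\<close>
  define j where "j = i - 1"
  \<comment> \<open>\<open>unit_doubling j\<close> is not compactly supported; \<open>p\<close>
    stands in for it on the support of \<open>y j\<close>.\<close>
  obtain p where p: "p \<in> PLDc" "\<And>t. of_int j \<le> t \<Longrightarrow> t \<le> of_int (j + 2) \<Longrightarrow> p t = ?x j t"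
    by (rule truncate_PLD[of "?x j" "of_int j" "of_int (j + 2)"]) auto
  have "p \<circ> y j \<circ> finv p = ?x j \<circ> y j \<circ> finv (?x j)"
    using p PLDcD yPL supp by (intro conj_eq_if_agree_on_support) auto
  also have "\<dots> = y j \<circ> y (j + 1)"
  proof
    fix t
    have "?x (j + 2) (?x j (finv (?x j) t)) = ?x j (?x (j + 1) (finv (?x j) t))"
      using unit_doubling_relation[of j "j + 1"] by (simp add: fun_eq_iff add.assoc)
    then have "finv (?x j) (?x (j + 2) t) = ?x (j + 1) (finv (?x j) t)" by simp
    then show "(?x j \<circ> y j \<circ> finv (?x j)) t = (y j \<circ> y (j + 1)) t"
      by (simp add: y_def add.assoc)
  qed
  finally have *: "p \<circ> y j \<circ> finv p = y j \<circ> y (j + 1)" .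
  have "finv (y j) \<circ> p \<circ> finv (finv (y j)) \<circ> finv p = finv (y j) \<circ> (p \<circ> y j \<circ> finv p)"
    using yPL PLD_bij by (simp add: inv_inv_eq o_assoc)
  also have "\<dots> = y (j + 1)"
    unfolding * using yPL by (simp add: fun_eq_iff)
  finally have "y (j + 1) = finv (y j) \<circ> p \<circ> finv (finv (y j)) \<circ> finv p" ..
  moreover have "y j \<in> PLDc" using yPL supp unfolding PLDc_def by blast
  ultimately have "y (j + 1) \<in> commprod PLDc"
    using commprod_commutator[of "finv (y j)" PLDc p] PLDc_finv p by metis
  then show ?thesis by (simp add: y_def j_def)
qed

lemma unit_doubling_quotient: "finv (unit_doubling i) \<circ> unit_doubling j \<in> commprod PLDc"
proof -
  let ?x = unit_doubling
  have le: "finv (?x i) \<circ> ?x j \<in> commprod PLDc" if "i \<le> j" for i j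
    using that
  proof (induction rule: int_ge_induct)
    case base
    have "finv (?x i) \<circ> ?x i = id" by (simp add: fun_eq_iff)
    then show ?case using commprod.id by metis
  next
    case (step k)
    have "finv (?x i) \<circ> ?x (k + 1) = (finv (?x i) \<circ> ?x k) \<circ> (finv (?x k) \<circ> ?x (k + 1))"
      by (simp add: fun_eq_iff)
    then show ?case using step unit_doubling_quotient_Suc[of k] commprod_comp by metis
  qed
  show ?thesis
  proof (cases "i \<le> j")
    case False
    then have "finv (finv (?x j) \<circ> ?x i) \<in> commprod PLDc"
      using le[of j i] commprod_finv PLDc_bij by fastforce
    moreover have "finv (finv (?x j) \<circ> ?x i) = finv (?x i) \<circ> ?x j"
      by (simp add: o_inv_distrib bij_imp_bij_inv PLD_bij inv_inv_eq)
    ultimately show ?thesis by metis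
  qed (rule le)
qed

inductive doubling_word :: "nat \<Rightarrow> (real \<Rightarrow> real) \<Rightarrow> bool" where
  Nil: "doubling_word 0 id"
| Cons: "doubling_word n f \<Longrightarrow> doubling_word (Suc n) (f \<circ> unit_doubling i)"

lemma doubling_word_PLD: "doubling_word n f \<Longrightarrow> f \<in> PLD"
proof (induction rule: doubling_word.induct)
  case (Cons n f i)
  then show ?case by (intro PLD_comp) auto
qed simp

text \<open>Modulo \<open>commprod PLDc\<close>, which conjugation by elements of \<open>PLD\<close>
  preserves, all doublings agree; so a word in them is determined by its length.\<close>

lemma doubling_word_quotient:
  assumes "doubling_word n f" "doubling_word n g" shows "finv f \<circ> g \<in> commprod PLDc"
  using assms
proof (induction arbitrary: g rule: doubling_word.induct)
  case Nil
  then have "g = id" by (cases rule: doubling_word.cases) auto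
  then show ?case by (simp only: inv_id comp_id commprod.id)
next
  case (Cons n f i)
  obtain g' j where g: "g = g' \<circ> unit_doubling j" "doubling_word n g'"
    using Cons.prems by (cases rule: doubling_word.cases) auto
  let ?z = "finv f \<circ> g'" and ?x = unit_doubling
  have "?z \<in> commprod PLDc" using Cons.IH g by blast
  then have "finv (?x i) \<circ> ?z \<circ> finv (finv (?x i)) \<in> commprod PLDc"
    by (intro commprod_PLDc_conj PLD_inv) auto
  then have "(finv (?x i) \<circ> ?z \<circ> ?x i) \<circ> (finv (?x i) \<circ> ?x j) \<in> commprod PLDc"
    using unit_doubling_quotient commprod_comp by (simp add: inv_inv_eq PLD_bij)
  moreover have "(finv (?x i) \<circ> ?z \<circ> ?x i) \<circ> (finv (?x i) \<circ> ?x j) = finv (f \<circ> ?x i) \<circ> g"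
    using doubling_word_PLD[OF Cons.hyps] PLD_bij
    by (simp add: g o_inv_distrib fun_eq_iff)
  ultimately show ?case by metis
qed

section \<open>Maps with prescribed slopes on unit intervals\<close>

text \<open>The continuous map that fixes the negative half line, has the listed powers of 2 as
  slopes on successive unit intervals, and has slope 1 afterwards.\<close>

fun expand :: "nat list \<Rightarrow> real \<Rightarrow> real" where
  "expand [] t = t"
| "expand (e # es) t = (if t \<le> 0 then t else if t \<le> 1 then 2 ^ e * t else 2 ^ e + expand es (t - 1))"

lemma expand_nonpos [simp]: "t \<le> 0 \<Longrightarrow> expand es t = t"
  by (cases es) auto

lemma expand_zeros: "set es \<subseteq> {0} \<Longrightarrow> expand es t = t"
  by (induction es arbitrary: t) auto

text \<open>Stretching a unit interval by \<open>2 ^ Suc k\<close> amounts to doubling it and then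
  stretching each of the two resulting unit intervals by \<open>2 ^ k\<close>.\<close>

lemma expand_split:
  "expand (xs @ Suc k # ys) t = expand (xs @ k # k # ys) (unit_doubling (int (length xs)) t)"
proof (induction xs arbitrary: t)
  case Nil
  show ?case by (auto simp: unit_doubling_def algebra_simps)
next
  case (Cons x xs)
  show ?case
  proof (cases "t \<le> 1")
    case True
    then have "unit_doubling (int (length (x # xs))) t = t" by (auto simp: unit_doubling_def)
    then show ?thesis using True by simp
  next
    case False
    then have "unit_doubling (int (length (x # xs))) t = unit_doubling (int (length xs)) (t - 1) + 1"
      and "unit_doubling (int (length xs)) (t - 1) > 0"
      by (auto simp: unit_doubling_def)
    then show ?thesis using False Cons[of "t - 1"] by simp
  qed
qed

text \<open>The sum is the total gain in length. Each application of \<open>expand_split\<close>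
  accounts for one unit of it, since \<open>2 ^ Suc k - 1 = 1 + 2 * (2 ^ k - 1)\<close>; hence the
  induction on the sum instead of the list.\<close>

lemma expand_doubling_word:
  "doubling_word (\<Sum>e\<leftarrow>es. 2 ^ e - 1) (expand es)"
proof (induction "\<Sum>e\<leftarrow>es. 2 ^ e - (1::nat)" arbitrary: es)
  case 0
  have "\<forall>e\<in>set es. 2 ^ e - (1::nat) = 0"
    using 0 by (metis (no_types, lifting) image_eqI list.set_map sum_list_eq_0_iff)
  have "e = 0" if "e \<in> set es" for e
  proof -
    have "2 ^ e \<le> (2::nat) ^ 0" using \<open>\<forall>e\<in>set es. _\<close> that by fastforce
    then show "e = 0" by (simp add: power_le_one_iff del: power_0)
  qed
  then have "expand es = id" by (intro ext) (auto intro: expand_zeros)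
  then show ?case using doubling_word.Nil 0 by metis
next
  case (Suc n)
  have "\<exists>e\<in>set es. e \<noteq> 0"
  proof (rule ccontr)
    assume "\<not> (\<exists>e\<in>set es. e \<noteq> 0)"
    then have "map (\<lambda>e. 2 ^ e - (1::nat)) es = map (\<lambda>_. 0) es" by (intro map_cong) auto
    then have "(\<Sum>e\<leftarrow>es. 2 ^ e - (1::nat)) = 0" by (simp only: sum_list_0)
    then show False using Suc.hyps(2) by linarith
  qed
  then obtain xs e ys where es: "es = xs @ e # ys" "e \<noteq> 0" by (metis split_list)
  then obtain k where k: "e = Suc k" by (metis not0_implies_Suc)
  let ?es = "xs @ k # k # ys"
  obtain q where q: "(2::nat) ^ k = Suc q" by (cases "(2::nat) ^ k") auto
  have "n = (\<Sum>e\<leftarrow>?es. 2 ^ e - (1::nat))"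
    using Suc.hyps(2) unfolding es k by (simp add: q)
  moreover from Suc.hyps(1)[OF this]
  have "doubling_word (Suc (\<Sum>e\<leftarrow>?es. 2 ^ e - 1)) (expand ?es \<circ> unit_doubling (int (length xs)))"
    by (rule doubling_word.Cons)
  moreover have "expand es = expand ?es \<circ> unit_doubling (int (length xs))"
    unfolding es k by (simp add: fun_eq_iff expand_split)
  ultimately show ?case using Suc.hyps(2) by metis
qed

lemma expand_on_unit:
  assumes "j < length es" "real j \<le> t" "t \<le> real j + 1"
  shows "expand es t = (\<Sum>i<j. 2 ^ (es ! i)) + 2 ^ (es ! j) * (t - real j)"
  using assms
proof (induction es arbitrary: j t)
  case (Cons e es)
  show ?case
  proof (cases j)
    case (Suc i)
    show ?thesis
    proof (cases "t = 1")
      case True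
      then have "i = 0" using Cons.prems Suc by simp
      then show ?thesis using True Suc by simp
    next
      case False
      then have "1 < t" using Cons.prems Suc by simp
      then have "expand (e # es) t = 2 ^ e + expand es (t - 1)" by simp
      also have "expand es (t - 1) = (\<Sum>i<i. 2 ^ (es ! i)) + 2 ^ (es ! i) * (t - 1 - real i)"
        using Cons.prems Suc by (intro Cons.IH) auto
      finally show ?thesis
        by (simp add: Suc sum.lessThan_Suc_shift algebra_simps del: sum.lessThan_Suc)
    qed
  qed (use Cons.prems in auto)
qed simp

lemma expand_beyond:
  assumes "real (length es) \<le> t"
  shows "expand es t = (\<Sum>i<length es. 2 ^ (es ! i)) + (t - real (length es))"
  using assms
proof (induction es arbitrary: t)
  case (Cons e es)
  show ?case
  proof (cases "t = 1")
    case True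
    then show ?thesis using Cons.prems by simp
  next
    case False
    then have "1 < t" using Cons.prems by simp
    then have "expand (e # es) t = 2 ^ e + expand es (t - 1)" by simp
    also have "expand es (t - 1) = (\<Sum>i<length es. 2 ^ (es ! i)) + (t - 1 - real (length es))"
      using Cons.prems by (intro Cons.IH) auto
    finally show ?thesis by (simp add: sum.lessThan_Suc_shift algebra_simps del: sum.lessThan_Suc)
  qed
qed simp

lemma expand_replicate:
  assumes "0 \<le> t" "t \<le> real n" shows "expand (replicate n l) t = 2 ^ l * t"
proof (cases "t = real n")
  case True
  then show ?thesis using expand_beyond[of "replicate n l" t] by (simp add: mult.commute)
next
  case False
  define j where "j = nat \<lfloor>t\<rfloor>"
  have "real j \<le> t" "t \<le> real j + 1" "j < n"
    using assms False unfolding j_def by linarith+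
  then show ?thesis using expand_on_unit[of j "replicate n l" t] by (simp add: algebra_simps)
qed

text \<open>With the target scaled by a power of \<open>2\<close>, a dyadic map that is affine on unit intervals
  multiplies their lengths by natural powers of \<open>2\<close>. Such an \<open>expand\<close> is a word in doublings, of a
  length determined by the total expansion.\<close>

lemma commprod_if_affine_on_units:
  assumes h: "h \<in> PLD" "supp_in h 0 (real n)"
    and aff: "\<And>j. j < n \<Longrightarrow> \<exists>m::int. \<exists>\<beta>. \<forall>t. real j \<le> t \<and> t \<le> real j + 1 \<longrightarrow> h t = 2 powi m * t + \<beta>"
  shows "h \<in> commprod PLDc"
proof -
  obtain m \<beta> where m: "h t = 2 powi (m j) * t + \<beta> j"
    if "j < n" "real j \<le> t" "t \<le> real j + 1" for j t
    using aff by metis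
  \<comment> \<open>A common bound for all \<open>\<bar>m j\<bar>\<close>: after multiplication by
    \<open>2 ^ L\<close> no exponent of a slope is negative.\<close>
  define L where "L = (\<Sum>j<n. nat \<bar>m j\<bar>)"
  define e where "e j = nat (m j + int L)" for j
  have e: "2 ^ L * 2 powi (m j) = (2::real) ^ e j" if "j < n" for j
  proof -
    have "nat \<bar>m j\<bar> \<le> L" unfolding L_def using that by (intro member_le_sum) auto
    then have "int (e j) = int L + m j" unfolding e_def by linarith
    then have "(2::real) powi int (e j) = 2 powi int L * 2 powi m j" by (simp add: power_int_add)
    then show ?thesis by simp
  qed
  define es where "es = map e [0..<n]"
  have es: "length es = n" "\<And>j. j < n \<Longrightarrow> es ! j = e j" by (auto simp: es_def)
  have h_fix: "h 0 = 0" "h (real n) = real n" using h(2) by (auto simp: supp_in_def)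
  have h_step: "h t = h (real j) + 2 powi (m j) * (t - real j)"
    if "j < n" "real j \<le> t" "t \<le> real j + 1" for j t
    using m[OF that] m[of j "real j"] that by (simp add: algebra_simps)
  have part: "2 ^ L * h (real j) = (\<Sum>i<j. 2 ^ e i)" if "j \<le> n" for j
    using that
  proof (induction j)
    case (Suc j)
    then have "h (real (Suc j)) = h (real j) + 2 powi (m j)"
      using h_step[of j "real (Suc j)"] by simp
    then show ?case using Suc e[of j] by (simp add: distrib_left)
  qed (simp add: h_fix)
  let ?R = "replicate n L"
  have eq: "expand ?R (h t) = expand es t" for t
  proof -
    consider "t \<le> 0" | "0 < t" "t < real n" | "real n \<le> t" by linarith
    then show ?thesis
    proof cases
      case 1
      then show ?thesis using h(2) by (simp add: supp_in_def)
    next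
      case 2
      define j where "j = nat \<lfloor>t\<rfloor>"
      have j: "real j \<le> t" "t \<le> real j + 1" "j < n"
        using 2 unfolding j_def by linarith+
      have "h 0 \<le> h t" "h t \<le> h (real n)" using h(1) 2 by auto
      then have "expand ?R (h t) = 2 ^ L * h t"
        using h_fix by (intro expand_replicate) auto
      also have "\<dots> = 2 ^ L * h (real j) + 2 ^ L * 2 powi (m j) * (t - real j)"
        unfolding h_step[OF j(3,1,2)] by (simp add: distrib_left mult.assoc)
      also have "\<dots> = (\<Sum>i<j. 2 ^ e i) + 2 ^ e j * (t - real j)"
        using part[of j] e j by simp
      also have "\<dots> = (\<Sum>i<j. 2 ^ (es ! i)) + 2 ^ (es ! j) * (t - real j)"
        using es j by simp
      also have "\<dots> = expand es t"
        using j es by (intro expand_on_unit[symmetric]) auto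
      finally show ?thesis .
    next
      case 3
      have "expand es t = (\<Sum>i<n. 2 ^ e i) + (t - real n)"
        using expand_beyond[of es t] 3 es by simp
      also have "\<dots> = 2 ^ L * real n + (t - real n)" using part[of n] h_fix by simp
      also have "\<dots> = expand ?R t"
        using expand_beyond[of ?R t] 3 by (simp add: mult.commute)
      finally have "expand es t = expand ?R t" .
      moreover have "h t = t" using 3 h(2) by (simp add: supp_in_def)
      ultimately show ?thesis by simp
    qed
  qed
  \<comment> \<open>The number of doublings is the length of the image of \<open>[0, n]\<close>
    minus \<open>n\<close>. Since \<open>h\<close> fixes 0 and \<open>n\<close>, both maps carry
    \<open>[0, n]\<close> onto an interval of length \<open>n * 2 ^ L\<close>, so the two words are
    equally long.\<close>
  have len: "(\<Sum>e\<leftarrow>xs. 2 ^ e - (1::nat)) + length xs = (\<Sum>e\<leftarrow>xs. 2 ^ e)" for xs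
  proof (induction xs)
    case (Cons a xs)
    have "(1::nat) \<le> 2 ^ a" by simp
    then show ?case using Cons unfolding list.map sum_list.Cons list.size by linarith
  qed simp
  have "real (\<Sum>e\<leftarrow>es. 2 ^ e) = (\<Sum>i<n. 2 ^ e i)"
    by (simp add: es_def sum_list_sum_nth atLeast0LessThan)
  also have "\<dots> = real (n * 2 ^ L)" using part[of n] h_fix by (simp add: mult.commute)
  finally have "(\<Sum>e\<leftarrow>es. 2 ^ e) = n * 2 ^ L" by linarith
  moreover have "(\<Sum>e\<leftarrow>?R. 2 ^ e) = n * (2::nat) ^ L" by (simp add: sum_list_replicate)
  ultimately have "(\<Sum>e\<leftarrow>es. 2 ^ e - (1::nat)) = (\<Sum>e\<leftarrow>?R. 2 ^ e - 1)"
    using len[of es] len[of ?R] es by simp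
  then have "finv (expand ?R) \<circ> expand es \<in> commprod PLDc"
    using doubling_word_quotient expand_doubling_word by metis
  moreover have "finv (expand ?R) \<circ> expand es = h"
    using doubling_word_PLD[OF expand_doubling_word[of ?R]] by (simp add: fun_eq_iff flip: eq)
  ultimately show ?thesis by simp
qed

section \<open>Perfectness on the line and on intervals\<close>

text \<open>Where the formula changes at \<open>x\<close>, the point \<open>x\<close> is dyadic and
  hence a vertex of every fine enough dyadic mesh. The bisection claim speaks of all
  \<open>k\<close> beyond a threshold, so that adjacent intervals can agree on one
  \<open>k\<close>.\<close>

lemma PLD_affine_on_mesh:
  assumes f: "f \<in> PLD" and "a \<le> b"
  obtains k where "\<And>j::int. j / 2 ^ k \<le> b \<Longrightarrow> a \<le> (real_of_int j + 1) / 2 ^ k \<Longrightarrow>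
    \<exists>m::int. \<exists>\<beta>. \<forall>t. j / 2 ^ k \<le> t \<and> t \<le> (real_of_int j + 1) / 2 ^ k \<longrightarrow> f t = 2 powi m * t + \<beta>"
proof -
  let ?A = "\<lambda>k j. \<exists>m::int. \<exists>\<beta>. \<forall>t. real_of_int j / 2 ^ k \<le> t \<and> t \<le> (real_of_int j + 1) / 2 ^ k \<longrightarrow> f t = 2 powi m * t + \<beta>"
  have "\<exists>K. \<forall>k\<ge>K. \<forall>j::int. j / 2 ^ k \<le> b \<and> a \<le> (real_of_int j + 1) / 2 ^ k \<longrightarrow> ?A k j"
    using \<open>a \<le> b\<close>
  proof (induction rule: Bolzano)
    case (trans a b c)
    then obtain K K' where
      "\<forall>k\<ge>K. \<forall>j::int. j / 2 ^ k \<le> b \<and> a \<le> (real_of_int j + 1) / 2 ^ k \<longrightarrow> ?A k j"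
      "\<forall>k\<ge>K'. \<forall>j::int. j / 2 ^ k \<le> c \<and> b \<le> (real_of_int j + 1) / 2 ^ k \<longrightarrow> ?A k j" by blast
    moreover have "j / 2 ^ k \<le> b \<or> b \<le> (real_of_int j + 1) / 2 ^ k" for j :: int and k :: nat
    proof -
      have "j / 2 ^ k \<le> ((real_of_int j + 1) / 2 ^ k :: real)" by (simp add: divide_right_mono)
      then show ?thesis by linarith
    qed
    ultimately show ?case by (intro exI[of _ "max K K'"]) (metis max.bounded_iff)
  next
    case (local x)
    obtain e m m' \<beta> \<beta>' where *: "0 < e"
      "\<And>s. x - e < s \<Longrightarrow> s \<le> x \<Longrightarrow> f s = 2 powi m * s + \<beta>"
      "\<And>s. x \<le> s \<Longrightarrow> s < x + e \<Longrightarrow> f s = 2 powi m' * s + \<beta>'"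
      "x \<in> D \<or> m = m' \<and> \<beta> = \<beta>'"
      using PLD_germ[OF f, of x] by (rule dyadic_germE) blast
    obtain K1 where K1: "(1/2::real) ^ K1 < e / 2"
      using real_arch_pow_inv[of "e / 2" "1/2"] * by auto
    obtain K2 where K2: "x \<in> D \<longrightarrow> x * 2 ^ K2 \<in> \<int>" using dyadic_rats_iff by blast
    have main: "?A k j" if k: "max K1 K2 \<le> k" and j: "j / 2 ^ k \<le> b" "a \<le> (real_of_int j + 1) / 2 ^ k"
      and ab: "a \<le> x" "x \<le> b" "b - a < e / 2" for a b k and j :: int
    proof -
      have "(1/2::real) ^ k \<le> (1/2) ^ K1" using k by (intro power_decreasing) auto
      then have small: "1 / 2 ^ k < e / 2" using K1 by (simp add: power_one_over)
      have sp: "(real_of_int j + 1) / 2 ^ k = j / 2 ^ k + 1 / (2 ^ k :: real)" by (simp add: add_divide_distrib)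
      have inner: "x - e < t \<and> t < x + e" if "j / 2 ^ k \<le> t" "t \<le> (real_of_int j + 1) / 2 ^ k" for t
        using that j ab small sp by linarith
      show ?thesis
      proof (cases "x \<in> D")
        case False
        then have "f t = 2 powi m * t + \<beta>" if "x - e < t" "t < x + e" for t
          using *(2)[of t] *(3)[of t] *(4) that by (cases "t \<le> x") auto
        then show ?thesis using inner by blast
      next
        case True
        then have "x * 2 ^ K2 * 2 ^ (k - K2) \<in> \<int>" using K2 by (auto intro!: Ints_mult)
        then have "x * 2 ^ k \<in> \<int>" using k by (simp flip: power_add add: mult.assoc)
        then obtain p where p: "x * 2 ^ k = of_int p" by (auto elim: Ints_cases)
        have "p \<le> j \<or> j + 1 \<le> p" by linarith
        then have "of_int p \<le> real_of_int j \<or> real_of_int j + 1 \<le> of_int p" by linarith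
        then have "x \<le> j / 2 ^ k \<or> (real_of_int j + 1) / 2 ^ k \<le> x"
          unfolding p[symmetric] by (simp add: field_simps)
        then show ?thesis
        proof
          assume "x \<le> j / 2 ^ k"
          then show ?thesis using inner *(3) by (meson order_trans)
        next
          assume "(real_of_int j + 1) / 2 ^ k \<le> x"
          then show ?thesis using inner *(2) by (meson order_trans)
        qed
      qed
    qed
    have "\<exists>K. \<forall>k\<ge>K. \<forall>j::int. j / 2 ^ k \<le> b \<and> a \<le> (real_of_int j + 1) / 2 ^ k \<longrightarrow> ?A k j"
      if "a \<le> x \<and> x \<le> b \<and> b - a < e / 2" for a b
      using main that by blast
    moreover have "0 < e / 2" using *(1) by simp
    ultimately show ?case by blast
  qed
  then show ?thesis using that by blast
qed

text \<open>A dyadic affine map turns a mesh on which \<open>h\<close> is affine into the mesh of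
  unit intervals, and conjugation by affine maps preserves \<open>commprod PLDc\<close>.\<close>

lemma PLDc_perfect:
  assumes "h \<in> PLDc" shows "h \<in> commprod PLDc"
proof -
  obtain a b where h: "h \<in> PLD" "supp_in h a b" using assms unfolding PLDc_def by blast
  define W where "W = nat \<lceil>max \<bar>a\<bar> \<bar>b\<bar>\<rceil>"
  have W: "- real W \<le> a" "b \<le> real W" unfolding W_def by linarith+
  then have supp: "supp_in h (- real W) (real W)" using h supp_in_mono by blast
  have "- real W \<le> real W" by simp
  then obtain k where k: "\<And>j::int. j / 2 ^ k \<le> real W \<Longrightarrow> - real W \<le> (real_of_int j + 1) / 2 ^ k \<Longrightarrow>
    \<exists>m::int. \<exists>\<beta>. \<forall>t. j / 2 ^ k \<le> t \<and> t \<le> (real_of_int j + 1) / 2 ^ k \<longrightarrow> h t = 2 powi m * t + \<beta>"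
    using PLD_affine_on_mesh[OF h(1)] by blast
  define A where "A = (\<lambda>t. 2 powi (int k) * t + 2 powi (int k) * real W)"
  have A: "A \<in> PLD" unfolding A_def by (rule PLD_affine) blast
  have finvA: "finv A t = t / 2 ^ k - real W" for t
  proof -
    have "A (t / 2 ^ k - real W) = t" by (simp add: A_def field_simps)
    then show ?thesis using A by (metis PLD_inv_f)
  qed
  let ?H = "A \<circ> h \<circ> finv A"
  let ?n = "2 * W * 2 ^ k"
  have "?H \<in> commprod PLDc"
  proof (rule commprod_if_affine_on_units)
    show "?H \<in> PLD" using A h by (intro PLD_comp PLD_inv)
    have "A (- real W) = 0" "A (real W) = real ?n" by (simp_all add: A_def)
    then show "supp_in ?H 0 (real ?n)" using supp_in_conj[OF A supp] by simp
    fix j assume j: "j < ?n"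
    let ?j = "int j - int W * 2 ^ k"
    have "real j < real ?n" using j by (simp only: of_nat_less_iff)
    then have jr: "real j \<le> 2 * real W * 2 ^ k" by simp
    have "?j / 2 ^ k \<le> real W" "- real W \<le> (real_of_int ?j + 1) / 2 ^ k"
      using jr by (simp_all add: field_simps)
    then obtain m \<beta> where m: "\<forall>t. ?j / 2 ^ k \<le> t \<and> t \<le> (real_of_int ?j + 1) / 2 ^ k \<longrightarrow> h t = 2 powi m * t + \<beta>"
      using k by blast
    have "?H t = 2 powi m * t + (2 ^ k * (\<beta> - 2 powi m * real W) + 2 ^ k * real W)"
      if "real j \<le> t" "t \<le> real j + 1" for t
    proof -
      have "?j / 2 ^ k \<le> t / 2 ^ k - real W" "t / 2 ^ k - real W \<le> (real_of_int ?j + 1) / 2 ^ k"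
        using that by (simp_all add: field_simps)
      then have "h (t / 2 ^ k - real W) = 2 powi m * (t / 2 ^ k - real W) + \<beta>" using m by blast
      then show ?thesis by (simp add: finvA) (simp add: A_def field_simps)
    qed
    then show "\<exists>m::int. \<exists>\<beta>. \<forall>t. real j \<le> t \<and> t \<le> real j + 1 \<longrightarrow> ?H t = 2 powi m * t + \<beta>"
      by blast
  qed
  then have "finv A \<circ> ?H \<circ> finv (finv A) \<in> commprod PLDc"
    by (rule commprod_PLDc_conj) (rule PLD_inv[OF A])
  moreover have "finv A \<circ> ?H \<circ> finv (finv A) = h"
    using A PLD_bij by (simp add: inv_inv_eq fun_eq_iff)
  ultimately show ?thesis by metis
qed

lemma commprod_PLDc_bounded:
  assumes "w \<in> commprod PLDc" obtains N :: nat where "w \<in> commprod (PLD_within (- real N) (real N))"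
proof -
  have mono: "PLD_within (- real N) (real N) \<subseteq> PLD_within (- real M) (real M)" if "N \<le> M" for N M
    using that by (intro PLD_within_mono) auto
  have bd: "\<exists>N::nat. a \<in> PLD_within (- real N) (real N)" if "a \<in> PLDc" for a
  proof -
    obtain u v where uv: "a \<in> PLD" "supp_in a u v"
      using \<open>a \<in> PLDc\<close> unfolding PLDc_def by blast
    let ?N = "nat (\<lceil>max \<bar>u\<bar> \<bar>v\<bar>\<rceil> + 1)"
    have "- real ?N < u" "v < real ?N" by linarith+
    then show ?thesis using uv unfolding PLD_within_def by blast
  qed
  have "\<exists>N::nat. w \<in> commprod (PLD_within (- real N) (real N))"
    using assms
  proof induction
    case id
    then show ?case using commprod.id by blast
  next
    case (step a b w)
    obtain N1 N2 N3 :: nat where N: "a \<in> PLD_within (- real N1) (real N1)"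
      "b \<in> PLD_within (- real N2) (real N2)" "w \<in> commprod (PLD_within (- real N3) (real N3))"
      using bd step by blast
    let ?N = "max N1 (max N2 N3)"
    have le: "N1 \<le> ?N" "N2 \<le> ?N" "N3 \<le> ?N" by auto
    have "a \<in> PLD_within (- real ?N) (real ?N)" "b \<in> PLD_within (- real ?N) (real ?N)"
      "w \<in> commprod (PLD_within (- real ?N) (real ?N))"
      using N mono[OF le(1)] mono[OF le(2)] commprod_mono[OF N(3) mono[OF le(3)]] by blast+
    then show ?case using commprod.step by blast
  qed
  then show ?thesis using that by blast
qed

text \<open>Squeezing the line into \<open>(u,v)\<close> by an affine map turns commutators of compactly supported
  elements into commutators of elements supported in \<open>(u,v)\<close>.\<close>

lemma PLD_within_perfect:
  assumes h: "h \<in> PLD_within u v" and D: "u \<in> D" "v \<in> D" "u < v"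
  shows "h \<in> commprod (PLD_within u v)"
proof -
  obtain a0 b0 where ab0: "h \<in> PLD" "u < a0" "b0 < v" "supp_in h a0 b0"
    using h unfolding PLD_within_def by blast
  obtain a where a: "a \<in> D" "u < a" "a < min a0 v" using dyadic_rats_between[of u "min a0 v"] ab0 D by auto
  obtain b where b: "b \<in> D" "max b0 a < b" "b < v" using dyadic_rats_between[of "max b0 a" v] ab0 a by auto
  have supp: "supp_in h a b" using supp_in_mono ab0 a b by simp
  have ab: "a \<le> b" using b by simp
  have "h \<in> PLDc" using ab0 unfolding PLDc_def by blast
  then obtain N0 :: nat where N0: "h \<in> commprod (PLD_within (- real N0) (real N0))"
    using PLDc_perfect commprod_PLDc_bounded by blast
  \<comment> \<open>The window \<open>(-N, N)\<close> is made to contain \<open>[u, v]\<close> too,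
    hence the support \<open>[a, b]\<close> of \<open>h\<close>.\<close>
  define N where "N = max N0 (nat (\<lceil>max \<bar>u\<bar> \<bar>v\<bar>\<rceil> + 1))"
  have "h \<in> commprod (PLD_within (- real N) (real N))"
    by (rule commprod_mono[OF N0 PLD_within_mono]) (auto simp: N_def)
  have N: "- real N < u" "v < real N" unfolding N_def by linarith+
  \<comment> \<open>At this scale the map \<open>A\<close> below, centred at the midpoint of
    \<open>(u, v)\<close>, sends the window strictly inside \<open>(u, v)\<close>.\<close>
  obtain k where k: "(1/2::real) ^ k < (v - u) / (2 * (real N + 1))"
    using real_arch_pow_inv[of "(v - u) / (2 * (real N + 1))" "1/2"] D by auto
  then have "real N * (1/2) ^ k < (v - u) / 2"
  proof -
    have "real N * (1/2) ^ k \<le> (real N + 1) * (1/2) ^ k" by simp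
    also have "\<dots> < (real N + 1) * ((v - u) / (2 * (real N + 1)))"
      using k by (intro mult_strict_left_mono) auto
    also have "\<dots> = (v - u) / 2"
      by (simp add: field_simps add_nonneg_eq_0_iff)
    finally show ?thesis .
  qed
  define mid where "mid = 2 powi (- 1) * (u + v)"
  define A where "A = (\<lambda>t. 2 powi (- int k) * t + mid)"
  have A: "A \<in> PLD" unfolding A_def mid_def
    using D by (intro PLD_affine dyadic_rats_mult dyadic_rats_powi dyadic_rats_add)
  have sc: "2 powi (- int k) = (1/2::real) ^ k" by (simp add: power_int_minus power_one_over field_simps)
  have "mid = (u + v) / 2" by (simp add: mid_def power_int_minus field_simps)
  then have AN: "u < A (- real N)" "A (real N) < v"
    using \<open>real N * (1/2) ^ k < _\<close> unfolding A_def sc by argo+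
  have "A (- real N) < A a" "A b < A (real N)" using A N a b by auto
  with AN have Aab: "u < A a" "A b < v" by linarith+
  obtain u' where u': "u' \<in> D" "u < u'" "u' < min a (A a)"
    using dyadic_rats_between[of u "min a (A a)"] a Aab by auto
  obtain v' where v': "v' \<in> D" "max b (A b) < v'" "v' < v"
    using dyadic_rats_between[of "max b (A b)" v] b Aab by auto
  \<comment> \<open>Undoing the conjugation with \<open>finv A\<close>, which expands, could lead
    out of \<open>(u, v)\<close>. The map \<open>c\<close> has the same effect on \<open>h\<close>
    and belongs to \<open>PLD_within u v\<close>, so conjugating back with it keeps all commutator
    entries inside.\<close>
  obtain c where c: "c \<in> PLD" "\<And>t. a \<le> t \<Longrightarrow> t \<le> b \<Longrightarrow> c t = A t" "supp_in c u' v'"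
    using PLD_extend[OF A a(1) b(1) u'(1) v'(1)] u' v' ab by auto
  then have cw: "c \<in> PLD_within u v" using u' v' unfolding PLD_within_def by blast
  have conj: "c \<circ> h \<circ> finv c = A \<circ> h \<circ> finv A"
    using A c(1) ab0(1) supp c(2) by (rule conj_eq_if_agree_on_support)
  have "A \<circ> h \<circ> finv A \<in> commprod (PLD_within u v)"
    using \<open>h \<in> commprod (PLD_within (- real N) (real N))\<close>
  proof (rule commprod_conj)
    show "bij A" using A by (rule PLD_bij)
    show "bij f" if "f \<in> PLD_within (- real N) (real N)" for f using that by (rule PLD_within_bij)
    fix f assume "f \<in> PLD_within (- real N) (real N)"
    then obtain r s where f: "f \<in> PLD" "- real N < r" "s < real N" "supp_in f r s"
      unfolding PLD_within_def by blast
    have "A (- real N) < A r" "A s < A (real N)" using f A by auto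
    then have "u < A r" "A s < v" using AN by linarith+
    moreover have "A \<circ> f \<circ> finv A \<in> PLD" using A f by (intro PLD_comp PLD_inv)
    ultimately show "A \<circ> f \<circ> finv A \<in> PLD_within u v"
      using supp_in_conj[OF A f(4)] unfolding PLD_within_def by blast
  qed
  then have "c \<circ> h \<circ> finv c \<in> commprod (PLD_within u v)" by (simp only: conj)
  then have "finv c \<circ> (c \<circ> h \<circ> finv c) \<circ> finv (finv c) \<in> commprod (PLD_within u v)"
  proof (rule commprod_conj)
    show "bij (finv c)" using c by (intro PLD_bij PLD_inv)
    show "bij f" if "f \<in> PLD_within u v" for f using that by (rule PLD_within_bij)
    show "finv c \<circ> f \<circ> finv (finv c) \<in> PLD_within u v" if "f \<in> PLD_within u v" for f
      using that cw by (intro PLD_within_comp PLD_within_finv)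
  qed
  moreover have "finv c \<circ> (c \<circ> h \<circ> finv c) \<circ> finv (finv c) = h"
    using c PLD_bij by (simp add: inv_inv_eq fun_eq_iff)
  ultimately show ?thesis by metis
qed

section \<open>Groups of lifts of circle homeomorphisms\<close>

text \<open>Lifts of orientation-preserving circle homeomorphisms; continuity is implied, as an
  increasing surjection of the line is continuous.\<close>

definition circle_lifts :: "(real \<Rightarrow> real) set" where
  "circle_lifts = {h. strict_mono h \<and> surj h \<and> (\<forall>x. h (x + 1) = h x + 1)}"

lemma circle_liftsD:
  assumes "h \<in> circle_lifts"
  shows "strict_mono h" "surj h" "h (x + 1) = h x + 1" "bij h" "finv h (h x) = x" "h (finv h x) = x"
    "h x < h y \<longleftrightarrow> x < y" "h x \<le> h y \<longleftrightarrow> x \<le> y"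
  using assms
  by (auto simp: circle_lifts_def bij_def strict_mono_imp_inj_on strict_mono_less strict_mono_less_eq
      surj_f_inv_f)

lemma circle_lifts_add_nat: "h \<in> circle_lifts \<Longrightarrow> h (x + real n) = h x + real n"
proof (induction n)
  case (Suc n)
  then show ?case using circle_liftsD(3)[of h "x + real n"] by (simp add: algebra_simps)
qed simp

lemma circle_lifts_add_int:
  assumes "h \<in> circle_lifts" shows "h (x + of_int k) = h x + of_int k"
proof (cases "0 \<le> k")
  case True
  then show ?thesis using circle_lifts_add_nat[OF assms, of x "nat k"] by simp
next
  case False
  then show ?thesis using circle_lifts_add_nat[OF assms, of "x + of_int k" "nat (- k)"] by simp
qed

lemma circle_lifts_id: "id \<in> circle_lifts"
  unfolding circle_lifts_def by (auto simp: strict_mono_def)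

lemma circle_lifts_comp:
  assumes "f \<in> circle_lifts" "g \<in> circle_lifts" shows "f \<circ> g \<in> circle_lifts"
  using assms comp_surj[of g f] unfolding circle_lifts_def by (auto simp: strict_mono_def)

lemma circle_lifts_finv:
  assumes h: "h \<in> circle_lifts" shows "finv h \<in> circle_lifts"
proof -
  have "finv h x < finv h y" if "x < y" for x y
    using that circle_liftsD(7)[OF h, of "finv h x" "finv h y"] circle_liftsD(6)[OF h] by simp
  moreover have "finv h (x + 1) = finv h x + 1" for x
    using circle_liftsD(3,5,6)[OF h] by metis
  moreover have "surj (finv h)" using circle_liftsD(4)[OF h] by (simp add: bij_is_inj inj_imp_surj_inv)
  ultimately show ?thesis unfolding circle_lifts_def strict_mono_def by blast
qed

text \<open>Displacement is 1-periodic, so \<open>y\<close> may be taken in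
  \<open>(x - 1, x]\<close>; monotonicity then traps \<open>h x\<close> between \<open>h y\<close>
  and \<open>h y + 1\<close>.\<close>

lemma circle_lifts_displacement:
  assumes h: "h \<in> circle_lifts" shows "\<bar>(h x - x) - (h y - y)\<bar> < 1"
proof -
  define k where "k = \<lfloor>x - y\<rfloor>"
  have k: "y + of_int k \<le> x" "x < y + of_int k + 1" unfolding k_def by linarith+
  have "h (y + of_int k) \<le> h x" "h x < h (y + of_int k + 1)" using k h by (auto simp: circle_liftsD(7,8))
  then have "h y + of_int k \<le> h x" "h x < h y + of_int k + 1"
    using circle_lifts_add_int[OF h] circle_liftsD(3)[OF h] by auto
  then show ?thesis using k by linarith
qed

section \<open>Commutator words with commuting entries\<close>

definition commute :: "('b \<Rightarrow> 'b) \<Rightarrow> ('b \<Rightarrow> 'b) \<Rightarrow> bool" where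
  "commute f g \<longleftrightarrow> (\<forall>x. f (g x) = g (f x))"

lemma commute_sym: "commute f g \<Longrightarrow> commute g f"
  by (simp add: commute_def)

lemma commute_comp: "commute f g \<Longrightarrow> commute f h \<Longrightarrow> commute f (g \<circ> h)"
  by (simp add: commute_def)

lemma commute_finv: "commute f g \<Longrightarrow> bij g \<Longrightarrow> commute f (finv g)"
  unfolding commute_def by (metis bij_inv_eq_iff)

lemma commute_id: "commute f id"
  by (simp add: commute_def)

text \<open>Unlike membership in \<open>commprod\<close>, a list retains the number of commutators,
  and this number bounds the displacement.\<close>

fun commutator_word :: "((real \<Rightarrow> real) \<times> (real \<Rightarrow> real)) list \<Rightarrow> real \<Rightarrow> real" where
  "commutator_word [] = id"
| "commutator_word ((a, b) # ps) = a \<circ> b \<circ> finv a \<circ> finv b \<circ> commutator_word ps"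

lemma commprod_imp_word:
  "w \<in> commprod P \<Longrightarrow> \<exists>ps. set ps \<subseteq> P \<times> P \<and> w = commutator_word ps"
proof (induction rule: commprod.induct)
  case id
  show ?case by (rule exI[of _ "[]"]) simp
next
  case (step a b w)
  then obtain ps where "set ps \<subseteq> P \<times> P" "w = commutator_word ps" by blast
  then show ?case using step by (intro exI[of _ "(a, b) # ps"]) simp
qed

text \<open>With \<open>q = finv a (finv b x)\<close>, \<open>p = a q\<close> and
  \<open>x = b p\<close>, the displacement is a difference of two displacements of \<open>a\<close>
  plus a difference of two displacements of \<open>b\<close>, each below 1.\<close>

lemma commutator_displacement:
  assumes a: "a \<in> circle_lifts" and b: "b \<in> circle_lifts"
  shows "\<bar>a (b (finv a (finv b x))) - x\<bar> \<le> 2"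
proof -
  define p q where "p = finv b x" and "q = finv a (finv b x)"
  have "x = b p" "p = a q" using a b by (simp_all add: p_def q_def circle_liftsD)
  moreover have "\<bar>(a (b q) - b q) - (a q - q)\<bar> < 1" "\<bar>(b q - q) - (b p - p)\<bar> < 1"
    using a b circle_lifts_displacement by blast+
  moreover have "a (b (finv a (finv b x))) = a (b q)" by (simp add: q_def)
  ultimately show ?thesis by linarith
qed

lemma commutator_word_displacement:
  assumes "set ps \<subseteq> circle_lifts \<times> circle_lifts"
  shows "\<bar>commutator_word ps x - x\<bar> \<le> 2 * real (length ps)"
  using assms
proof (induction ps)
  case (Cons p ps)
  obtain a b where p: "p = (a, b)" by force
  have "\<bar>a (b (finv a (finv b (commutator_word ps x)))) - commutator_word ps x\<bar> \<le> 2"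
    using Cons.prems p by (intro commutator_displacement) auto
  moreover have "\<bar>commutator_word ps x - x\<bar> \<le> 2 * real (length ps)" using Cons by simp
  ultimately show ?case by (simp add: p)
qed simp

lemma commute_commutator_word:
  assumes "\<And>a b. (a, b) \<in> set ps \<Longrightarrow> commute f a \<and> commute f b \<and> bij a \<and> bij b"
  shows "commute f (commutator_word ps)"
  using assms
proof (induction ps)
  case (Cons p ps)
  obtain a b where p: "p = (a, b)" by force
  have "commute f (commutator_word ps)" by (rule Cons.IH) (use Cons.prems in auto)
  moreover have "commute f a" "commute f b" "bij a" "bij b" using Cons.prems[of a b] p by auto
  ultimately show ?case unfolding p commutator_word.simps
    by (intro commute_comp commute_finv)
qed (simp only: commutator_word.simps commute_id)

lemma commutator_comp_commuting:
  assumes bij: "bij a" "bij b" "bij c" "bij d"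
    and comm: "commute a c" "commute a d" "commute b c" "commute b d"
  shows "(a \<circ> c) \<circ> (b \<circ> d) \<circ> finv (a \<circ> c) \<circ> finv (b \<circ> d)
    = (a \<circ> b \<circ> finv a \<circ> finv b) \<circ> (c \<circ> d \<circ> finv c \<circ> finv d)"
proof -
  have i: "finv (a \<circ> c) = finv c \<circ> finv a" "finv (b \<circ> d) = finv d \<circ> finv b"
    using bij by (simp_all add: o_inv_distrib)
  have 1: "commute c a" "commute c b" "commute d a" "commute d b"
    using comm commute_sym by blast+
  then have 2: "commute c (finv a)" "commute c (finv b)" "commute d (finv a)" "commute d (finv b)"
    using bij commute_finv by blast+
  then have "commute (finv c) (finv a)" "commute (finv c) (finv b)"
    "commute (finv d) (finv a)" "commute (finv d) (finv b)"
    "commute (finv c) a" "commute (finv c) b"  "commute (finv d) a" "commute (finv d) b"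
    using bij commute_finv commute_sym 1 by metis+
  with 1 2 show ?thesis unfolding i by (simp add: fun_eq_iff commute_def)
qed

definition merge_words where "merge_words = map2 (\<lambda>(a, b) (c, d). (a \<circ> c, b \<circ> d))"

text \<open>The commutator of \<open>a c\<close> and \<open>b d\<close> splits into that of
  \<open>a\<close>, \<open>b\<close> and that of \<open>c\<close>, \<open>d\<close> when the pairs
  commute. Merging does not lengthen the word, so the displacement bound does not grow with the
  number of words merged.\<close>

lemma commutator_word_merge:
  assumes "length ps = length qs"
    and "\<And>a b. (a, b) \<in> set ps \<union> set qs \<Longrightarrow> bij a \<and> bij b"
    and "\<And>a b c d. (a, b) \<in> set ps \<Longrightarrow> (c, d) \<in> set qs \<Longrightarrow>
      commute a c \<and> commute a d \<and> commute b c \<and> commute b d"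
  shows "commutator_word (merge_words ps qs) = commutator_word ps \<circ> commutator_word qs"
  using assms
proof (induction ps qs rule: list_induct2)
  case (Cons p ps q qs)
  obtain a b c d where pq: "p = (a, b)" "q = (c, d)" by force
  have bij: "bij a" "bij b" "bij c" "bij d" using Cons.prems(1) pq by auto
  have comm: "commute a c" "commute a d" "commute b c" "commute b d"
    using Cons.prems(2)[of a b c d] pq by auto
  have cc: "commute c (commutator_word ps)" "commute d (commutator_word ps)"
  proof -
    have *: "commute a' c \<and> commute a' d \<and> commute b' c \<and> commute b' d \<and> bij a' \<and> bij b'"
      if "(a', b') \<in> set ps" for a' b'
      using Cons.prems(1)[of a' b'] Cons.prems(2)[of a' b' c d] that pq by auto
    show "commute c (commutator_word ps)" "commute d (commutator_word ps)"
      using * commute_sym by (blast intro!: commute_commutator_word)+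
  qed
  then have cc': "commute (commutator_word ps) (c \<circ> d \<circ> finv c \<circ> finv d)"
    using bij by (intro commute_comp commute_finv) (auto intro: commute_sym)
  have IH: "commutator_word (merge_words ps qs) = commutator_word ps \<circ> commutator_word qs"
  proof (rule Cons.IH)
    fix a b assume "(a, b) \<in> set ps \<union> set qs"
    then show "bij a \<and> bij b" using Cons.prems(1)[of a b] by auto
  next
    fix a b c d assume "(a, b) \<in> set ps" "(c, d) \<in> set qs"
    then show "commute a c \<and> commute a d \<and> commute b c \<and> commute b d"
      using Cons.prems(2)[of a b c d] by auto
  qed
  have "commutator_word (merge_words (p # ps) (q # qs))
     = (a \<circ> c) \<circ> (b \<circ> d) \<circ> finv (a \<circ> c) \<circ> finv (b \<circ> d) \<circ> commutator_word (merge_words ps qs)"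
    unfolding pq merge_words_def by simp
  also have "\<dots> = (a \<circ> b \<circ> finv a \<circ> finv b) \<circ> (c \<circ> d \<circ> finv c \<circ> finv d) \<circ> (commutator_word ps \<circ> commutator_word qs)"
    unfolding IH commutator_comp_commuting[OF bij comm] ..
  also have "\<dots> = commutator_word (p # ps) \<circ> commutator_word (q # qs)"
    using cc' unfolding pq commutator_word.simps commute_def by (simp add: fun_eq_iff)
  finally show ?case .
qed (simp add: merge_words_def)

text \<open>The fixed point is the supremum \<open>p\<close> of the orbit of 0. Invariance of the
  orbit gives \<open>p \<le> w p\<close> for every \<open>w\<close>, and the same for the inverse of
  \<open>w\<close> gives the other inequality.\<close>

lemma bounded_orbit_fixed_point:
  fixes W :: "(real \<Rightarrow> real) set"
  assumes ne: "W \<noteq> {}" and mono: "\<And>w. w \<in> W \<Longrightarrow> mono w"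
    and comp: "\<And>w v. w \<in> W \<Longrightarrow> v \<in> W \<Longrightarrow> w \<circ> v \<in> W"
    and inv: "\<And>w. w \<in> W \<Longrightarrow> \<exists>v\<in>W. \<forall>x. w (v x) = x"
    and bd: "\<And>w. w \<in> W \<Longrightarrow> w 0 \<le> c"
  obtains p where "\<And>w. w \<in> W \<Longrightarrow> w p = p"
proof -
  define p where "p = Sup ((\<lambda>w. w 0) ` W)"
  have bdd: "bdd_above ((\<lambda>w. w 0) ` W)" using bd by (auto intro!: bdd_aboveI2)
  have up: "u 0 \<le> p" if "u \<in> W" for u
    unfolding p_def using bdd that by (rule cSUP_upper2) auto
  have le: "p \<le> w p" if w: "w \<in> W" for w
  proof -
    obtain v where v: "v \<in> W" "\<And>x. w (v x) = x" using inv[OF w] by blast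
    have "u 0 \<le> w p" if "u \<in> W" for u
    proof -
      have "(v \<circ> u) 0 \<le> p" using that v comp up by blast
      then have "w (v (u 0)) \<le> w p" using mono[OF \<open>w \<in> W\<close>] by (auto dest: monoD)
      then show ?thesis using v by simp
    qed
    then show ?thesis unfolding p_def using ne by (intro cSUP_least)
  qed
  have "w p = p" if w: "w \<in> W" for w
  proof -
    obtain v where v: "v \<in> W" "\<And>x. w (v x) = x" using inv[OF w] by blast
    have "w p \<le> w (v p)" using le[OF v(1)] mono[OF w] by (auto dest: monoD)
    then show ?thesis using v le[OF w] by simp
  qed
  then show ?thesis using that by blast
qed

section \<open>Abstract groups with lifts to the line\<close>

inductive_set commutator_products :: "('g, 'm) monoid_scheme \<Rightarrow> 'g set \<Rightarrow> 'g set" for G K where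
  one: "\<one>\<^bsub>G\<^esub> \<in> commutator_products G K"
| step: "a \<in> K \<Longrightarrow> b \<in> K \<Longrightarrow> w \<in> commutator_products G K \<Longrightarrow>
    a \<otimes>\<^bsub>G\<^esub> b \<otimes>\<^bsub>G\<^esub> inv\<^bsub>G\<^esub> a \<otimes>\<^bsub>G\<^esub> inv\<^bsub>G\<^esub> b \<otimes>\<^bsub>G\<^esub> w \<in> commutator_products G K"

text \<open>\<open>L g\<close> plays the set of lifts of the circle homeomorphism given by
  \<open>g\<close>. Lifts are unique up to integer translations, and these commute with all lifts,
  so the lifts amount to a central extension of \<open>G\<close>.\<close>

locale circle_lifted_group = group G for G (structure) +
  fixes L :: "'a \<Rightarrow> (real \<Rightarrow> real) set"
  assumes L_sub: "g \<in> carrier G \<Longrightarrow> h \<in> L g \<Longrightarrow> h \<in> circle_lifts"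
    and L_ne: "g \<in> carrier G \<Longrightarrow> L g \<noteq> {}"
    and L_one: "id \<in> L \<one>"
    and L_mult: "g \<in> carrier G \<Longrightarrow> g' \<in> carrier G \<Longrightarrow> h \<in> L g \<Longrightarrow> h' \<in> L g' \<Longrightarrow> h \<circ> h' \<in> L (g \<otimes> g')"
    and L_inv: "g \<in> carrier G \<Longrightarrow> h \<in> L g \<Longrightarrow> finv h \<in> L (inv g)"
    and L_uniq: "g \<in> carrier G \<Longrightarrow> h \<in> L g \<Longrightarrow> h' \<in> L g \<Longrightarrow> \<exists>k::int. \<forall>x. h' x = h x + of_int k"
begin

text \<open>Lifts of commuting elements commute up to an integer translation \<open>k\<close>.
  Passing to the cube of \<open>b\<close> multiplies \<open>k\<close> by 3, while comparing
  displacements bounds the result by 2, so \<open>k = 0\<close>. For \<open>b\<close> itself that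
  bound would not exclude \<open>k = 1\<close>.\<close>

lemma commuting_lifts:
  assumes g: "g \<in> carrier G" "g' \<in> carrier G" "g \<otimes> g' = g' \<otimes> g" and a: "a \<in> L g" and b: "b \<in> L g'"
  shows "commute a b"
proof -
  have A: "a \<in> circle_lifts" and B: "b \<in> circle_lifts" using g a b L_sub by auto
  have "a \<circ> b \<in> L (g \<otimes> g')" "b \<circ> a \<in> L (g \<otimes> g')" using L_mult g a b by metis+
  then obtain k where "\<forall>x. (a \<circ> b) x = (b \<circ> a) x + of_int k"
    using L_uniq[of "g \<otimes> g'" "b \<circ> a" "a \<circ> b"] g by auto
  then have k: "a (b x) = b (a x) + of_int k" for x by simp
  have bb: "b (x + of_int k) = b x + of_int k" for x using circle_lifts_add_int[OF B] .
  have "a (b (b (b x))) = b (b (b (a x))) + 3 * of_int k" for x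
    by (simp only: k bb)
  moreover have "\<bar>(a (b (b (b 0))) - b (b (b 0))) - (a 0 - 0)\<bar> < 1"
    using circle_lifts_displacement[OF A] by blast
  moreover have "\<bar>((b \<circ> (b \<circ> b)) (a 0) - a 0) - ((b \<circ> (b \<circ> b)) 0 - 0)\<bar> < 1"
    by (rule circle_lifts_displacement) (intro circle_lifts_comp B)
  ultimately have "\<bar>3 * real_of_int k\<bar> < 2" by simp
  then have "k = 0" by linarith
  then show ?thesis using k by (simp add: commute_def)
qed

lemma commutator_products_fixed_point:
  assumes K: "K \<subseteq> carrier G"
    and displace: "\<And>S (N::nat). finite S \<Longrightarrow> S \<subseteq> K \<Longrightarrow> \<exists>t. (\<forall>i<N. t i \<in> carrier G) \<and>
      (\<forall>i<N. \<forall>j<N. i \<noteq> j \<longrightarrow> (\<forall>a\<in>S. \<forall>b\<in>S.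
        (t i \<otimes> a \<otimes> inv t i) \<otimes> (t j \<otimes> b \<otimes> inv t j) = (t j \<otimes> b \<otimes> inv t j) \<otimes> (t i \<otimes> a \<otimes> inv t i)))"
    and perfect: "K \<subseteq> commutator_products G K"
  obtains p where "\<And>k. k \<in> K \<Longrightarrow> \<exists>h\<in>L k. h p = p"
proof -
  define P where "P = (\<Union>k\<in>K. L k)"
  have P: "P \<subseteq> circle_lifts" unfolding P_def using L_sub K by blast
  have not_ge: "\<exists>x. w x < x + 1" if w: "w \<in> commprod P" for w
  proof (rule ccontr)
    assume "\<nexists>x. w x < x + 1"
    then have w1: "x + 1 \<le> w x" for x by (meson not_le)
    obtain ps where ps: "set ps \<subseteq> P \<times> P" "w = commutator_word ps"
      using commprod_imp_word[OF w] by blast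
    have "\<forall>h\<in>P. \<exists>k\<in>K. h \<in> L k" unfolding P_def by blast
    then obtain \<kappa> where \<kappa>: "\<And>h. h \<in> P \<Longrightarrow> \<kappa> h \<in> K \<and> h \<in> L (\<kappa> h)" by metis
    define E where "E = fst ` set ps \<union> snd ` set ps"
    have E: "E \<subseteq> P" "finite E" unfolding E_def using ps by auto
    \<comment> \<open>One more than the displacement that
      \<open>commutator_word_displacement\<close> allows for words of this length.\<close>
    define N where "N = 2 * length ps + 1"
    have "finite (\<kappa> ` E)" "\<kappa> ` E \<subseteq> K" using E \<kappa> by auto
    from displace[OF this, of N]
    obtain t where tc: "\<forall>i<N. t i \<in> carrier G" and
      tt: "\<forall>i<N. \<forall>j<N. i \<noteq> j \<longrightarrow> (\<forall>a\<in>\<kappa> ` E. \<forall>b\<in>\<kappa> ` E.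
        (t i \<otimes> a \<otimes> inv t i) \<otimes> (t j \<otimes> b \<otimes> inv t j) = (t j \<otimes> b \<otimes> inv t j) \<otimes> (t i \<otimes> a \<otimes> inv t i))"
      by (elim exE conjE)
    have "\<exists>h. h \<in> L (t i)" if "i < N" for i using L_ne tc that by blast
    then obtain \<tau> where \<tau>: "\<And>i. i < N \<Longrightarrow> \<tau> i \<in> L (t i)" by metis
    have \<tau>l: "\<tau> i \<in> circle_lifts" if "i < N" for i using L_sub \<tau> tc that by blast
    define cj where "cj i h = \<tau> i \<circ> h \<circ> finv (\<tau> i)" for i h
    define qs where "qs i = map (\<lambda>(a, b). (cj i a, cj i b)) ps" for i
    have cjl: "cj i h \<in> circle_lifts" if "i < N" "h \<in> E" for i h
      unfolding cj_def using that \<tau>l E P by (intro circle_lifts_comp circle_lifts_finv) auto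
    have cjL: "cj i h \<in> L (t i \<otimes> \<kappa> h \<otimes> inv t i)" if "i < N" "h \<in> E" for i h
    proof -
      have "h \<in> P" using that E by blast
      then have "\<kappa> h \<in> carrier G" "h \<in> L (\<kappa> h)" using \<kappa> K by auto
      then show ?thesis unfolding cj_def using tc \<tau> that by (intro L_mult L_inv) auto
    qed
    have cjc: "commute (cj i a) (cj j b)" if "i < N" "j < N" "i \<noteq> j" "a \<in> E" "b \<in> E" for i j a b
    proof (rule commuting_lifts[OF _ _ _ cjL cjL])
      have "\<kappa> a \<in> carrier G" "\<kappa> b \<in> carrier G" using \<kappa> K E that by blast+
      then show "t i \<otimes> \<kappa> a \<otimes> inv t i \<in> carrier G" "t j \<otimes> \<kappa> b \<otimes> inv t j \<in> carrier G"
        using tc that by auto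
    qed (use that tt in auto)
    \<comment> \<open>A lift of \<open>t i\<close> is increasing and commutes with the unit
      translation, so conjugation by it preserves \<open>x + 1 \<le> w x\<close>.\<close>
    have qs_word: "commutator_word (qs i) x \<ge> x + 1" if "i < N" for i x
    proof -
      have bt: "bij (\<tau> i)" using \<tau>l that circle_liftsD(4) by blast
      have "commutator_word (map (\<lambda>(a, b). (cj i a, cj i b)) xs) = \<tau> i \<circ> commutator_word xs \<circ> finv (\<tau> i)"
        if "set xs \<subseteq> P \<times> P" for xs
        using that
      proof (induction xs)
        case Nil
        show ?case using bt by (simp add: fun_eq_iff surj_f_inv_f bij_is_surj)
      next
        case (Cons p xs)
        obtain a b where p: "p = (a, b)" by force
        have ab: "bij a" "bij b" using Cons.prems P p circle_liftsD(4) by auto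
        have "finv (cj i c) = \<tau> i \<circ> finv c \<circ> finv (\<tau> i)" if "bij c" for c
          unfolding cj_def using bt that
          by (simp add: o_inv_distrib bij_comp bij_imp_bij_inv inv_inv_eq o_assoc)
        then have *: "finv (cj i a) = \<tau> i \<circ> finv a \<circ> finv (\<tau> i)" "finv (cj i b) = \<tau> i \<circ> finv b \<circ> finv (\<tau> i)"
          using ab by auto
        have "commutator_word (map (\<lambda>(a, b). (cj i a, cj i b)) (p # xs)) =
          cj i a \<circ> cj i b \<circ> finv (cj i a) \<circ> finv (cj i b) \<circ> (\<tau> i \<circ> commutator_word xs \<circ> finv (\<tau> i))"
          using Cons.IH Cons.prems by (simp only: p list.map prod.case commutator_word.simps set_simps insert_subset simp_thms)
        also have "\<dots> = \<tau> i \<circ> commutator_word (p # xs) \<circ> finv (\<tau> i)"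
          unfolding * unfolding cj_def p commutator_word.simps
          using bt by (simp add: fun_eq_iff bij_is_inj)
        finally show ?case .
      qed
      then have "commutator_word (qs i) x = \<tau> i (w (finv (\<tau> i) x))" unfolding qs_def using ps by simp
      also have "\<dots> \<ge> \<tau> i (finv (\<tau> i) x + 1)" using w1 \<tau>l[OF that] by (simp add: circle_liftsD(8))
      finally show ?thesis using circle_liftsD(3,6)[OF \<tau>l[OF that]] by simp
    qed
    \<comment> \<open>Commutation with the conjugates still to come is carried along because the
      next merge requires it; the constant length leads to the contradiction at
      \<open>n = N\<close>.\<close>
    have "\<exists>rs. length rs = length ps \<and> set rs \<subseteq> circle_lifts \<times> circle_lifts \<and>
        (\<forall>a b. (a, b) \<in> set rs \<longrightarrow> (\<forall>j. n \<le> j \<and> j < N \<longrightarrow> (\<forall>c\<in>E. commute a (cj j c) \<and> commute b (cj j c)))) \<and>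
        (\<forall>x. x + real n \<le> commutator_word rs x)" if "n \<le> N" for n
      using that
    proof (induction n)
      case 0
      have "commutator_word (replicate n (id, id)) = id" for n
      proof (induction n)
        case (Suc n)
        then show ?case by (simp only: replicate_Suc commutator_word.simps inv_id comp_id)
      qed simp
      then show ?case
        by (intro exI[of _ "replicate (length ps) (id, id)"])
          (auto simp: circle_lifts_id[unfolded id_def] id_def commute_def)
    next
      case (Suc n)
      then obtain rs where rs: "length rs = length ps" "set rs \<subseteq> circle_lifts \<times> circle_lifts"
        "\<And>a b j c. (a, b) \<in> set rs \<Longrightarrow> n \<le> j \<Longrightarrow> j < N \<Longrightarrow> c \<in> E \<Longrightarrow> commute a (cj j c) \<and> commute b (cj j c)"
        "\<And>x. x + real n \<le> commutator_word rs x" by (metis Suc_leD)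
      have nN: "n < N" using Suc.prems by simp
      have qE: "\<exists>c\<in>E. \<exists>d\<in>E. p = cj n c \<and> q = cj n d" if "(p, q) \<in> set (qs n)" for p q
        using that unfolding qs_def E_def by force
      have len: "length rs = length (qs n)" using rs by (simp add: qs_def)
      let ?rs = "merge_words rs (qs n)"
      have mem: "\<exists>a' b' c d. (a', b') \<in> set rs \<and> c \<in> E \<and> d \<in> E \<and> a = a' \<circ> cj n c \<and> b = b' \<circ> cj n d"
        if ab: "(a, b) \<in> set ?rs" for a b
      proof -
        obtain a' b' p q where *: "((a', b'), (p, q)) \<in> set (zip rs (qs n))" "a = a' \<circ> p" "b = b' \<circ> q"
        proof -
          obtain x where x: "x \<in> set (zip rs (qs n))"
            "(a, b) = (case x of (x, y) \<Rightarrow> (case x of (a, b) \<Rightarrow> \<lambda>(c, d). (a \<circ> c, b \<circ> d)) y)"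
            using ab unfolding merge_words_def set_map by (elim imageE)
          obtain a' b' p q where "x = ((a', b'), (p, q))" by (metis surj_pair)
          with x show thesis by (intro that[of a' b' p q]) auto
        qed
        then have "(a', b') \<in> set rs" "(p, q) \<in> set (qs n)"
          by (auto dest: set_zip_leftD set_zip_rightD)
        with * have "(a', b') \<in> set rs" "(p, q) \<in> set (qs n)" "a = a' \<circ> p" "b = b' \<circ> q" by auto
        then show ?thesis using qE by blast
      qed
      have word: "commutator_word ?rs = commutator_word rs \<circ> commutator_word (qs n)"
      proof (rule commutator_word_merge[OF len])
        fix a b assume "(a, b) \<in> set rs \<union> set (qs n)"
        then have "a \<in> circle_lifts" "b \<in> circle_lifts" using rs(2) qE cjl nN by fastforce+
        then show "bij a \<and> bij b" using circle_liftsD(4) by blast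
      next
        fix a b c d assume "(a, b) \<in> set rs" "(c, d) \<in> set (qs n)"
        then show "commute a c \<and> commute a d \<and> commute b c \<and> commute b d"
          using rs(3) qE nN by blast
      qed
      show ?case
      proof (intro exI[of _ ?rs] conjI allI impI ballI)
        show "length ?rs = length ps" using rs len by (simp add: merge_words_def)
        show "set ?rs \<subseteq> circle_lifts \<times> circle_lifts"
        proof (rule subrelI)
          fix a b assume "(a, b) \<in> set ?rs"
          then obtain a' b' c d where *: "(a', b') \<in> set rs" "c \<in> E" "d \<in> E" "a = a' \<circ> cj n c" "b = b' \<circ> cj n d"
            using mem by blast
          then have "a' \<in> circle_lifts" "b' \<in> circle_lifts" using rs(2) by auto
          then have "a \<in> circle_lifts" "b \<in> circle_lifts"
            unfolding *(4,5) using cjl nN * by (auto intro!: circle_lifts_comp)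
          then show "(a, b) \<in> circle_lifts \<times> circle_lifts" by blast
        qed
        fix x
        have "x + 1 \<le> commutator_word (qs n) x" using qs_word nN by blast
        moreover have "commutator_word (qs n) x + real n \<le> commutator_word rs (commutator_word (qs n) x)"
          by (rule rs(4))
        ultimately show "x + real (Suc n) \<le> commutator_word ?rs x" by (simp add: word)
      next
        fix a b j c assume "(a, b) \<in> set ?rs" and j: "Suc n \<le> j \<and> j < N" and c: "c \<in> E"
        then obtain a' b' c' d' where *: "(a', b') \<in> set rs" "c' \<in> E" "d' \<in> E" "a = a' \<circ> cj n c'" "b = b' \<circ> cj n d'"
          using mem by blast
        have "commute a' (cj j c)" "commute b' (cj j c)" using rs(3)[OF *(1)] j c by auto
        moreover have "commute (cj n c') (cj j c)" "commute (cj n d') (cj j c)"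
          using cjc nN j c * by auto
        ultimately show "commute a (cj j c)" "commute b (cj j c)"
          unfolding * by (auto simp: commute_def)
      qed
    qed
    from this[OF order_refl] obtain rs where "length rs = length ps" "set rs \<subseteq> circle_lifts \<times> circle_lifts"
      "0 + real N \<le> commutator_word rs 0" by blast
    with commutator_word_displacement[of rs 0] show False by (simp add: N_def)
  qed
  let ?W = "commprod P"
  have bij: "bij a" if "a \<in> P" for a using that P circle_liftsD(4) by blast
  have Wl: "w \<in> circle_lifts" if "w \<in> ?W" for w
    using that
  proof induction
    case (step a b w)
    then show ?case using P by (intro circle_lifts_comp circle_lifts_finv) auto
  qed (rule circle_lifts_id)
  obtain p where p: "\<And>w. w \<in> ?W \<Longrightarrow> w p = p"
  proof (rule bounded_orbit_fixed_point[of ?W 2])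
    show "?W \<noteq> {}" using commprod.id by blast
    show "mono w" if "w \<in> ?W" for w using Wl[OF that] by (simp add: circle_liftsD(1) strict_mono_mono)
    show "w \<circ> v \<in> ?W" if "w \<in> ?W" "v \<in> ?W" for w v using that by (rule commprod_comp)
    show "\<exists>v\<in>?W. \<forall>x. w (v x) = x" if "w \<in> ?W" for w
      using commprod_finv[OF that bij] circle_liftsD(6)[OF Wl[OF that]] by blast
    \<comment> \<open>Some point is displaced by less than 1, and any two displacements differ by
      less than 1.\<close>
    show "w 0 \<le> 2" if w: "w \<in> ?W" for w
    proof -
      obtain x where "w x < x + 1" using not_ge[OF w] by blast
      moreover have "\<bar>(w 0 - 0) - (w x - x)\<bar> < 1" using Wl[OF w] by (rule circle_lifts_displacement)
      ultimately show ?thesis by linarith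
    qed
  qed blast
  \<comment> \<open>Any lifts of the entries will do, since integer translations are central and
    cancel in a commutator.\<close>
  have "\<exists>h\<in>L k. h \<in> ?W" if "k \<in> commutator_products G K" for k
  proof -
    have "k \<in> carrier G \<and> (\<exists>h\<in>L k. h \<in> ?W)"
      using that
    proof induction
      case one
      then show ?case using L_one commprod.id by blast
    next
      case (step a b w)
      then obtain h where h: "h \<in> L w" "h \<in> ?W" by blast
      have ab: "a \<in> carrier G" "b \<in> carrier G" using step K by auto
      obtain h1 h2 where h12: "h1 \<in> L a" "h2 \<in> L b" using L_ne ab by blast
      then have "h1 \<in> P" "h2 \<in> P" using step unfolding P_def by auto
      then have "h1 \<circ> h2 \<circ> finv h1 \<circ> finv h2 \<circ> h \<in> ?W" using h by (intro commprod.step)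
      moreover have "h1 \<circ> h2 \<circ> finv h1 \<circ> finv h2 \<circ> h \<in> L (a \<otimes> b \<otimes> inv a \<otimes> inv b \<otimes> w)"
        using h h12 ab step by (intro L_mult L_inv) auto
      ultimately show ?case using ab step by auto
    qed
    then show ?thesis by blast
  qed
  then show ?thesis using that p perfect by (meson subsetD)
qed

section \<open>Canonical lifts and their gluing\<close>

definition hat :: "'a \<Rightarrow> real \<Rightarrow> real" where
  "hat k = (THE h. h \<in> L k \<and> (\<exists>p. h p = p))"

text \<open>A lift with a fixed point displaces every point by less than 1, so none of its nonzero
  integer translates has a fixed point.\<close>

lemma hat_eq:
  assumes k: "k \<in> carrier G" and h: "h \<in> L k" "h p = p" shows "hat k = h"
  unfolding hat_def
proof (rule the_equality)
  show "h \<in> L k \<and> (\<exists>p. h p = p)" using h by blast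
  fix h' assume h': "h' \<in> L k \<and> (\<exists>p. h' p = p)"
  then obtain m q where m: "\<forall>x. h' x = h x + of_int m" and q: "h' q = q"
    using L_uniq[OF k h(1)] by blast
  have "\<bar>(h p - p) - (h q - q)\<bar> < 1" using L_sub k h by (intro circle_lifts_displacement) auto
  moreover have "h q - q = - of_int m" using m q by (metis add_diff_cancel_left' diff_diff_eq2 minus_diff_eq)
  ultimately have "m = 0" using h(2) by linarith
  then show "h' = h" using m by auto
qed

lemma glued_fixed_point:
  fixes K :: "nat \<Rightarrow> 'a set"
  assumes K: "\<And>i. i < 3 \<Longrightarrow> subgroup (K i) G"
    and fix_pt: "\<And>i. i < 3 \<Longrightarrow> \<exists>p. \<forall>k\<in>K i. \<exists>h\<in>L k. h p = p"
    and factor: "\<And>g i j l. g \<in> carrier G \<Longrightarrow> {i, j, l} = {0, 1, 2} \<Longrightarrow>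
      \<exists>k\<in>K i \<inter> K j. \<exists>k'\<in>K l. g = k \<otimes> k'"
  obtains p where "\<And>g. g \<in> carrier G \<Longrightarrow> \<exists>h\<in>L g. h p = p"
proof -
  \<comment> \<open>A relation, because \<open>g\<close> may factor in several ways; that
    \<open>h\<close> is nevertheless determined is \<open>R_unique\<close>.\<close>
  define R where "R i j g h \<longleftrightarrow> (\<exists>k\<in>K i. \<exists>k'\<in>K j. g = k \<otimes> k' \<and> h = hat k \<circ> hat k')" for i j g h
  have KG: "k \<in> carrier G" if "i < 3" "k \<in> K i" for i k
    using subgroup.mem_carrier[OF K] that by blast
  have hat: "\<exists>p. \<forall>k\<in>K i. hat k \<in> L k \<and> hat k p = p" if "i < 3" for i
    using fix_pt[OF that] hat_eq KG[OF that] by metis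
  have hatL: "hat k \<in> L k" "\<exists>p. hat k p = p" "hat k \<in> circle_lifts" if "i < 3" "k \<in> K i" for i k
  proof -
    show "hat k \<in> L k" "\<exists>p. hat k p = p" using hat[OF that(1)] that(2) by blast+
    then show "hat k \<in> circle_lifts" using L_sub KG[OF that] by blast
  qed
  have hat_mult: "hat (k \<otimes> k') = hat k \<circ> hat k'" if i: "i < 3" "k \<in> K i" "k' \<in> K i" for i k k'
  proof -
    obtain p where p: "\<And>k. k \<in> K i \<Longrightarrow> hat k \<in> L k \<and> hat k p = p" using hat i by blast
    show ?thesis
      using p i KG L_mult subgroup.m_closed[OF K[OF i(1)]] by (intro hat_eq[of _ _ p]) auto
  qed
  \<comment> \<open>Two factorizations \<open>a b = c d\<close> differ by an element
    \<open>z\<close>, equal to \<open>inv a\<close> times \<open>c\<close> and to \<open>b\<close>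
    times \<open>inv d\<close>. It lies in both subgroups, and \<open>hat\<close> is multiplicative
    on each of them.\<close>
  have R_unique: "h = h'" if R: "R i j g h" "R i j g h'" and ij: "i < 3" "j < 3" for i j g h h'
  proof -
    obtain a b where ab: "a \<in> K i" "b \<in> K j" "g = a \<otimes> b" "h = hat a \<circ> hat b" using R unfolding R_def by blast
    obtain c d where cd: "c \<in> K i" "d \<in> K j" "g = c \<otimes> d" "h' = hat c \<circ> hat d" using R unfolding R_def by blast
    have car: "a \<in> carrier G" "b \<in> carrier G" "c \<in> carrier G" "d \<in> carrier G" using ab cd KG ij by blast+
    define z where "z = inv a \<otimes> c"
    have zc: "z \<in> carrier G" using car by (simp add: z_def)
    have c: "c = a \<otimes> z" using car by (simp add: z_def m_assoc[symmetric])
    have "a \<otimes> b = a \<otimes> (z \<otimes> d)" using ab(3) cd(3) c car zc by (simp add: m_assoc)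
    then have b: "b = z \<otimes> d" using car zc by simp
    then have z': "z = b \<otimes> inv d" using car zc by (simp add: m_assoc)
    have "z \<in> K i" unfolding z_def using ab cd subgroup.m_closed[OF K] subgroup.m_inv_closed[OF K] ij by blast
    moreover have "z \<in> K j" unfolding z' using ab cd subgroup.m_closed[OF K] subgroup.m_inv_closed[OF K] ij by blast
    ultimately have "hat c = hat a \<circ> hat z" "hat b = hat z \<circ> hat d"
      unfolding b c using ab cd ij hat_mult by blast+
    then show ?thesis by (simp add: ab(4) cd(4) o_assoc)
  qed
  have three: "i < 3 \<and> j < 3 \<and> l < 3" if "{i, j, l} = {0, 1, 2}" for i j l :: nat
  proof -
    have "i \<in> {0, 1, 2}" "j \<in> {0, 1, 2}" "l \<in> {0, 1, 2}" using that by blast+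
    then show ?thesis by auto
  qed
  \<comment> \<open>A factorization whose left factor lies in both \<open>K i\<close> and
    \<open>K l\<close> counts for both pairs, so by uniqueness the two lifts agree.\<close>
  have change_left: "R l j g h" if R: "R i j g h" and g: "g \<in> carrier G" and ijl: "{i, l, j} = {0, 1, 2}" for i j l g h
  proof -
    have lt: "i < 3" "j < 3" using three[OF ijl] by auto
    obtain k k' where k: "k \<in> K i \<inter> K l" "k' \<in> K j" "g = k \<otimes> k'" using factor[OF g ijl] by blast
    then have "R i j g (hat k \<circ> hat k')" "R l j g (hat k \<circ> hat k')" unfolding R_def by blast+
    then show ?thesis using R_unique[OF R _ lt] by blast
  qed
  \<comment> \<open>\<open>factor\<close> puts the common element of two subgroups on the left only;
    for the right it is applied to the inverse of \<open>g\<close>.\<close>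
  have change_right: "R i l g h" if R: "R i j g h" and g: "g \<in> carrier G" and ijl: "{j, l, i} = {0, 1, 2}" for i j l g h
  proof -
    have lt: "i < 3" "j < 3" "l < 3" using three[OF ijl] by auto
    obtain k k' where k: "k \<in> K j \<inter> K l" "k' \<in> K i" "inv g = k \<otimes> k'" using factor[OF _ ijl] g by blast
    have "k \<in> carrier G" "k' \<in> carrier G" using k KG lt by auto
    then have "inv (inv g) = inv k' \<otimes> inv k" using k(3) by (simp add: inv_mult_group)
    then have *: "g = inv k' \<otimes> inv k" using g by simp
    have "inv k \<in> K j \<inter> K l" "inv k' \<in> K i" using k subgroup.m_inv_closed[OF K] lt by auto
    then have "R i j g (hat (inv k') \<circ> hat (inv k))" "R i l g (hat (inv k') \<circ> hat (inv k))"
      unfolding R_def using * by blast+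
    then show ?thesis using R_unique[OF R _ lt(1,2)] by blast
  qed
  \<comment> \<open>The pairs run through (0,1), (2,1), (2,0), (1,0): one index changes at a time,
    and the third subgroup provides the room.\<close>
  have swap01: "R 1 0 g h" if "R 0 1 g h" "g \<in> carrier G" for g h
  proof -
    have "R 2 1 g h" using that by (intro change_left[of 0 1 g h 2]) auto
    then have "R 2 0 g h" using that by (intro change_right[of 2 1 g h 0]) auto
    then show ?thesis using that by (intro change_left[of 2 0 g h 1]) auto
  qed
  have swap10: "R 0 1 g h" if "R 1 0 g h" "g \<in> carrier G" for g h
  proof -
    have "R 2 0 g h" using that by (intro change_left[of 1 0 g h 2]) auto
    then have "R 2 1 g h" using that by (intro change_right[of 2 0 g h 1]) auto
    then show ?thesis using that by (intro change_left[of 2 1 g h 0]) auto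
  qed
  have R_right: "R i j (g \<otimes> k) (h \<circ> hat k)" if R: "R i j g h" and k: "k \<in> K j" and ij: "i < 3" "j < 3" for i j g h k
  proof -
    obtain a b where ab: "a \<in> K i" "b \<in> K j" "g = a \<otimes> b" "h = hat a \<circ> hat b" using R unfolding R_def by blast
    have "a \<in> carrier G" "b \<in> carrier G" "k \<in> carrier G" using KG ij ab k by blast+
    then have "g \<otimes> k = a \<otimes> (b \<otimes> k)" using ab by (simp add: m_assoc)
    moreover have "h \<circ> hat k = hat a \<circ> hat (b \<otimes> k)" using ab hat_mult[OF ij(2) ab(2) k] by (simp add: o_assoc)
    moreover have "b \<otimes> k \<in> K j" using ab k subgroup.m_closed[OF K[OF ij(2)]] by blast
    ultimately show ?thesis unfolding R_def using ab by blast
  qed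
  have R_car: "g \<in> carrier G" "h \<in> L g" if R: "R 0 1 g h" for g h
  proof -
    obtain a b where ab: "a \<in> K 0" "b \<in> K 1" "g = a \<otimes> b" "h = hat a \<circ> hat b"
      using R unfolding R_def by blast
    have "a \<in> carrier G" "b \<in> carrier G" using ab KG[of 0] KG[of 1] by auto
    moreover have "hat a \<in> L a" "hat b \<in> L b" using ab hatL(1)[of 0] hatL(1)[of 1] by auto
    ultimately show "g \<in> carrier G" "h \<in> L g" unfolding ab by (auto intro: L_mult)
  qed
  have R_ex: "\<exists>h. R 0 1 g h" if g: "g \<in> carrier G" for g
  proof -
    have "{0, 2, 1} = {0, 1, 2 :: nat}" by auto
    from factor[OF g this] show ?thesis unfolding R_def by blast
  qed
  \<comment> \<open>Let \<open>g' = a b\<close>. The factor \<open>a\<close> in \<open>K 0\<close>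
    is absorbed after \<open>g\<close> is rewritten in the order \<open>K 1\<close>,
    \<open>K 0\<close>; swapping back then lets \<open>b\<close> in \<open>K 1\<close> be
    absorbed.\<close>
  have R_mult: "R 0 1 (g \<otimes> g') (h \<circ> h')" if R: "R 0 1 g h" "R 0 1 g' h'" for g g' h h'
  proof -
    obtain a b where ab: "a \<in> K 0" "b \<in> K 1" "g' = a \<otimes> b" "h' = hat a \<circ> hat b"
      using R unfolding R_def by blast
    have car: "a \<in> carrier G" "b \<in> carrier G" "g \<in> carrier G" using ab KG[of 0] KG[of 1] R_car[OF R(1)] by auto
    have "R 1 0 (g \<otimes> a) (h \<circ> hat a)" using swap01[OF R(1)] car ab by (intro R_right) auto
    then have "R 0 1 (g \<otimes> a) (h \<circ> hat a)" using car by (intro swap10) auto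
    then have "R 0 1 (g \<otimes> a \<otimes> b) (h \<circ> hat a \<circ> hat b)" using ab
      by (intro R_right[of 0 1 "g \<otimes> a" "h \<circ> hat a" b]) auto
    then show ?thesis using car ab by (simp add: m_assoc o_assoc)
  qed
  have R_one: "R 0 1 \<one> id"
  proof -
    have "\<one> \<in> K 0" "\<one> \<in> K 1" using subgroup.one_closed[OF K] by auto
    moreover have "hat \<one> = id" using L_one by (intro hat_eq) auto
    ultimately show ?thesis unfolding R_def by (intro bexI[of _ \<one>]) auto
  qed
  define W where "W = {h. \<exists>g. R 0 1 g h}"
  obtain p where p: "\<And>w. w \<in> W \<Longrightarrow> w p = p"
  proof (rule bounded_orbit_fixed_point[of W 2])
    show "W \<noteq> {}" using R_one unfolding W_def by blast
    show "mono w" if "w \<in> W" for w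
      using that R_car L_sub circle_liftsD(1) strict_mono_mono unfolding W_def by blast
    show "w \<circ> v \<in> W" if "w \<in> W" "v \<in> W" for w v using that R_mult unfolding W_def by blast
    show "\<exists>v\<in>W. \<forall>x. w (v x) = x" if w: "w \<in> W" for w
    proof -
      obtain g where g: "R 0 1 g w" using w unfolding W_def by blast
      then have gc: "g \<in> carrier G" using R_car by blast
      then obtain v where v: "R 0 1 (inv g) v" using R_ex by blast
      then have "R 0 1 \<one> (w \<circ> v)" using R_mult[OF g v] gc by simp
      then have "w \<circ> v = id" using R_unique[OF _ R_one] by simp
      then show ?thesis using v unfolding W_def by (metis (mono_tags, lifting) comp_apply id_apply mem_Collect_eq)
    qed
    show "w 0 \<le> 2" if w: "w \<in> W" for w
    proof -
      obtain a b where ab: "a \<in> K 0" "b \<in> K 1" "w = hat a \<circ> hat b"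
        using w unfolding W_def R_def by blast
      obtain q r where "hat a q = q" "hat b r = r" using hatL(2)[of 0 a] hatL(2)[of 1 b] ab by auto
      moreover have "hat a \<in> circle_lifts" "hat b \<in> circle_lifts" using hatL(3)[of 0 a] hatL(3)[of 1 b] ab by auto
      ultimately have "\<bar>hat a x - x\<bar> < 1" "\<bar>hat b x - x\<bar> < 1" for x
        using circle_lifts_displacement[of "hat a" x q] circle_lifts_displacement[of "hat b" x r] by auto
      from this(1)[of "hat b 0"] this(2)[of 0] show ?thesis using ab by simp
    qed
  qed blast
  show ?thesis
  proof (rule that)
    fix g assume "g \<in> carrier G"
    then obtain h where "R 0 1 g h" using R_ex by blast
    then show "\<exists>h\<in>L g. h p = p" using R_car p unfolding W_def by blast
  qed
qed

end

section \<open>Actions on the circle\<close>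

definition circle_pt :: "real \<Rightarrow> complex" where
  "circle_pt t = cis (2 * pi * t)"

lemma norm_circle_pt [simp]: "cmod (circle_pt t) = 1"
  by (simp add: circle_pt_def)

lemma circle_pt_sphere: "circle_pt t \<in> sphere 0 1"
  by simp

lemma circle_pt_eq_iff: "circle_pt s = circle_pt t \<longleftrightarrow> (\<exists>k::int. s = t + of_int k)"
proof -
  have "circle_pt s = circle_pt t \<longleftrightarrow> sin (2 * pi * s) = sin (2 * pi * t) \<and> cos (2 * pi * s) = cos (2 * pi * t)"
    by (auto simp: circle_pt_def complex_eq_iff)
  also have "\<dots> \<longleftrightarrow> (\<exists>k::int. 2 * pi * s = 2 * pi * t + 2 * pi * of_int k)"
    by (rule sin_cos_eq_iff)
  also have "\<dots> \<longleftrightarrow> (\<exists>k::int. s = t + of_int k)"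
    by (simp flip: distrib_left)
  finally show ?thesis .
qed

lemma continuous_circle_pt: "continuous_on S circle_pt"
  unfolding circle_pt_def[abs_def] by (intro continuous_intros)

lemma continuous_int_valued_constant:
  fixes d :: "real \<Rightarrow> real"
  assumes d: "continuous_on UNIV d" "\<And>t. \<exists>k::int. d t = of_int k"
  obtains k :: int where "\<And>t. d t = of_int k"
proof -
  have "d constant_on UNIV"
  proof (rule continuous_discrete_range_constant[OF _ d(1)])
    fix x :: real
    have "1 \<le> norm (d y - d x)" if "d y \<noteq> d x" for y
    proof -
      obtain k l :: int where "d x = of_int k" "d y = of_int l" using d(2) by metis
      with that show ?thesis by (simp flip: of_int_diff of_int_abs)
    qed
    then show "\<exists>e>0. \<forall>y. y \<in> UNIV \<and> d y \<noteq> d x \<longrightarrow> e \<le> norm (d y - d x)"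
      by (intro exI[of _ 1]) auto
  qed auto
  then obtain c where "\<And>t. d t = c" unfolding constant_on_def by blast
  then show ?thesis using d(2) that by metis
qed

text \<open>The composite with the covering has no zero, hence a continuous logarithm on the line.
  Its real part vanishes as the values have modulus 1, and its imaginary part is the lift up to the
  factor \<open>2 * pi\<close>.\<close>

lemma continuous_map_circle_lift:
  assumes "continuous_map circle circle f"
  obtains h where "continuous_on UNIV h" "\<And>t. f (circle_pt t) = circle_pt (h t)"
proof -
  have f: "continuous_on (sphere 0 1) f" "f ` sphere 0 1 \<subseteq> sphere 0 1"
    using assms by (auto simp: continuous_map_in_subtopology)
  have "continuous_on UNIV (f \<circ> circle_pt)"
    by (rule continuous_on_compose[OF continuous_circle_pt])
      (rule continuous_on_subset[OF f(1)], use circle_pt_sphere in blast)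
  moreover have "(f \<circ> circle_pt) t \<noteq> 0" for t
    using f(2) circle_pt_sphere[of t] by fastforce
  moreover have "contractible (UNIV :: real set)" by (intro convex_imp_contractible) auto
  ultimately obtain g where g: "continuous_on UNIV g" "\<And>t. (f \<circ> circle_pt) t = exp (g t)"
    by (metis UNIV_I continuous_logarithm_on_contractible)
  have re: "Re (g t) = 0" for t
  proof -
    have "cmod (f (circle_pt t)) = 1" using f(2) circle_pt_sphere[of t] by fastforce
    then show ?thesis using g(2)[of t] by simp
  qed
  have "exp (g t) = circle_pt (Im (g t) / (2 * pi))" for t
    by (simp add: circle_pt_def complex_eq_iff Re_exp Im_exp re)
  moreover have "continuous_on UNIV (\<lambda>t. Im (g t) / (2 * pi))"
    using g(1) by (intro continuous_intros) auto
  ultimately show ?thesis using that g(2) by simp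
qed

text \<open>Lifts of \<open>f\<close> and of its inverse compose to integer translations in both
  orders, so the lift of \<open>f\<close> is bijective.\<close>

lemma homeomorphic_circle_lift:
  assumes "homeomorphic_map circle circle f"
  obtains h where "continuous_on UNIV h" "bij h" "\<And>t. f (circle_pt t) = circle_pt (h t)"
proof -
  obtain f' where ff': "homeomorphic_maps circle circle f f'"
    using assms by (auto simp: homeomorphic_map_maps)
  obtain h where h: "continuous_on UNIV h" "\<And>t. f (circle_pt t) = circle_pt (h t)"
    using ff' continuous_map_circle_lift by (metis homeomorphic_maps_def)
  obtain h' where h': "continuous_on UNIV h'" "\<And>t. f' (circle_pt t) = circle_pt (h' t)"
    using ff' continuous_map_circle_lift by (metis homeomorphic_maps_def)
  have inv: "f' (f (circle_pt t)) = circle_pt t" "f (f' (circle_pt t)) = circle_pt t" for t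
    using ff' by (auto simp: homeomorphic_maps_def)
  have ex: "\<exists>k::int. h' (h t) - t = of_int k" "\<exists>k::int. h (h' t) - t = of_int k" for t
    using inv[of t] unfolding h h' circle_pt_eq_iff by auto
  have "continuous_on UNIV (\<lambda>t. h' (h t))" "continuous_on UNIV (\<lambda>t. h (h' t))"
    using continuous_on_compose2[OF h'(1) h(1)] continuous_on_compose2[OF h(1) h'(1)] by auto
  from this[THEN continuous_on_diff, OF continuous_on_id]
  have cont: "continuous_on UNIV (\<lambda>t. h' (h t) - t)" "continuous_on UNIV (\<lambda>t. h (h' t) - t)" .
  obtain k :: int where k: "h' (h t) - t = of_int k" for t
    using continuous_int_valued_constant[OF cont(1) ex(1)] by blast
  obtain l :: int where l: "h (h' t) - t = of_int l" for t
    using continuous_int_valued_constant[OF cont(2) ex(2)] by blast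
  have "inj h"
    by (rule injI) (metis k diff_eq_eq add_left_cancel)
  moreover have "h (h' (t - of_int l)) = t" for t using l[of "t - of_int l"] by simp
  then have "surj h" by (intro surjI[of h "\<lambda>t. h' (t - of_int l)"])
  ultimately show ?thesis using that h by (simp add: bij_def)
qed

lemma continuous_bij_monotone:
  fixes h :: "real \<Rightarrow> real"
  assumes "continuous_on UNIV h" "bij h"
  shows "(\<forall>x y. x < y \<longrightarrow> h x < h y) \<or> (\<forall>x y. x < y \<longrightarrow> h y < h x)"
  using injective_eq_monotone_map[of UNIV h] assms
  by (auto simp: bij_def monotone_on_def is_interval_univ)

text \<open>\<open>a\<close> and \<open>finv a\<close> are both increasing or both decreasing, and
  likewise for \<open>b\<close>, so the number of decreasing factors is even. This is how
  commutators preserve orientation although the action need not.\<close>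

lemma commutator_strict_mono:
  fixes a b :: "real \<Rightarrow> real"
  assumes a: "continuous_on UNIV a" "bij a" and b: "continuous_on UNIV b" "bij b"
  shows "strict_mono (a \<circ> b \<circ> finv a \<circ> finv b)"
proof -
  have inv: "(\<forall>x y. x < y \<longrightarrow> f x < f y) \<and> (\<forall>x y. x < y \<longrightarrow> finv f x < finv f y) \<or>
      (\<forall>x y. x < y \<longrightarrow> f y < f x) \<and> (\<forall>x y. x < y \<longrightarrow> finv f y < finv f x)"
    if f: "continuous_on UNIV f" "bij f" for f :: "real \<Rightarrow> real"
  proof -
    have i: "f (finv f x) = x" for x using f(2) by (simp add: bij_is_surj surj_f_inv_f)
    show ?thesis using continuous_bij_monotone[OF f]
    proof
      assume m: "\<forall>x y. x < y \<longrightarrow> f x < f y"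
      have "finv f x < finv f y" if "x < y" for x y
      proof (rule ccontr)
        assume "\<not> finv f x < finv f y"
        then have "f (finv f y) \<le> f (finv f x)" using m by (metis le_less not_less)
        then show False using i that by simp
      qed
      then show ?thesis using m by blast
    next
      assume m: "\<forall>x y. x < y \<longrightarrow> f y < f x"
      have "finv f y < finv f x" if "x < y" for x y
      proof (rule ccontr)
        assume "\<not> finv f y < finv f x"
        then have "f (finv f y) \<le> f (finv f x)" using m by (metis le_less not_less)
        then show False using i that by simp
      qed
      then show ?thesis using m by blast
    qed
  qed
  show ?thesis
    unfolding strict_mono_def comp_def using inv[OF a] inv[OF b] by blast
qed

section \<open>From an action to increasing lifts\<close>

locale circle_action = group G for G (structure) +
  fixes \<beta> :: "'a \<Rightarrow> complex \<Rightarrow> complex"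
  assumes hom: "\<beta> \<in> hom G (homeo_group circle)"
begin

text \<open>Only increasing lifts count, so an element that reverses orientation would have none.
  That every element has one is deduced from the factorization.\<close>

definition lifts :: "'a \<Rightarrow> (real \<Rightarrow> real) set" where
  "lifts g = {h \<in> circle_lifts. \<forall>t. \<beta> g (circle_pt t) = circle_pt (h t)}"

lemma action_homeo: "g \<in> carrier G \<Longrightarrow> homeomorphic_map circle circle (\<beta> g)"
  using hom by (auto simp: hom_def homeo_group_def)

lemma action_sphere: "g \<in> carrier G \<Longrightarrow> z \<in> sphere 0 1 \<Longrightarrow> \<beta> g z \<in> sphere 0 1"
  using homeomorphic_imp_surjective_map[OF action_homeo] by fastforce

lemma action_mult:
  assumes "g \<in> carrier G" "g' \<in> carrier G" "z \<in> sphere 0 1"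
  shows "\<beta> (g \<otimes> g') z = \<beta> g (\<beta> g' z)"
proof -
  have "\<beta> (g \<otimes> g') = \<beta> g \<otimes>\<^bsub>homeo_group circle\<^esub> \<beta> g'" using hom assms by (simp add: hom_def)
  also have "\<dots> = compose (sphere 0 1) (\<beta> g) (\<beta> g')"
    using hom assms by (auto simp: hom_def homeo_group_def BijGroup_def Pi_def)
  finally show ?thesis using assms by (simp add: compose_def)
qed

lemma action_one:
  assumes "z \<in> sphere 0 1" shows "\<beta> \<one> z = z"
proof -
  have "\<beta> \<one> (\<beta> \<one> z) = \<beta> \<one> z" using action_mult[of \<one> \<one> z] assms by simp
  then show ?thesis
    using homeomorphic_imp_injective_map[OF action_homeo[of \<one>]] action_sphere[of \<one> z] assms
    by (auto dest: inj_onD)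
qed

lemma lifts_one: "id \<in> lifts \<one>"
  unfolding lifts_def using circle_lifts_id by (auto simp: action_one)

lemma lifts_mult:
  assumes "g \<in> carrier G" "g' \<in> carrier G" "h \<in> lifts g" "h' \<in> lifts g'"
  shows "h \<circ> h' \<in> lifts (g \<otimes> g')"
  using assms circle_lifts_comp[of h h'] unfolding lifts_def by (simp add: action_mult)

lemma action_inv_lift:
  assumes g: "g \<in> carrier G" and h: "bij h" "\<And>t. \<beta> g (circle_pt t) = circle_pt (h t)"
  shows "\<beta> (inv g) (circle_pt t) = circle_pt (finv h t)"
proof -
  have "\<beta> (inv g) (circle_pt t) = \<beta> (inv g) (\<beta> g (circle_pt (finv h t)))"
    using h by (simp add: bij_is_surj surj_f_inv_f)
  also have "\<dots> = circle_pt (finv h t)"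
    using action_mult[of "inv g" g "circle_pt (finv h t)"] g by (simp add: action_one)
  finally show ?thesis .
qed

lemma lifts_inv: "g \<in> carrier G \<Longrightarrow> h \<in> lifts g \<Longrightarrow> finv h \<in> lifts (inv g)"
  unfolding lifts_def using action_inv_lift circle_lifts_finv circle_liftsD(4) by blast

lemma circle_lifts_continuous: "h \<in> circle_lifts \<Longrightarrow> continuous_on UNIV h"
  by (rule continuous_onI_mono) (auto simp: circle_liftsD(2,8))

lemma lifts_unique:
  assumes "h \<in> lifts g" "h' \<in> lifts g"
  shows "\<exists>k::int. \<forall>x. h' x = h x + of_int k"
proof -
  have "\<exists>k::int. h' x - h x = of_int k" for x
  proof -
    have "circle_pt (h' x) = circle_pt (h x)" using assms unfolding lifts_def by force
    then show ?thesis unfolding circle_pt_eq_iff by auto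
  qed
  moreover have "continuous_on UNIV (\<lambda>x. h' x - h x)"
    using assms circle_lifts_continuous unfolding lifts_def by (intro continuous_intros) auto
  ultimately obtain k :: int where "h' x - h x = of_int k" for x
    using continuous_int_valued_constant[of "\<lambda>x. h' x - h x"] by blast
  then show ?thesis by (intro exI[of _ k]) (simp add: algebra_simps)
qed

text \<open>Over one period an increasing lift gains a positive integer \<open>d\<close>. If
  \<open>d\<close> were at least 2, the lift would take a value congruent to \<open>h t\<close>
  strictly inside the period, against injectivity on the circle.\<close>

lemma monotone_lift_in_lifts:
  assumes g: "g \<in> carrier G" and h: "continuous_on UNIV h" "strict_mono h" "surj h"
    "\<And>t. \<beta> g (circle_pt t) = circle_pt (h t)"
  shows "h \<in> lifts g"
proof -
  have "h (t + 1) = h t + 1" for t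
  proof -
    have "circle_pt (t + 1) = circle_pt t" unfolding circle_pt_eq_iff by (intro exI[of _ 1]) simp
    then have "circle_pt (h (t + 1)) = circle_pt (h t)" using h(4) by metis
    then obtain d :: int where d: "h (t + 1) = h t + of_int d" unfolding circle_pt_eq_iff by blast
    have "h t < h (t + 1)" using h(2) by (simp add: strict_mono_less)
    then have "1 \<le> d" using d by simp
    moreover have "\<not> 2 \<le> d"
    proof
      assume "2 \<le> d"
      obtain s where s: "h s = h t + 1" using h(3) by (metis surjE)
      have "h t < h s" "h s < h (t + 1)" using s d \<open>2 \<le> d\<close> by auto
      then have st: "t < s" "s < t + 1" using h(2) by (simp_all add: strict_mono_less)
      have "circle_pt (h s) = circle_pt (h t)" unfolding s circle_pt_eq_iff by (intro exI[of _ 1]) simp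
      then have "\<beta> g (circle_pt s) = \<beta> g (circle_pt t)" by (simp add: h(4))
      then have "circle_pt s = circle_pt t"
        using homeomorphic_imp_injective_map[OF action_homeo[OF g]] by (simp add: inj_on_eq_iff)
      then obtain k :: int where "s = t + of_int k" unfolding circle_pt_eq_iff by blast
      then show False using st by simp
    qed
    ultimately have "d = 1" by linarith
    then show ?thesis using d by simp
  qed
  then show ?thesis using h unfolding lifts_def circle_lifts_def by blast
qed

lemma commutator_lifts_ne:
  assumes g: "a \<in> carrier G" "b \<in> carrier G"
  shows "lifts (a \<otimes> b \<otimes> inv a \<otimes> inv b) \<noteq> {}"
proof -
  obtain h where h: "continuous_on UNIV h" "bij h" "\<And>t. \<beta> a (circle_pt t) = circle_pt (h t)"
    using homeomorphic_circle_lift[OF action_homeo[OF g(1)]] by blast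
  obtain k where k: "continuous_on UNIV k" "bij k" "\<And>t. \<beta> b (circle_pt t) = circle_pt (k t)"
    using homeomorphic_circle_lift[OF action_homeo[OF g(2)]] by blast
  let ?c = "h \<circ> k \<circ> finv h \<circ> finv k"
  have mono: "strict_mono ?c" by (rule commutator_strict_mono) fact+
  have "surj ?c" using h(2) k(2) by (intro comp_surj) (auto simp: bij_is_surj bij_is_inj inj_imp_surj_inv)
  moreover have "continuous_on UNIV ?c"
    by (rule continuous_onI_mono)
      (simp_all only: \<open>surj ?c\<close> strict_mono_less_eq[OF mono] open_UNIV)
  moreover have "\<beta> (a \<otimes> b \<otimes> inv a \<otimes> inv b) (circle_pt t) = circle_pt (?c t)" for t
    using g action_inv_lift[OF g(1) h(2,3)] action_inv_lift[OF g(2) k(2,3)]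
    by (simp add: action_mult h(3) k(3))
  ultimately have "?c \<in> lifts (a \<otimes> b \<otimes> inv a \<otimes> inv b)"
    using mono g by (intro monotone_lift_in_lifts) auto
  then show ?thesis by blast
qed

lemma commutator_products_lifts_ne:
  assumes "g \<in> commutator_products G K" "K \<subseteq> carrier G"
  shows "g \<in> carrier G \<and> lifts g \<noteq> {}"
  using assms
proof induction
  case one
  then show ?case using lifts_one by blast
next
  case (step a b w)
  then have car: "a \<in> carrier G" "b \<in> carrier G" "w \<in> carrier G" by auto
  obtain h h' where "h \<in> lifts (a \<otimes> b \<otimes> inv a \<otimes> inv b)" "h' \<in> lifts w"
    using commutator_lifts_ne[OF car(1,2)] step by blast
  then have "h \<circ> h' \<in> lifts (a \<otimes> b \<otimes> inv a \<otimes> inv b \<otimes> w)" using car by (intro lifts_mult) auto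
  then show ?case using car by blast
qed

theorem fixed_point_if_factored:
  fixes K :: "nat \<Rightarrow> 'a set"
  assumes K: "\<And>i. i < 3 \<Longrightarrow> subgroup (K i) G"
    and displace: "\<And>i S (N::nat). i < 3 \<Longrightarrow> finite S \<Longrightarrow> S \<subseteq> K i \<Longrightarrow> \<exists>t. (\<forall>i<N. t i \<in> carrier G) \<and>
      (\<forall>i<N. \<forall>j<N. i \<noteq> j \<longrightarrow> (\<forall>a\<in>S. \<forall>b\<in>S.
        (t i \<otimes> a \<otimes> inv t i) \<otimes> (t j \<otimes> b \<otimes> inv t j) = (t j \<otimes> b \<otimes> inv t j) \<otimes> (t i \<otimes> a \<otimes> inv t i)))"
    and perfect: "\<And>i. i < 3 \<Longrightarrow> K i \<subseteq> commutator_products G (K i)"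
    and factor: "\<And>g i j l. g \<in> carrier G \<Longrightarrow> {i, j, l} = {0, 1, 2} \<Longrightarrow>
      \<exists>k\<in>K i \<inter> K j. \<exists>k'\<in>K l. g = k \<otimes> k'"
  shows "\<exists>z\<in>sphere 0 1. \<forall>g\<in>carrier G. \<beta> g z = z"
proof -
  have KG: "K i \<subseteq> carrier G" if "i < 3" for i using subgroup.subset[OF K[OF that]] .
  \<comment> \<open>Both factors lie in perfect subgroups, so they are products of commutators and
    have increasing lifts.\<close>
  have ne: "lifts g \<noteq> {}" if g: "g \<in> carrier G" for g
  proof -
    obtain k k' where k: "k \<in> K 0" "k' \<in> K 2" "g = k \<otimes> k'" using factor[OF g refl] by blast
    have "k \<in> carrier G \<and> lifts k \<noteq> {}" "k' \<in> carrier G \<and> lifts k' \<noteq> {}"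
      using k KG[of 0] KG[of 2] perfect[of 0] perfect[of 2] commutator_products_lifts_ne by auto
    then show ?thesis using lifts_mult k by blast
  qed
  interpret circle_lifted_group G lifts
  proof unfold_locales
    show "h \<in> circle_lifts" if "g \<in> carrier G" "h \<in> lifts g" for g h using that by (simp add: lifts_def)
  qed (rule ne lifts_one lifts_mult lifts_inv lifts_unique; assumption)+
  have fixed: "\<exists>p. \<forall>k\<in>K i. \<exists>h\<in>lifts k. h p = p" if i: "i < 3" for i
    using commutator_products_fixed_point[OF KG[OF i] displace[OF i] perfect[OF i]] by metis
  obtain p where p: "\<And>g. g \<in> carrier G \<Longrightarrow> \<exists>h\<in>lifts g. h p = p"
    by (rule glued_fixed_point[where K = K, OF K fixed factor]) blast+
  have "\<beta> g (circle_pt p) = circle_pt p" if g: "g \<in> carrier G" for g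
  proof -
    obtain h where "h \<in> lifts g" "h p = p" using p[OF g] by blast
    then show ?thesis unfolding lifts_def by force
  qed
  then show ?thesis using circle_pt_sphere by blast
qed

end

section \<open>Leafwise maps of the suspension\<close>

locale stone_dynamics =
  fixes X :: "'a topology" and \<phi> :: "'a \<Rightarrow> 'a"
  assumes stone: "stone_system X \<phi>"
begin

abbreviation "it \<equiv> int_iter X \<phi>"
abbreviation "cls \<equiv> susp_class X \<phi>"
abbreviation "Y \<equiv> suspension X \<phi>"

lemma X_ne: "topspace X \<noteq> {}" and X_compact: "compact_space X" and X_Hausdorff: "Hausdorff_space X"
  and X_disconnected: "connectedin X S \<Longrightarrow> \<exists>a. S \<subseteq> {a}" and \<phi>_homeo: "homeomorphic_map X X \<phi>"
  using stone by (auto simp: stone_system_def totally_disconnected_top_def)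

lemma \<phi>_bij: "bij_betw \<phi> (topspace X) (topspace X)"
  using \<phi>_homeo by (simp add: bij_betw_def homeomorphic_imp_injective_map homeomorphic_imp_surjective_map)

lemma \<phi>_in: "x \<in> topspace X \<Longrightarrow> \<phi> x \<in> topspace X"
  using \<phi>_bij by (auto simp: bij_betw_def)

lemma inv_\<phi>: "x \<in> topspace X \<Longrightarrow> inv_into (topspace X) \<phi> x \<in> topspace X"
  "x \<in> topspace X \<Longrightarrow> \<phi> (inv_into (topspace X) \<phi> x) = x"
  "x \<in> topspace X \<Longrightarrow> inv_into (topspace X) \<phi> (\<phi> x) = x"
  using \<phi>_bij by (auto simp: bij_betw_def inv_into_into f_inv_into_f)

lemma it_0 [simp]: "it 0 x = x"
  by (simp add: int_iter_def)

lemma it_in [simp]: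
  assumes "x \<in> topspace X" shows "it n x \<in> topspace X"
proof -
  have "(f ^^ k) x \<in> topspace X" if "\<And>x. x \<in> topspace X \<Longrightarrow> f x \<in> topspace X" for f k
    by (induction k) (use assms that in auto)
  then show ?thesis using \<phi>_in inv_\<phi>(1) by (simp add: int_iter_def)
qed

lemma it_Suc:
  assumes "x \<in> topspace X" shows "it (n + 1) x = \<phi> (it n x)"
proof (cases "0 \<le> n")
  case True
  then have "nat (n + 1) = Suc (nat n)" by simp
  then show ?thesis using True by (simp add: int_iter_def)
next
  case False
  define \<psi> where "\<psi> = inv_into (topspace X) \<phi>"
  define k where "k = nat (- (n + 1))"
  have k: "nat (- n) = Suc k" "nat (- (n + 1)) = k" using False by (simp_all add: k_def)
  have "it n x = \<psi> ((\<psi> ^^ k) x)" "(\<psi> ^^ k) x = it (n + 1) x"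
    using False k by (auto simp: int_iter_def \<psi>_def)
  then show ?thesis using inv_\<phi>(2)[of "it (n + 1) x"] assms by (simp add: \<psi>_def)
qed

lemma it_add:
  assumes x: "x \<in> topspace X" shows "it (m + n) x = it m (it n x)"
proof -
  have nonneg: "it (m + n) x = it m (it n x)" if "0 \<le> m" for m n
    using that
  proof (induction rule: int_ge_induct)
    case (step m)
    have "it (m + 1 + n) x = \<phi> (it (m + n) x)" using it_Suc[OF x, of "m + n"] by (simp add: add_ac)
    then show ?case using step it_Suc[of "it n x" m] x by simp
  qed simp
  show ?thesis
  proof (cases "0 \<le> m")
    case False
    have cancel: "it (- m) (it m z) = z" if z: "z \<in> topspace X" for z
    proof -
      have "it k (it (- k) z) = z" if "0 \<le> k" for k
        using that
      proof (induction rule: int_ge_induct)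
        case (step k)
        have "it (k + 1) (it (- (k + 1)) z) = it k (\<phi> (it (- (k + 1)) z))"
        proof -
          have "it (k + 1) w = it k (it 1 w)" if "w \<in> topspace X" for w
          proof -
            have "nat (k + 1) = Suc (nat k)" using step by simp
            then show ?thesis using step by (simp add: int_iter_def funpow_swap1)
          qed
          then show ?thesis
            using it_Suc[of "it (- (k + 1)) z" 0] it_in[OF z] by (metis add_0 it_0)
        qed
        also have "\<phi> (it (- (k + 1)) z) = it (- k) z" using it_Suc[OF z, of "- (k + 1)"] by simp
        finally show ?case using step by simp
      qed simp
      from this[of "- m"] False show ?thesis by simp
    qed
    \<comment> \<open>For negative \<open>m\<close> both sides agree after applying
      \<open>it (- m)\<close>, which the non-negative case covers and which is injective.\<close>
    have "it (- m) (it (m + n) x) = it n x" using nonneg[of "- m" "m + n"] False by simp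
    moreover have "it (- m) (it m (it n x)) = it n x" using cancel x by simp
    moreover have "inj_on (it (- m)) (topspace X)"
    proof -
      have "inj_on (\<phi> ^^ k) (topspace X)" for k
      proof (induction k)
        case (Suc k)
        have "(\<phi> ^^ k) ` topspace X \<subseteq> topspace X" using it_in[of _ "int k"] by (auto simp: int_iter_def)
        then have "inj_on (\<phi> \<circ> \<phi> ^^ k) (topspace X)"
          using Suc \<phi>_bij unfolding bij_betw_def by (intro comp_inj_on) (auto intro: inj_on_subset)
        then show ?case by (simp only: funpow.simps)
      qed simp
      then show ?thesis using False by (simp add: int_iter_def)
    qed
    moreover have "it (m + n) x \<in> topspace X" "it m (it n x) \<in> topspace X" using x by simp_all
    ultimately show ?thesis by (metis inj_onD)
  qed (use nonneg in blast)
qed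

lemma it_cancel: "x \<in> topspace X \<Longrightarrow> it (- n) (it n x) = x" "x \<in> topspace X \<Longrightarrow> it n (it (- n) x) = x"
  using it_add[of x "- n" n] it_add[of x n "- n"] by simp_all

lemma it_homeo: "homeomorphic_map X X (it n)"
proof -
  have pow: "homeomorphic_map X X (f ^^ k)" if "homeomorphic_map X X f" for f k
  proof (induction k)
    case 0
    show ?case by (simp add: homeomorphic_map_id[unfolded id_def] id_def)
  next
    case (Suc k)
    then show ?case using that homeomorphic_map_compose by (simp only: funpow.simps) blast
  qed
  obtain \<psi> where \<psi>: "homeomorphic_maps X X \<phi> \<psi>" using \<phi>_homeo by (auto simp: homeomorphic_map_maps)
  have "\<psi> x = inv_into (topspace X) \<phi> x" if "x \<in> topspace X" for x
  proof -
    have "\<phi> (\<psi> x) = x" "\<psi> x \<in> topspace X"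
      using \<psi> that by (auto simp: homeomorphic_maps_def continuous_map_def)
    then show ?thesis using inv_\<phi>(3)[of "\<psi> x"] by simp
  qed
  then have "homeomorphic_map X X (inv_into (topspace X) \<phi>)"
    using \<psi> homeomorphic_map_eq homeomorphic_map_maps homeomorphic_maps_sym by metis
  then show ?thesis using pow \<phi>_homeo by (simp add: int_iter_def)
qed

lemma it_continuous: "continuous_map X X (it n)"
  using it_homeo homeomorphic_imp_continuous_map by blast

lemma openin_it_preimage: "openin X U \<Longrightarrow> openin X {x \<in> topspace X. it n x \<in> U}"
  using it_continuous by (simp add: continuous_map_def)

text \<open>In a compact Hausdorff space, closed sets that no connected set joins are separated by a
  clopen partition; here connected sets have at most one point.\<close>

lemma clopen_neighbourhood:
  assumes "openin X U" "x \<in> U"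
  obtains C where "openin X C" "closedin X C" "x \<in> C" "C \<subseteq> U"
proof -
  have x: "x \<in> topspace X" using assms openin_subset by blast
  have "separated_between X {x} (topspace X - U)"
  proof (rule cut_wire_fence_theorem_gen)
    show "disjnt C {x} \<or> disjnt C (topspace X - U)" if "connectedin X C" for C
      using X_disconnected[OF that] assms by (auto simp: disjnt_def)
  qed (use X_compact X_Hausdorff assms x in \<open>auto simp: compactin_sing\<close>)
  then obtain V W where VW: "openin X V" "openin X W" "V \<union> W = topspace X" "disjnt V W" "x \<in> V" "topspace X - U \<subseteq> W"
    by (auto simp: separated_between_def)
  then have "V = topspace X - W" by (auto simp: disjnt_def)
  then have "closedin X V" using VW by blast
  moreover have "V \<subseteq> U" using VW by (auto simp: disjnt_def)
  ultimately show ?thesis using that VW by blast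
qed

section \<open>Maps of the suspension that preserve leaves\<close>

lemma cls_eq_iff:
  assumes "x \<in> topspace X"
  shows "cls (x, s) = cls (y, t) \<longleftrightarrow> (\<exists>n. y = it n x \<and> t = s - of_int n)"
proof
  assume "cls (x, s) = cls (y, t)"
  moreover have "(y, t) \<in> cls (y, t)"
    unfolding susp_class_def susp_act_def by (rule image_eqI[of _ _ 0]) auto
  ultimately have "(y, t) \<in> cls (x, s)" by simp
  then show "\<exists>n. y = it n x \<and> t = s - of_int n"
    unfolding susp_class_def susp_act_def by auto
next
  assume "\<exists>n. y = it n x \<and> t = s - of_int n"
  then obtain n where n: "y = it n x" "t = s - of_int n" by blast
  have 1: "susp_act X \<phi> k (y, t) = susp_act X \<phi> (k + n) (x, s)" for k
    unfolding susp_act_def n using it_add[OF assms, of k n] by simp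
  have 2: "susp_act X \<phi> k (x, s) = susp_act X \<phi> (k - n) (y, t)" for k using 1[of "k - n"] by simp
  show "cls (x, s) = cls (y, t)"
    unfolding susp_class_def
    by (intro antisym image_subsetI) (subst 2, rule rangeI, subst 1, rule rangeI)
qed

lemma cls_shift: "x \<in> topspace X \<Longrightarrow> cls (it n x, s - of_int n) = cls (x, s)"
  using cls_eq_iff by metis

lemma cls_in_Y [simp]: "x \<in> topspace X \<Longrightarrow> cls (x, t) \<in> topspace Y"
  by (auto simp: topspace_suspension)

lemma Y_cases:
  assumes "y \<in> topspace Y" obtains x t where "x \<in> topspace X" "y = cls (x, t)"
  using assms by (auto simp: topspace_suspension)

text \<open>A class is literally an orbit of pairs, so the map is applied to its members and needs
  no representative. The restriction to \<open>topspace Y\<close> gives the extensionality that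
  \<open>homeo_group\<close> demands.\<close>

definition flow_map :: "('a \<Rightarrow> real \<Rightarrow> real) \<Rightarrow> ('a \<times> real) set \<Rightarrow> ('a \<times> real) set" where
  "flow_map F = (\<lambda>y\<in>topspace Y. (\<lambda>(x, t). (x, F x t)) ` y)"

definition equivariant :: "('a \<Rightarrow> real \<Rightarrow> real) \<Rightarrow> bool" where
  "equivariant F \<longleftrightarrow> (\<forall>x\<in>topspace X. \<forall>n t. F (it n x) (t - of_int n) = F x t - of_int n)"

lemma equivariantD: "equivariant F \<Longrightarrow> x \<in> topspace X \<Longrightarrow> F (it n x) (t - of_int n) = F x t - of_int n"
  by (simp add: equivariant_def)

lemma equivariant_shift:
  "equivariant F \<Longrightarrow> x \<in> topspace X \<Longrightarrow> F x t = F (it n x) (t - of_int n) + of_int n"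
  by (simp add: equivariant_def)

lemma flow_map_cls:
  assumes "equivariant F" "x \<in> topspace X" shows "flow_map F (cls (x, t)) = cls (x, F x t)"
proof -
  have "(\<lambda>(x, t). (x, F x t)) ` cls (x, t) = cls (x, F x t)"
    unfolding susp_class_def susp_act_def image_image using assms by (simp add: equivariantD)
  then show ?thesis using assms by (simp add: flow_map_def)
qed

text \<open>Wider than the dyadic families \<open>leaf_maps\<close>: the straight-line isotopy to
  the identity leaves the dyadic maps but stays in this class.\<close>

definition leaf_homeo :: "('a \<Rightarrow> real \<Rightarrow> real) \<Rightarrow> bool" where
  "leaf_homeo F \<longleftrightarrow> equivariant F \<and>
     continuous_map (prod_topology X euclideanreal) euclideanreal (\<lambda>(x, t). F x t) \<and>
     (\<forall>x\<in>topspace X. strict_mono (F x) \<and> surj (F x))"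

lemma leaf_homeoD:
  assumes "leaf_homeo F"
  shows "equivariant F" "continuous_map (prod_topology X euclideanreal) euclideanreal (\<lambda>(x, t). F x t)"
    "x \<in> topspace X \<Longrightarrow> F x s < F x t \<longleftrightarrow> s < t"
    "x \<in> topspace X \<Longrightarrow> finv (F x) (F x t) = t" "x \<in> topspace X \<Longrightarrow> F x (finv (F x) t) = t"
  using assms unfolding leaf_homeo_def
  by (auto simp: strict_mono_less surj_f_inv_f strict_mono_imp_inj_on)

lemma equivariant_finv:
  assumes F: "equivariant F" and bij: "\<And>x. x \<in> topspace X \<Longrightarrow> bij (F x)"
  shows "equivariant (\<lambda>x. finv (F x))"
  unfolding equivariant_def
proof (intro ballI allI)
  fix x n t assume x: "x \<in> topspace X"
  define s where "s = finv (F x) t"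
  have "F x s = t" using bij[OF x] by (simp add: s_def bij_is_surj surj_f_inv_f)
  then have "F (it n x) (s - of_int n) = t - of_int n" using equivariantD[OF F x] by simp
  then have "finv (F (it n x)) (t - of_int n) = s - of_int n"
    using bij[of "it n x"] x by (metis bij_is_inj inv_f_f it_in)
  then show "finv (F (it n x)) (t - of_int n) = finv (F x) t - of_int n" by (simp add: s_def)
qed

text \<open>The inverse exceeds \<open>c\<close> exactly where \<open>s > F x c\<close>, so both
  semicontinuities of the inverse reduce to continuity of \<open>F\<close> with its second argument
  fixed at \<open>c\<close>.\<close>

lemma leaf_homeo_finv:
  assumes F: "leaf_homeo F" shows "leaf_homeo (\<lambda>x. finv (F x))"
proof -
  note FD = leaf_homeoD[OF F]
  have bij: "bij (F x)" if "x \<in> topspace X" for x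
    using F that unfolding leaf_homeo_def bij_def by (auto simp: strict_mono_imp_inj_on)
  have less: "finv (F x) s < t \<longleftrightarrow> s < F x t" "t < finv (F x) s \<longleftrightarrow> F x t < s" if "x \<in> topspace X" for x s t
    using FD(3)[OF that, of "finv (F x) s" t] FD(3)[OF that, of t "finv (F x) s"] FD(5)[OF that] by simp_all
  have slice: "continuous_map X euclideanreal (\<lambda>x. F x t)" for t
  proof -
    have "continuous_map X (prod_topology X euclideanreal) (\<lambda>x. (x, t))"
      by (intro continuous_map_pairedI) auto
    from continuous_map_compose[OF this FD(2)] show ?thesis by (simp add: comp_def)
  qed
  have "continuous_map (prod_topology X euclideanreal) euclideanreal (\<lambda>(x, s). finv (F x) s)"
    unfolding continuous_map_upper_lower_semicontinuous_lt
  proof (intro conjI allI)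
    fix c
    have "openin (prod_topology X euclideanreal) {z \<in> topspace (prod_topology X euclideanreal). snd z - F (fst z) c \<in> {0<..}}"
    proof (rule openin_continuous_map_preimage)
      show "continuous_map (prod_topology X euclideanreal) euclideanreal (\<lambda>z. snd z - F (fst z) c)"
        using continuous_map_compose[OF continuous_map_fst slice[of c], of euclideanreal]
        by (intro continuous_map_diff continuous_map_snd) (simp add: comp_def)
    qed auto
    moreover have "{z \<in> topspace (prod_topology X euclideanreal). snd z - F (fst z) c \<in> {0<..}}
      = {z \<in> topspace (prod_topology X euclideanreal). c < (\<lambda>(x, s). finv (F x) s) z}"
      using less by auto
    ultimately show "openin (prod_topology X euclideanreal) {z \<in> topspace (prod_topology X euclideanreal). c < (\<lambda>(x, s). finv (F x) s) z}"
      by simp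
    have "openin (prod_topology X euclideanreal) {z \<in> topspace (prod_topology X euclideanreal). snd z - F (fst z) c \<in> {..<0}}"
    proof (rule openin_continuous_map_preimage)
      show "continuous_map (prod_topology X euclideanreal) euclideanreal (\<lambda>z. snd z - F (fst z) c)"
        using continuous_map_compose[OF continuous_map_fst slice[of c], of euclideanreal]
        by (intro continuous_map_diff continuous_map_snd) (simp add: comp_def)
    qed auto
    moreover have "{z \<in> topspace (prod_topology X euclideanreal). snd z - F (fst z) c \<in> {..<0}}
      = {z \<in> topspace (prod_topology X euclideanreal). (\<lambda>(x, s). finv (F x) s) z < c}"
      using less by auto
    ultimately show "openin (prod_topology X euclideanreal) {z \<in> topspace (prod_topology X euclideanreal). (\<lambda>(x, s). finv (F x) s) z < c}"
      by simp
  qed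
  moreover have "strict_mono (finv (F x))" if "x \<in> topspace X" for x
    using less[OF that] FD(5)[OF that] by (simp add: strict_mono_def)
  moreover have "surj (finv (F x))" if "x \<in> topspace X" for x
    using bij[OF that] by (simp add: bij_is_inj inj_imp_surj_inv)
  ultimately show ?thesis
    unfolding leaf_homeo_def using equivariant_finv[OF FD(1) bij] by blast
qed

lemma continuous_flow_map:
  assumes F: "leaf_homeo F" shows "continuous_map Y Y (flow_map F)"
proof (rule continuous_compose_quotient_map[OF quotient_map_susp_class])
  have "continuous_map (prod_topology X euclideanreal) (prod_topology X euclideanreal) (\<lambda>z. (fst z, F (fst z) (snd z)))"
    using leaf_homeoD(2)[OF F] by (intro continuous_map_pairedI continuous_map_fst) (simp add: case_prod_unfold)
  then have "continuous_map (prod_topology X euclideanreal) Y (cls \<circ> (\<lambda>z. (fst z, F (fst z) (snd z))))"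
    using continuous_map_compose quotient_imp_continuous_map[OF quotient_map_susp_class] by blast
  then show "continuous_map (prod_topology X euclideanreal) Y (flow_map F \<circ> cls)"
    by (rule continuous_map_eq) (use flow_map_cls[OF leaf_homeoD(1)[OF F]] in auto)
qed

lemma homeomorphic_flow_map:
  assumes F: "leaf_homeo F" shows "homeomorphic_map Y Y (flow_map F)"
proof -
  let ?F' = "\<lambda>x. finv (F x)"
  have F': "leaf_homeo ?F'" using leaf_homeo_finv[OF F] .
  have "homeomorphic_maps Y Y (flow_map F) (flow_map ?F')"
    unfolding homeomorphic_maps_def
  proof (intro conjI ballI continuous_flow_map F F')
    fix y assume "y \<in> topspace Y"
    then obtain x t where "x \<in> topspace X" "y = cls (x, t)" by (rule Y_cases)
    then show "flow_map ?F' (flow_map F y) = y" "flow_map F (flow_map ?F' y) = y"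
      using leaf_homeoD(1)[OF F] leaf_homeoD(1)[OF F'] leaf_homeoD(4,5)[OF F] by (auto simp: flow_map_cls)
  qed
  then show ?thesis by (auto simp: homeomorphic_map_maps)
qed

text \<open>The isotopy is the straight line from the identity to \<open>F\<close> on each leaf. It
  is equivariant because the integers act on the line by translations.\<close>

lemma isotopic_flow_map:
  assumes F: "leaf_homeo F" shows "isotopic_to_id Y (flow_map F)"
proof -
  define H where "H s = (\<lambda>x t. (1 - s) * t + s * F x t)" for s
  let ?I = "top_of_set {0..1::real}"
  have contF: "continuous_map (prod_topology X euclideanreal) euclideanreal (\<lambda>z. F (fst z) (snd z))"
    using leaf_homeoD(2)[OF F] by (simp add: case_prod_unfold)
  have eq: "equivariant (H s)" for s
    unfolding equivariant_def H_def
    by (intro ballI allI) (simp add: equivariantD[OF leaf_homeoD(1)[OF F]] algebra_simps)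
  have H: "leaf_homeo (H s)" if s: "s \<in> {0..1}" for s
    unfolding leaf_homeo_def
  proof (intro conjI ballI eq)
    show "continuous_map (prod_topology X euclideanreal) euclideanreal (\<lambda>(x, t). H s x t)"
      unfolding H_def case_prod_unfold
      by (intro continuous_map_add continuous_map_real_mult contF continuous_map_snd continuous_map_canonical_const)
  next
    fix x assume x: "x \<in> topspace X"
    show mono: "strict_mono (H s x)"
    proof
      fix t u :: real assume tu: "t < u"
      then have F: "F x t < F x u" using leaf_homeoD(3)[OF F x] by simp
      show "H s x t < H s x u"
      proof (cases "s = 0")
        case False
        then have "s * F x t < s * F x u" "(1 - s) * t \<le> (1 - s) * u"
          using F tu s by (auto intro: mult_left_mono)
        then show ?thesis by (simp add: H_def)
      qed (use tu in \<open>simp add: H_def\<close>)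
    qed
    have slice: "continuous_on UNIV (F x)"
      by (rule continuous_onI_mono)
        (use F x in \<open>auto simp: leaf_homeo_def strict_mono_less_eq\<close>)
    show "surj (H s x)"
      unfolding surj_def
    proof
      fix y
      \<comment> \<open>The identity and \<open>F x\<close> are both at most \<open>y\<close> at
        \<open>a\<close> and at least \<open>y\<close> at \<open>b\<close>, hence so are their
        convex combinations.\<close>
      define a where "a = min y (finv (F x) y)"
      define b where "b = max y (finv (F x) y)"
      have Fa: "F x a \<le> y" "y \<le> F x b"
        using F x leaf_homeoD(5)[OF F x, of y] unfolding leaf_homeo_def a_def b_def
        by (metis min.cobounded2 strict_mono_less_eq, metis max.cobounded2 strict_mono_less_eq)
      have "H s x a \<le> (1 - s) * y + s * y"
        unfolding H_def using Fa s by (intro add_mono mult_left_mono) (auto simp: a_def)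
      moreover have "(1 - s) * y + s * y \<le> H s x b"
        unfolding H_def using Fa s by (intro add_mono mult_left_mono) (auto simp: b_def)
      moreover have "continuous_on {a..b} (H s x)"
        unfolding H_def by (intro continuous_intros continuous_on_subset[OF slice]) auto
      moreover have "a \<le> b" by (simp add: a_def b_def)
      ultimately have "\<exists>z. a \<le> z \<and> z \<le> b \<and> H s x z = y"
        by (intro IVT') (auto simp: algebra_simps)
      then show "\<exists>z. y = H s x z" by metis
    qed
  qed
  define h where "h = (\<lambda>(s, y). flow_map (H s) y)"
  have "continuous_map (prod_topology ?I Y) Y h"
  proof (rule continuous_compose_quotient_map)
    \<comment> \<open>Continuity may be tested before passing to classes, because the product of a
      quotient map with the locally compact interval \<open>{0..1}\<close> is again a quotient
      map.\<close>
    show "quotient_map (prod_topology ?I (prod_topology X euclideanreal)) (prod_topology ?I Y) (\<lambda>(s, z). (s, cls z))"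
      by (intro quotient_map_prod_right quotient_map_susp_class)
        (auto simp: compact_imp_locally_compact_space compact_space_subtopology Hausdorff_space_subtopology)
    let ?P = "prod_topology ?I (prod_topology X euclideanreal)"
    have c: "continuous_map ?P X (\<lambda>z. fst (snd z))" "continuous_map ?P euclideanreal (\<lambda>z. snd (snd z))"
      using continuous_map_compose[OF continuous_map_snd continuous_map_fst, of ?I X euclideanreal]
        continuous_map_compose[OF continuous_map_snd continuous_map_snd, of ?I X euclideanreal]
      by (simp_all add: comp_def)
    have "continuous_map ?P ?I fst" by (rule continuous_map_fst)
    then have c1: "continuous_map ?P euclideanreal fst" by (rule continuous_map_into_fulltopology)
    have "continuous_map ?P euclideanreal ((\<lambda>z. F (fst z) (snd z)) \<circ> snd)"
      by (rule continuous_map_compose[OF continuous_map_snd contF])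
    then have c2: "continuous_map ?P euclideanreal (\<lambda>z. F (fst (snd z)) (snd (snd z)))" by (simp add: comp_def)
    have "continuous_map ?P euclideanreal (\<lambda>z. H (fst z) (fst (snd z)) (snd (snd z)))"
      unfolding H_def
      by (intro continuous_map_add continuous_map_diff continuous_map_real_mult c c1 c2 continuous_map_canonical_const)
    then have "continuous_map ?P (prod_topology X euclideanreal) (\<lambda>z. (fst (snd z), H (fst z) (fst (snd z)) (snd (snd z))))"
      using c by (intro continuous_map_pairedI) auto
    then have "continuous_map ?P Y (cls \<circ> (\<lambda>z. (fst (snd z), H (fst z) (fst (snd z)) (snd (snd z)))))"
      using continuous_map_compose quotient_imp_continuous_map[OF quotient_map_susp_class] by blast
    then show "continuous_map ?P Y (h \<circ> (\<lambda>(s, z). (s, cls z)))"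
      by (rule continuous_map_eq) (auto simp: h_def flow_map_cls[OF eq])
  qed
  moreover have "h (0, y) = id y" "h (1, y) = flow_map F y" if y: "y \<in> topspace Y" for y
  proof -
    obtain x t where "x \<in> topspace X" "y = cls (x, t)" using y by (rule Y_cases)
    then have "h (s, y) = cls (x, H s x t)" "flow_map F y = cls (x, F x t)" for s
      by (simp_all add: h_def flow_map_cls eq leaf_homeoD(1)[OF F])
    then show "h (0, y) = id y" "h (1, y) = flow_map F y"
      using \<open>y = cls (x, t)\<close> by (simp_all add: H_def)
  qed
  moreover have "homeomorphic_map Y Y (\<lambda>y. h (s, y))" if "s \<in> {0..1}" for s
    using homeomorphic_flow_map[OF H[OF that]] by (simp add: h_def)
  ultimately show ?thesis
    unfolding isotopic_to_id_def
    by (subst homotopic_with) (blast intro: homeomorphic_map_eq, blast)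
qed

lemma flow_map_in_H0:
  assumes F: "leaf_homeo F" shows "flow_map F \<in> H0 X \<phi>"
proof -
  have h: "homeomorphic_map Y Y (flow_map F)" using F by (rule homeomorphic_flow_map)
  moreover have "flow_map F \<in> extensional (topspace Y)" by (simp add: flow_map_def)
  ultimately have "flow_map F \<in> Bij (topspace Y)"
    by (simp add: Bij_def bij_betw_def homeomorphic_imp_injective_map homeomorphic_imp_surjective_map)
  then show ?thesis using h isotopic_flow_map[OF F] by (simp add: H0_def homeo_group_def)
qed

end

section \<open>Passing between dyadic charts and germs\<close>

lemma dyadic_germ_shift:
  assumes "dyadic_germ f (t - of_int n)" shows "dyadic_germ (\<lambda>s. f (s - of_int n) + of_int n) t"
proof -
  obtain e m m' \<beta> \<beta>' where *: "0 < e" "\<beta> \<in> D" "\<beta>' \<in> D"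
    "\<And>s. t - of_int n - e < s \<Longrightarrow> s \<le> t - of_int n \<Longrightarrow> f s = 2 powi m * s + \<beta>"
    "\<And>s. t - of_int n \<le> s \<Longrightarrow> s < t - of_int n + e \<Longrightarrow> f s = 2 powi m' * s + \<beta>'"
    "t - of_int n \<in> D \<or> m = m' \<and> \<beta> = \<beta>'"
    using assms by (rule dyadic_germE) blast
  have D: "t - of_int n \<in> D \<Longrightarrow> t \<in> D"
    using dyadic_rats_add[of "t - of_int n" "of_int n"] by simp
  show ?thesis
  proof (rule dyadic_germI[OF *(1)])
    show "\<beta> - 2 powi m * of_int n + of_int n \<in> D" "\<beta>' - 2 powi m' * of_int n + of_int n \<in> D"
      using * by (intro dyadic_rats_add dyadic_rats_diff dyadic_rats_mult; blast)+
    show "t \<in> D \<or> m = m' \<and> \<beta> - 2 powi m * of_int n + of_int n = \<beta>' - 2 powi m' * of_int n + of_int n"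
      using *(6) D by blast
  next
    fix s assume "t - e < s" "s \<le> t"
    then show "f (s - of_int n) + of_int n = 2 powi m * s + (\<beta> - 2 powi m * of_int n + of_int n)"
      using *(4)[of "s - of_int n"] by (simp add: algebra_simps)
  next
    fix s assume "t \<le> s" "s < t + e"
    then show "f (s - of_int n) + of_int n = 2 powi m' * s + (\<beta>' - 2 powi m' * of_int n + of_int n)"
      using *(5)[of "s - of_int n"] by (simp add: algebra_simps)
  qed
qed

lemma affine_at_left_end:
  fixes f :: "real \<Rightarrow> real"
  assumes "isCont f t" "0 < e" "\<And>s. t < s \<Longrightarrow> s < t + e \<Longrightarrow> f s = c * s + \<beta>"
  shows "f t = c * t + \<beta>"
proof -
  have "(f \<longlongrightarrow> f t) (at_right t)" using assms(1) by (simp add: isCont_def filterlim_at_split)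
  moreover have "\<forall>\<^sub>F s in at_right t. c * s + \<beta> = f s"
    using assms(2,3) by (auto simp: eventually_at_right_field intro!: exI[of _ "t + e"])
  moreover have "((\<lambda>s. c * s + \<beta>) \<longlongrightarrow> c * t + \<beta>) (at_right t)" by (intro tendsto_intros)
  ultimately show ?thesis
    using Lim_transform_eventually tendsto_unique trivial_limit_at_right_real by blast
qed

lemma affine_at_right_end:
  fixes f :: "real \<Rightarrow> real"
  assumes "isCont f t" "0 < e" "\<And>s. t - e < s \<Longrightarrow> s < t \<Longrightarrow> f s = c * s + \<beta>"
  shows "f t = c * t + \<beta>"
proof -
  have "(f \<longlongrightarrow> f t) (at_left t)" using assms(1) by (simp add: isCont_def filterlim_at_split)
  moreover have "\<forall>\<^sub>F s in at_left t. c * s + \<beta> = f s"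
    using assms(2,3) by (auto simp: eventually_at_left_field intro!: exI[of _ "t - e"])
  moreover have "((\<lambda>s. c * s + \<beta>) \<longlongrightarrow> c * t + \<beta>) (at_left t)" by (intro tendsto_intros)
  ultimately show ?thesis
    using Lim_transform_eventually tendsto_unique trivial_limit_at_left_real by blast
qed

text \<open>The breakpoint set is finite, so each side of \<open>t\<close> starts inside a single
  affine piece; continuity extends both formulas to \<open>t\<close>.\<close>

lemma dyadic_PL_homeo_germ:
  assumes f: "dyadic_PL_homeo a b c d f" and t: "a < t" "t < b"
  shows "dyadic_germ f t"
proof -
  obtain B where B: "finite B" "B \<subseteq> D"
    and aff: "\<forall>K\<in>components ({a<..<b} - B). \<exists>m::int. \<exists>\<beta>\<in>D. \<forall>t\<in>K. f t = 2 powi m * t + \<beta>"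
    using f unfolding dyadic_PL_homeo_def by (elim conjE exE)
  have "continuous_map (top_of_set {a<..<b}) (top_of_set {c<..<d}) f"
    using f unfolding dyadic_PL_homeo_def by (intro homeomorphic_imp_continuous_map) blast
  then have "continuous_on {a<..<b} f" by (auto simp: continuous_map_in_subtopology)
  then have cont: "isCont f t" using t by (simp add: continuous_on_eq_continuous_at)
  obtain d0 where d0: "0 < d0" "\<And>x. x \<in> B \<Longrightarrow> x \<noteq> t \<Longrightarrow> d0 \<le> dist t x"
    using finite_set_avoid[OF B(1), of t] by blast
  define e where "e = min d0 (min (t - a) (b - t))"
  have e: "0 < e" "a \<le> t - e" "t + e \<le> b" "e \<le> d0" using t d0 by (auto simp: e_def)
  have avoid: "x \<notin> B" if "\<bar>x - t\<bar> < e" "x \<noteq> t" for x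
    using d0(2)[of x] that e by (auto simp: dist_real_def)
  have piece: "\<exists>m::int. \<exists>\<beta>\<in>D. \<forall>t\<in>I. f t = 2 powi m * t + \<beta>"
    if I: "I \<subseteq> {a<..<b} - B" "I \<noteq> {}" "connected I" for I
  proof -
    obtain K where "K \<in> components ({a<..<b} - B)" "I \<subseteq> K"
      using exists_component_superset[of I "{a<..<b} - B"] I by blast
    then show ?thesis using aff by blast
  qed
  show ?thesis
  proof (cases "t \<in> B")
    case False
    have "{t - e<..<t + e} \<subseteq> {a<..<b} - B"
    proof
      fix x assume x: "x \<in> {t - e<..<t + e}"
      then have "\<bar>x - t\<bar> < e" by (simp add: abs_less_iff)
      then have "x \<notin> B" using avoid[of x] False by (cases "x = t") auto
      then show "x \<in> {a<..<b} - B" using x e by auto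
    qed
    then obtain m \<beta> where "\<beta> \<in> D" "\<forall>s\<in>{t - e<..<t + e}. f s = 2 powi (m::int) * s + \<beta>"
      using piece[of "{t - e<..<t + e}"] e by auto
    then show ?thesis using e by (intro dyadic_germI[of e \<beta> \<beta> t f m m]) auto
  next
    case True
    have "x \<in> {a<..<b} - B" if "t - e < x" "x < t + e" "x \<noteq> t" for x
    proof -
      have "\<bar>x - t\<bar> < e" using that by (simp add: abs_less_iff)
      then show ?thesis using avoid[of x] that e by auto
    qed
    then have "{t - e<..<t} \<subseteq> {a<..<b} - B" "{t<..<t + e} \<subseteq> {a<..<b} - B"
      using e by auto
    then obtain m \<beta> m' \<beta>' where D: "\<beta> \<in> D" "\<beta>' \<in> D"
      and l: "\<forall>s\<in>{t - e<..<t}. f s = 2 powi (m::int) * s + \<beta>"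
      and r: "\<forall>s\<in>{t<..<t + e}. f s = 2 powi (m'::int) * s + \<beta>'"
      using piece[of "{t - e<..<t}"] piece[of "{t<..<t + e}"] e by auto
    have "f t = 2 powi m * t + \<beta>" using l by (intro affine_at_right_end[OF cont e(1)]) auto
    moreover have "f t = 2 powi m' * t + \<beta>'" using r by (intro affine_at_left_end[OF cont e(1)]) auto
    ultimately have "f s = 2 powi m * s + \<beta>" if "t - e < s" "s \<le> t" for s
      using l that by (cases "s = t") auto
    moreover have "f s = 2 powi m' * s + \<beta>'" if "t \<le> s" "s < t + e" for s
      using r that \<open>f t = 2 powi m' * t + \<beta>'\<close> by (cases "s = t") auto
    ultimately show ?thesis using D e True B by (intro dyadic_germI[of e \<beta> \<beta>' t f m m']) auto
  qed
qed

text \<open>The interval is so small that the germ formulas are exact on it and that it and its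
  image are shorter than 1. Return times are at least 1, so any clopen set then gives charts on both
  sides.\<close>

lemma PLD_local_chart:
  assumes f: "f \<in> PLD" and "0 < e"
  obtains a b where "t - e < a" "a < t" "t < b" "b < t + e" "b - a < 1" "f b - f a < 1"
    "dyadic_PL_homeo a b (f a) (f b) f"
proof -
  obtain e' m m' \<beta> \<beta>' where *: "0 < e'" "\<beta> \<in> D" "\<beta>' \<in> D"
    "\<And>s. t - e' < s \<Longrightarrow> s \<le> t \<Longrightarrow> f s = 2 powi m * s + \<beta>"
    "\<And>s. t \<le> s \<Longrightarrow> s < t + e' \<Longrightarrow> f s = 2 powi m' * s + \<beta>'"
    "t \<in> D \<or> m = m' \<and> \<beta> = \<beta>'"
    using PLD_germ[OF f, of t] by (rule dyadic_germE) blast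
  have lt: "finv f (f t - 1/2) < t" "t < finv f (f t + 1/2)"
    using PLD_less_iff[OF f, of "finv f (f t - 1/2)" t] PLD_less_iff[OF f, of t "finv f (f t + 1/2)"] f by simp_all
  define l where "l = Max {t - e, t - e', t - 1/2, finv f (f t - 1/2)}"
  define r where "r = Min {t + e, t + e', t + 1/2, finv f (f t + 1/2)}"
  have "l < t" "t < r" unfolding l_def r_def using assms * lt by auto
  obtain a where a: "a \<in> D" "l < a" "a < t" using dyadic_rats_between[OF \<open>l < t\<close>] by blast
  obtain b where b: "b \<in> D" "t < b" "b < r" using dyadic_rats_between[OF \<open>t < r\<close>] by blast
  have a': "t - e < a" "t - e' < a" "t - 1/2 < a" "finv f (f t - 1/2) < a" using a unfolding l_def by auto
  have b': "b < t + e" "b < t + e'" "b < t + 1/2" "b < finv f (f t + 1/2)" using b unfolding r_def by auto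
  have "f t - 1/2 < f a" "f b < f t + 1/2"
    using PLD_less_iff[OF f, of "finv f (f t - 1/2)" a] PLD_less_iff[OF f, of b "finv f (f t + 1/2)"] f a' b' by auto
  then have fab: "f b - f a < 1" by simp
  have "homeomorphic_maps (top_of_set {a<..<b}) (top_of_set {f a<..<f b}) f (finv f)"
    unfolding homeomorphic_maps_def
  proof (intro conjI ballI)
    show "continuous_map (top_of_set {a<..<b}) (top_of_set {f a<..<f b}) f"
      using f PLD_continuous[OF f] by (auto simp: continuous_map_in_subtopology intro: continuous_on_subset)
    have "a < finv f s \<and> finv f s < b" if "f a < s" "s < f b" for s
      using that PLD_less_iff[OF f, of a "finv f s"] PLD_less_iff[OF f, of "finv f s" b] f by simp
    then show "continuous_map (top_of_set {f a<..<f b}) (top_of_set {a<..<b}) (finv f)"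
      using f PLD_continuous[OF PLD_inv[OF f]] by (auto simp: continuous_map_in_subtopology intro: continuous_on_subset)
  qed (use f in auto)
  then have hm: "homeomorphic_map (top_of_set {a<..<b}) (top_of_set {f a<..<f b}) f"
    by (auto simp: homeomorphic_map_maps)
  \<comment> \<open>The breakpoint set \<open>{t} \<inter> D\<close> is empty for a non-dyadic
    \<open>t\<close>, where the formula does not change.\<close>
  have "\<exists>m::int. \<exists>\<beta>\<in>D. \<forall>s\<in>K. f s = 2 powi m * s + \<beta>" if K: "K \<in> components ({a<..<b} - {t} \<inter> D)" for K
  proof -
    have Ks: "K \<subseteq> {a<..<b} - {t} \<inter> D" "connected K" using K in_components_subset in_components_connected by auto
    show ?thesis
    proof (cases "t \<in> D")
      case False
      then have "f s = 2 powi m * s + \<beta>" if "s \<in> K" for s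
        using *(4)[of s] *(5)[of s] *(6) Ks that a' b' by (cases "s \<le> t") auto
      then show ?thesis using * by blast
    next
      case True
      then have "t \<notin> K" using Ks by auto
      have "(\<forall>s\<in>K. s < t) \<or> (\<forall>s\<in>K. t < s)"
      proof (rule ccontr)
        assume "\<not> ?thesis"
        then obtain r s where "r \<in> K" "s \<in> K" "r \<le> t" "t \<le> s" by (meson not_le)
        then have "t \<in> K" using Ks(2) by (meson connected_contains_Icc atLeastAtMost_iff subsetD)
        then show False using \<open>t \<notin> K\<close> by simp
      qed
      then show ?thesis
      proof
        assume "\<forall>s\<in>K. s < t"
        then have "\<forall>s\<in>K. f s = 2 powi m * s + \<beta>" using *(4) Ks a' by force
        then show ?thesis using * by blast
      next
        assume "\<forall>s\<in>K. t < s"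
        then have "\<forall>s\<in>K. f s = 2 powi m' * s + \<beta>'" using *(5) Ks b' by force
        then show ?thesis using * by blast
      qed
    qed
  qed
  then have "dyadic_PL_homeo a b (f a) (f b) f"
    unfolding dyadic_PL_homeo_def using hm a b f
    by (intro conjI exI[of _ "{t} \<inter> D"]) auto
  then show ?thesis using that[of a b] a a' b b' fab by auto
qed

section \<open>The group of locally constant dyadic families and its map onto T(phi)\<close>

context stone_dynamics
begin

text \<open>The last clause is the chart condition: near \<open>(x, t)\<close> the new time does not
  depend on the first coordinate. Off \<open>topspace X\<close> the value is pinned to
  \<open>id\<close>, so that equal maps are equal functions.\<close>

definition leaf_maps :: "('a \<Rightarrow> real \<Rightarrow> real) set" where
  "leaf_maps = {F. equivariant F \<and> (\<forall>x\<in>topspace X. F x \<in> PLD) \<and> (\<forall>x. x \<notin> topspace X \<longrightarrow> F x = id) \<and>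
     (\<forall>x\<in>topspace X. \<forall>t. \<exists>U e. openin X U \<and> x \<in> U \<and> 0 < e \<and>
        (\<forall>x'\<in>U. \<forall>s. \<bar>s - t\<bar> < e \<longrightarrow> F x' s = F x s))}"

lemma leaf_mapsD:
  assumes "F \<in> leaf_maps"
  shows "equivariant F" "x \<in> topspace X \<Longrightarrow> F x \<in> PLD" "x \<notin> topspace X \<Longrightarrow> F x = id"
  using assms by (auto simp: leaf_maps_def)

lemma leaf_maps_PLD: "F \<in> leaf_maps \<Longrightarrow> F x \<in> PLD"
  by (cases "x \<in> topspace X") (auto simp: leaf_mapsD)

lemma leaf_maps_locally_constant:
  assumes "F \<in> leaf_maps" "x \<in> topspace X"
  obtains U e where "openin X U" "x \<in> U" "0 < e" "\<And>x' s. x' \<in> U \<Longrightarrow> \<bar>s - t\<bar> < e \<Longrightarrow> F x' s = F x s"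
proof -
  have "\<exists>U e. openin X U \<and> x \<in> U \<and> 0 < e \<and> (\<forall>x'\<in>U. \<forall>s. \<bar>s - t\<bar> < e \<longrightarrow> F x' s = F x s)"
    using assms unfolding leaf_maps_def by (elim CollectE conjE) (drule (1) bspec, erule spec)
  then show ?thesis using that by blast
qed

lemma leaf_maps_leaf_homeo:
  assumes F: "F \<in> leaf_maps" shows "leaf_homeo F"
proof -
  let ?P = "prod_topology X euclideanreal"
  have "continuous_map ?P euclideanreal (\<lambda>(x, t). F x t)"
    unfolding continuous_map_def
  proof (intro conjI allI impI)
    fix V :: "real set" assume V: "openin euclideanreal V"
    show "openin ?P {z \<in> topspace ?P. (case z of (x, t) \<Rightarrow> F x t) \<in> V}" (is "openin ?P ?S")
    proof (subst openin_subopen, rule ballI)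
      fix z assume "z \<in> ?S"
      then obtain x t where z: "z = (x, t)" "x \<in> topspace X" "F x t \<in> V" by auto
      obtain U e where U: "openin X U" "x \<in> U" "0 < e" "\<And>x' s. x' \<in> U \<Longrightarrow> \<bar>s - t\<bar> < e \<Longrightarrow> F x' s = F x s"
        using leaf_maps_locally_constant[OF F z(2)] by blast
      have "open (F x -` V)"
        using PLD_continuous[OF leaf_mapsD(2)[OF F z(2)]] V by (auto intro: open_vimage)
      then have "open ({t - e<..<t + e} \<inter> F x -` V)" by auto
      then have "openin ?P (U \<times> ({t - e<..<t + e} \<inter> F x -` V))"
        using U by (simp add: openin_prod_Times_iff)
      moreover have "z \<in> U \<times> ({t - e<..<t + e} \<inter> F x -` V)" using z U(2,3) by auto
      moreover have "U \<times> ({t - e<..<t + e} \<inter> F x -` V) \<subseteq> ?S"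
      proof (rule subrelI)
        fix x' s assume xs: "(x', s) \<in> U \<times> ({t - e<..<t + e} \<inter> F x -` V)"
        then have "F x' s = F x s" by (intro U(4)) auto
        then show "(x', s) \<in> ?S" using xs openin_subset[OF U(1)] by auto
      qed
      ultimately show "\<exists>T. openin ?P T \<and> z \<in> T \<and> T \<subseteq> ?S" by blast
    qed
  qed auto
  then show ?thesis
    unfolding leaf_homeo_def using leaf_mapsD[OF F] PLD_strict_mono PLD_surj by blast
qed

definition leaf_group :: "('a \<Rightarrow> real \<Rightarrow> real) monoid" where
  "leaf_group = \<lparr>carrier = leaf_maps, mult = (\<lambda>F G x. F x \<circ> G x), one = (\<lambda>x. id)\<rparr>"

lemma leaf_group_simps [simp]:
  "carrier leaf_group = leaf_maps" "F \<otimes>\<^bsub>leaf_group\<^esub> G = (\<lambda>x. F x \<circ> G x)" "\<one>\<^bsub>leaf_group\<^esub> = (\<lambda>x. id)"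
  by (simp_all add: leaf_group_def)

lemma leaf_maps_comp:
  assumes F: "F \<in> leaf_maps" and G: "G \<in> leaf_maps" shows "(\<lambda>x. F x \<circ> G x) \<in> leaf_maps"
proof -
  have "equivariant (\<lambda>x. F x \<circ> G x)"
    using leaf_mapsD(1)[OF F] leaf_mapsD(1)[OF G] unfolding equivariant_def by simp
  moreover have "\<exists>U e. openin X U \<and> x \<in> U \<and> 0 < e \<and>
      (\<forall>x'\<in>U. \<forall>s. \<bar>s - t\<bar> < e \<longrightarrow> (F x' \<circ> G x') s = (F x \<circ> G x) s)" if x: "x \<in> topspace X" for x t
  proof -
    obtain U e where U: "openin X U" "x \<in> U" "0 < e" "\<And>x' s. x' \<in> U \<Longrightarrow> \<bar>s - t\<bar> < e \<Longrightarrow> G x' s = G x s"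
      using leaf_maps_locally_constant[OF G x] by blast
    obtain V d where V: "openin X V" "x \<in> V" "0 < d" "\<And>x' s. x' \<in> V \<Longrightarrow> \<bar>s - G x t\<bar> < d \<Longrightarrow> F x' s = F x s"
      using leaf_maps_locally_constant[OF F x] by blast
    have "isCont (G x) t"
      using PLD_continuous[OF leaf_mapsD(2)[OF G x]] by (simp add: continuous_on_eq_continuous_at)
    then obtain c where c: "0 < c" "\<And>s. \<bar>s - t\<bar> < c \<Longrightarrow> \<bar>G x s - G x t\<bar> < d"
      using V(3) unfolding continuous_at_real_range by (metis real_norm_def)
    have "(F x' \<circ> G x') s = (F x \<circ> G x) s" if "x' \<in> U \<inter> V" "\<bar>s - t\<bar> < min c e" for x' s
    proof -
      have "G x' s = G x s" by (rule U(4)) (use that in auto)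
      moreover have "F x' (G x s) = F x (G x s)" by (rule V(4)) (use that c(2)[of s] in auto)
      ultimately show ?thesis by (simp only: comp_apply)
    qed
    moreover have "openin X (U \<inter> V)" "x \<in> U \<inter> V" "0 < min c e" using U(1-3) V(1-3) c(1) by auto
    ultimately show ?thesis by blast
  qed
  moreover have "F x \<circ> G x \<in> PLD" if "x \<in> topspace X" for x
    using leaf_mapsD(2) F G that by (intro PLD_comp)
  moreover have "F x \<circ> G x = id" if "x \<notin> topspace X" for x
    using leaf_mapsD(3)[OF F that] leaf_mapsD(3)[OF G that] by (metis id_comp)
  ultimately show ?thesis unfolding leaf_maps_def by blast
qed

lemma leaf_maps_id: "(\<lambda>x. id) \<in> leaf_maps"
proof -
  have "\<exists>U e. openin X U \<and> x \<in> U \<and> 0 < e \<and> (\<forall>x'\<in>U. \<forall>s. \<bar>s - t\<bar> < e \<longrightarrow> id s = id s)"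
    if "x \<in> topspace X" for x :: 'a and t :: real
    using that by (intro exI[of _ "topspace X"] exI[of _ 1]) auto
  then show ?thesis unfolding leaf_maps_def equivariant_def using PLD_id by auto
qed

lemma leaf_maps_finv:
  assumes F: "F \<in> leaf_maps" shows "(\<lambda>x. finv (F x)) \<in> leaf_maps"
proof -
  have "equivariant (\<lambda>x. finv (F x))"
    using leaf_mapsD[OF F] PLD_bij by (intro equivariant_finv) auto
  moreover have "\<exists>U e. openin X U \<and> x \<in> U \<and> 0 < e \<and>
      (\<forall>x'\<in>U. \<forall>s. \<bar>s - t\<bar> < e \<longrightarrow> finv (F x') s = finv (F x) s)" if x: "x \<in> topspace X" for x t
  proof -
    have Fx: "F x \<in> PLD" using leaf_mapsD(2)[OF F x] .
    define u where "u = finv (F x) t"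
    have t: "t = F x u" using Fx by (simp add: u_def)
    obtain U e where U: "openin X U" "x \<in> U" "0 < e" "\<And>x' s. x' \<in> U \<Longrightarrow> \<bar>s - u\<bar> < e \<Longrightarrow> F x' s = F x s"
      using leaf_maps_locally_constant[OF F x] by blast
    define d where "d = min (F x u - F x (u - e)) (F x (u + e) - F x u)"
    have "0 < d" using PLD_strict_mono[OF Fx] U(3) by (simp add: d_def strict_monoD)
    moreover have "finv (F x') s = finv (F x) s" if x': "x' \<in> U" and s: "\<bar>s - t\<bar> < d" for x' s
    proof -
      define r where "r = finv (F x) s"
      have r: "F x r = s" using Fx by (simp add: r_def)
      have "F x (u - e) < F x r" "F x r < F x (u + e)" using s unfolding d_def t r by linarith+
      then have "\<bar>r - u\<bar> < e" using Fx by auto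
      then have "F x' r = s" using U(4)[OF x'] r by simp
      moreover have "F x' \<in> PLD" using leaf_maps_PLD[OF F] .
      ultimately show ?thesis using r_def by (metis PLD_inv_f)
    qed
    ultimately show ?thesis using U by blast
  qed
  moreover have "finv (F x) \<in> PLD" if "x \<in> topspace X" for x using leaf_mapsD(2)[OF F that] by (rule PLD_inv)
  moreover have "finv (F x) = id" if "x \<notin> topspace X" for x
    using leaf_mapsD(3)[OF F that] by (metis inv_id)
  ultimately show ?thesis unfolding leaf_maps_def by blast
qed

lemma leaf_maps_finv_comp:
  assumes F: "F \<in> leaf_maps"
  shows "(\<lambda>x. finv (F x) \<circ> F x) = (\<lambda>x. id)" "(\<lambda>x. F x \<circ> finv (F x)) = (\<lambda>x. id)"
  using leaf_maps_PLD[OF F] by (auto simp: fun_eq_iff)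

lemma group_leaf_group: "group leaf_group"
proof (rule groupI)
  fix F assume F: "F \<in> carrier leaf_group"
  then show "\<exists>G\<in>carrier leaf_group. G \<otimes>\<^bsub>leaf_group\<^esub> F = \<one>\<^bsub>leaf_group\<^esub>"
    by (intro bexI[of _ "\<lambda>x. finv (F x)"])
      (simp_all only: leaf_group_simps leaf_maps_finv leaf_maps_finv_comp)
qed (simp_all only: leaf_group_simps leaf_maps_comp leaf_maps_id o_assoc id_comp)

lemma inv_leaf_group: "F \<in> leaf_maps \<Longrightarrow> inv\<^bsub>leaf_group\<^esub> F = (\<lambda>x. finv (F x))"
  by (rule group.inv_equality[OF group_leaf_group])
    (simp_all only: leaf_group_simps leaf_maps_finv leaf_maps_finv_comp)

lemma return_time_gt:
  assumes "r < 1" shows "ereal r < ereal_of_enat (return_time \<phi> C)"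
proof -
  have "1 \<le> return_time \<phi> C"
    unfolding return_time_def by (rule Inf_greatest) (auto simp: one_enat_def)
  then have "ereal_of_enat 1 \<le> ereal_of_enat (return_time \<phi> C)" by (simp only: ereal_of_enat_le_iff)
  then have "1 \<le> ereal_of_enat (return_time \<phi> C)" by (simp add: one_enat_def one_ereal_def)
  moreover have "ereal r < 1" using assms by simp
  ultimately show ?thesis by (rule less_le_trans[rotated])
qed

lemma cls_inj_on:
  assumes "C \<subseteq> topspace X" "d - c < 1" shows "inj_on cls (C \<times> {c<..<d})"
proof (rule inj_onI)
  fix p q assume p: "p \<in> C \<times> {c<..<d}" and q: "q \<in> C \<times> {c<..<d}" and eq: "cls p = cls q"
  obtain x s y t where pq: "p = (x, s)" "q = (y, t)" by force
  then obtain n where n: "y = it n x" "t = s - of_int n"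
    using eq cls_eq_iff[of x s y t] assms p by auto
  have "\<bar>real_of_int n\<bar> < 1" using p q pq n assms by auto
  then have "n = 0" by linarith
  then show "p = q" using pq n by simp
qed

lemma flow_map_in_T_carrier:
  assumes F: "F \<in> leaf_maps" shows "flow_map F \<in> T_carrier X \<phi>"
  unfolding T_carrier_def
proof (intro CollectI conjI ballI)
  show "flow_map F \<in> H0 X \<phi>" using F leaf_maps_leaf_homeo flow_map_in_H0 by blast
  fix y assume "y \<in> topspace Y"
  then obtain x t where x: "x \<in> topspace X" and y: "y = cls (x, t)" by (rule Y_cases)
  define f where "f = F x"
  have f: "f \<in> PLD" using leaf_mapsD(2)[OF F x] by (simp add: f_def)
  obtain U e where U: "openin X U" "x \<in> U" "0 < e" "\<And>x' s. x' \<in> U \<Longrightarrow> \<bar>s - t\<bar> < e \<Longrightarrow> F x' s = F x s"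
    using leaf_maps_locally_constant[OF F x] by blast
  obtain C where C: "openin X C" "closedin X C" "x \<in> C" "C \<subseteq> U" using clopen_neighbourhood[OF U(1,2)] .
  have CX: "C \<subseteq> topspace X" using C(1) openin_subset by blast
  obtain a b where ab: "t - e < a" "a < t" "t < b" "b < t + e" "b - a < 1" "f b - f a < 1"
    "dyadic_PL_homeo a b (f a) (f b) f"
    using PLD_local_chart[OF f U(3)] by blast
  have ff: "f a < f b" using f ab by simp
  have img: "f ` {a<..<b} = {f a<..<f b}"
  proof
    show "f ` {a<..<b} \<subseteq> {f a<..<f b}" using f by auto
    show "{f a<..<f b} \<subseteq> f ` {a<..<b}"
    proof
      fix s assume "s \<in> {f a<..<f b}"
      then have "finv f s \<in> {a<..<b}"
        using PLD_less_iff[OF f, of a "finv f s"] PLD_less_iff[OF f, of "finv f s" b] f by simp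
      moreover have "s = f (finv f s)" using f by simp
      ultimately show "s \<in> f ` {a<..<b}" by blast
    qed
  qed
  have act: "flow_map F (cls (x', s)) = cls (x', f s)" if "x' \<in> C" "s \<in> {a<..<b}" for x' s
  proof -
    have "F x' s = f s" unfolding f_def by (rule U(4)) (use that C ab in auto)
    moreover have "x' \<in> topspace X" using that CX by blast
    ultimately show ?thesis using flow_map_cls[OF leaf_mapsD(1)[OF F]] by simp
  qed
  have "is_chart X \<phi> C a b" "is_chart X \<phi> C (f a) (f b)"
    unfolding is_chart_def using C ab ff return_time_gt by auto
  moreover have "y \<in> cls ` (C \<times> {a<..<b})" using y C ab by auto
  moreover have "flow_map F ` cls ` (C \<times> {a<..<b}) = cls ` (C \<times> {f a<..<f b})"
  proof -
    have "flow_map F ` cls ` (C \<times> {a<..<b}) = (\<lambda>(x', s). cls (x', f s)) ` (C \<times> {a<..<b})"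
      unfolding image_image using act by (intro image_cong) auto
    also have "\<dots> = cls ` (C \<times> f ` {a<..<b})" by force
    finally show ?thesis by (simp add: img)
  qed
  moreover have "inv_into (C \<times> {f a<..<f b}) cls (flow_map F (cls (x', s))) = (x', f s)"
    if "x' \<in> C" "s \<in> {a<..<b}" for x' s
    unfolding act[OF that] using that img by (intro inv_into_f_f cls_inj_on CX ab) auto
  ultimately show "\<exists>C a b c d f. is_chart X \<phi> C a b \<and> y \<in> cls ` (C \<times> {a<..<b}) \<and>
      dyadic_PL_homeo a b c d f \<and> is_chart X \<phi> C c d \<and>
      flow_map F ` cls ` (C \<times> {a<..<b}) = cls ` (C \<times> {c<..<d}) \<and>
      (\<forall>x\<in>C. \<forall>t\<in>{a<..<b}. inv_into (C \<times> {c<..<d}) cls (flow_map F (cls (x, t))) = (x, f t))"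
    using ab(7) by blast
qed

lemma flow_map_mult:
  assumes "F \<in> leaf_maps" "G \<in> leaf_maps"
  shows "flow_map (\<lambda>x. F x \<circ> G x) = compose (topspace Y) (flow_map F) (flow_map G)"
proof
  fix y
  show "flow_map (\<lambda>x. F x \<circ> G x) y = compose (topspace Y) (flow_map F) (flow_map G) y"
  proof (cases "y \<in> topspace Y")
    case True
    then obtain x t where "x \<in> topspace X" "y = cls (x, t)" by (rule Y_cases)
    moreover have "equivariant F" "equivariant G" "equivariant (\<lambda>x. F x \<circ> G x)"
      using assms leaf_maps_comp leaf_mapsD(1) by blast+
    ultimately show ?thesis using True by (simp add: compose_def flow_map_cls)
  next
    case False
    then show ?thesis by (simp add: flow_map_def compose_def)
  qed
qed

lemma flow_map_hom: "flow_map \<in> hom leaf_group (T_group X \<phi>)"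
proof (rule homI)
  fix F assume "F \<in> carrier leaf_group"
  then show "flow_map F \<in> carrier (T_group X \<phi>)"
    using flow_map_in_T_carrier by (simp add: T_group_def)
next
  fix F G assume FG: "F \<in> carrier leaf_group" "G \<in> carrier leaf_group"
  then have "flow_map F \<in> T_carrier X \<phi>" "flow_map G \<in> T_carrier X \<phi>"
    using flow_map_in_T_carrier by auto
  then have "flow_map F \<in> Bij (topspace Y)" "flow_map G \<in> Bij (topspace Y)"
    by (auto simp: T_carrier_def H0_def homeo_group_def)
  then show "flow_map (F \<otimes>\<^bsub>leaf_group\<^esub> G) = flow_map F \<otimes>\<^bsub>T_group X \<phi>\<^esub> flow_map G"
    using FG flow_map_mult by (simp only: leaf_group_simps) (simp add: T_group_def homeo_group_def BijGroup_def)
qed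

text \<open>By freeness a point on the leaf of \<open>x\<close> has only one time coordinate
  relative to \<open>x\<close>, so \<open>g [x, t] = [x, F x t]\<close> defines \<open>F\<close>.
  The charts supply existence, dyadic germs and local constancy.\<close>

lemma T_carrier_flow_map:
  assumes free: "\<And>x n. x \<in> topspace X \<Longrightarrow> it n x = x \<Longrightarrow> n = 0"
    and g: "g \<in> T_carrier X \<phi>"
  obtains F where "F \<in> leaf_maps" "g = flow_map F"
proof -
  have gB: "g \<in> Bij (topspace Y)" using g by (simp add: T_carrier_def H0_def homeo_group_def)
  have g_inj: "inj_on g (topspace Y)" and g_surj: "g ` topspace Y = topspace Y"
    using gB by (auto simp: Bij_def bij_betw_def)
  have uniq: "s = s'" if "x \<in> topspace X" "cls (x, s) = cls (x, s')" for x s s'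
  proof -
    have "\<exists>n. x = it n x \<and> s' = s - of_int n" using that cls_eq_iff by blast
    then obtain n where "it n x = x" "s' = s - of_int n" by metis
    then show ?thesis using free[OF that(1)] by force
  qed
  \<comment> \<open>The chart may contain the class of \<open>(x, t)\<close> only through another
    representative \<open>(it n x, t - n)\<close>.\<close>
  have chart: "\<exists>C a b f n. openin X C \<and> it n x \<in> C \<and> a < t - of_int n \<and> t - of_int n < b \<and>
      (\<forall>s. a < s \<and> s < b \<longrightarrow> dyadic_germ f s) \<and>
      (\<forall>x'\<in>C. \<forall>s. a < s \<and> s < b \<longrightarrow> g (cls (x', s)) = cls (x', f s))" if x: "x \<in> topspace X" for x t
  proof -
    have y: "cls (x, t) \<in> topspace Y" using x by simp
    have "\<exists>C a b c d f. is_chart X \<phi> C a b \<and> cls (x, t) \<in> domain_of X \<phi> C a b \<and>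
      dyadic_PL_homeo a b c d f \<and> is_chart X \<phi> C c d \<and>
      g ` domain_of X \<phi> C a b = domain_of X \<phi> C c d \<and>
      (\<forall>x\<in>C. \<forall>t\<in>{a<..<b}. inv_into (C \<times> {c<..<d}) cls (g (cls (x, t))) = (x, f t))"
      using g y unfolding T_carrier_def mem_Collect_eq by (elim conjE) (drule (1) bspec)
    then obtain C a b c d f where C: "is_chart X \<phi> C a b" "cls (x, t) \<in> domain_of X \<phi> C a b"
      "dyadic_PL_homeo a b c d f" "g ` domain_of X \<phi> C a b = domain_of X \<phi> C c d"
      "\<forall>x\<in>C. \<forall>t\<in>{a<..<b}. inv_into (C \<times> {c<..<d}) cls (g (cls (x, t))) = (x, f t)"
      by (elim exE conjE)
    obtain x' t' where x': "x' \<in> C" "t' \<in> {a<..<b}" "cls (x, t) = cls (x', t')" using C(2) by auto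
    then obtain n where n: "x' = it n x" "t' = t - of_int n" using cls_eq_iff[OF x] by blast
    have "g (cls (x', s)) = cls (x', f s)" if "x' \<in> C" "a < s" "s < b" for x' s
    proof -
      have "g (cls (x', s)) \<in> cls ` (C \<times> {c<..<d})" using C(4) that by (auto simp flip: C(4))
      then have "cls (inv_into (C \<times> {c<..<d}) cls (g (cls (x', s)))) = g (cls (x', s))"
        by (rule f_inv_into_f)
      then show ?thesis using C(5) that by simp
    qed
    moreover have "openin X C" using C(1) by (simp add: is_chart_def)
    ultimately show ?thesis
      using x' n dyadic_PL_homeo_germ[OF C(3)] by (intro exI[of _ C] exI[of _ a] exI[of _ b] exI[of _ f] exI[of _ n]) auto
  qed
  have ex: "\<exists>s. g (cls (x, t)) = cls (x, s)" if x: "x \<in> topspace X" for x t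
  proof -
    obtain C a b f n where C: "it n x \<in> C" "a < t - of_int n" "t - of_int n < b"
      "\<forall>x'\<in>C. \<forall>s. a < s \<and> s < b \<longrightarrow> g (cls (x', s)) = cls (x', f s)"
      using chart[OF x, of t] by blast
    then have "g (cls (it n x, t - of_int n)) = cls (it n x, f (t - of_int n))" by blast
    then have "g (cls (x, t)) = cls (it n x, (f (t - of_int n) + of_int n) - of_int n)"
      by (simp add: cls_shift[OF x])
    then show ?thesis unfolding cls_shift[OF x] by blast
  qed
  define F where "F x = (if x \<in> topspace X then \<lambda>t. THE s. g (cls (x, t)) = cls (x, s) else id)" for x
  have F_eq: "F x t = s" if "x \<in> topspace X" "g (cls (x, t)) = cls (x, s)" for x t s
    unfolding F_def using that uniq by auto
  have F: "g (cls (x, t)) = cls (x, F x t)" if x: "x \<in> topspace X" for x t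
    using ex[OF x, of t] F_eq[OF x] by metis
  have eq: "equivariant F"
    unfolding equivariant_def
  proof (intro ballI allI)
    fix x n t assume x: "x \<in> topspace X"
    have "g (cls (it n x, t - of_int n)) = g (cls (x, t))" by (simp add: cls_shift[OF x])
    also have "\<dots> = cls (it n x, F x t - of_int n)" using F[OF x] by (simp add: cls_shift[OF x])
    finally show "F (it n x) (t - of_int n) = F x t - of_int n" using F_eq x by simp
  qed
  have local: "\<exists>U e h. openin X U \<and> x \<in> U \<and> 0 < e \<and> dyadic_germ h t \<and>
      (\<forall>x'\<in>U. \<forall>s. \<bar>s - t\<bar> < e \<longrightarrow> F x' s = h s)" if x: "x \<in> topspace X" for x t
  proof -
    obtain C a b f n where C: "openin X C" "it n x \<in> C" "a < t - of_int n" "t - of_int n < b"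
      "\<forall>s. a < s \<and> s < b \<longrightarrow> dyadic_germ f s"
      "\<forall>x'\<in>C. \<forall>s. a < s \<and> s < b \<longrightarrow> g (cls (x', s)) = cls (x', f s)"
      using chart[OF x, of t] by blast
    let ?U = "{x' \<in> topspace X. it n x' \<in> C}"
    define e where "e = min (t - of_int n - a) (b - (t - of_int n))"
    have "F x' s = f (s - of_int n) + of_int n" if x': "x' \<in> ?U" and s: "\<bar>s - t\<bar> < e" for x' s
    proof -
      have "a < s - of_int n" "s - of_int n < b" using s by (auto simp: e_def abs_if split: if_splits)
      then have "F (it n x') (s - of_int n) = f (s - of_int n)" using C(6) x' by (intro F_eq) auto
      then show ?thesis using equivariant_shift[OF eq, of x' s n] x' by simp
    qed
    moreover have "openin X ?U" by (rule openin_it_preimage[OF C(1)])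
    moreover have "dyadic_germ (\<lambda>s. f (s - of_int n) + of_int n) t"
      using C by (intro dyadic_germ_shift) auto
    moreover have "0 < e" using C by (simp add: e_def)
    ultimately show ?thesis using x C(2)
      by (intro exI[of _ ?U] exI[of _ e] exI[of _ "\<lambda>s. f (s - of_int n) + of_int n"]) auto
  qed
  have "F x \<in> PLD" if x: "x \<in> topspace X" for x
  proof (rule PLD_I)
    show "dyadic_germ (F x) t" for t
    proof -
      obtain U e h where *: "x \<in> U" "0 < e" "dyadic_germ h t" "\<forall>x'\<in>U. \<forall>s. \<bar>s - t\<bar> < e \<longrightarrow> F x' s = h s"
        using local[OF x, of t] by blast
      show ?thesis by (rule dyadic_germ_cong[OF *(3,2)]) (use *(1,4) in blast)
    qed
    have "\<exists>t. s = F x t" for s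
    proof -
      have "cls (x, s) \<in> g ` topspace Y" using g_surj x by simp
      then obtain y where y: "y \<in> topspace Y" "g y = cls (x, s)" by auto
      obtain x' t' where x': "x' \<in> topspace X" "y = cls (x', t')" using y(1) by (rule Y_cases)
      then have "cls (x, s) = cls (x', F x' t')" using y F by simp
      then obtain n where n: "x' = it n x" "F x' t' = s - of_int n" using cls_eq_iff[OF x] by blast
      have "F x (t' + of_int n) = F x' t' + of_int n"
        using equivariant_shift[OF eq x, of "t' + of_int n" n] n by simp
      then show ?thesis using n by (intro exI[of _ "t' + of_int n"]) simp
    qed
    then show "surj (F x)" by (auto simp: surj_def)
  qed
  moreover have "\<exists>U e. openin X U \<and> x \<in> U \<and> 0 < e \<and> (\<forall>x'\<in>U. \<forall>s. \<bar>s - t\<bar> < e \<longrightarrow> F x' s = F x s)"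
    if x: "x \<in> topspace X" for x t
  proof -
    obtain U e h where U: "openin X U" "x \<in> U" "0 < e" "\<forall>x'\<in>U. \<forall>s. \<bar>s - t\<bar> < e \<longrightarrow> F x' s = h s"
      using local[OF x, of t] by blast
    then have "F x' s = F x s" if "x' \<in> U" "\<bar>s - t\<bar> < e" for x' s using that by metis
    then show ?thesis using U(1-3) by blast
  qed
  moreover have "F x = id" if "x \<notin> topspace X" for x using that by (simp add: F_def)
  ultimately have "F \<in> leaf_maps" unfolding leaf_maps_def using eq by blast
  moreover have "g = flow_map F"
  proof
    fix y
    show "g y = flow_map F y"
    proof (cases "y \<in> topspace Y")
      case True
      then obtain x t where "x \<in> topspace X" "y = cls (x, t)" by (rule Y_cases)
      then show ?thesis using F flow_map_cls[OF eq] by simp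
    next
      case False
      then show ?thesis using gB by (auto simp: flow_map_def Bij_def extensional_def)
    qed
  qed
  ultimately show ?thesis using that by blast
qed

end

section \<open>Towers over clopen sets of a minimal system\<close>

locale minimal_stone_dynamics = stone_dynamics +
  assumes X_infinite: "infinite (topspace X)" and minimal: "minimal_system X \<phi>"
begin

lemma closedin_finite: "finite S \<Longrightarrow> S \<subseteq> topspace X \<Longrightarrow> closedin X S"
  using X_Hausdorff by (simp add: closedin_Hausdorff_finite)

text \<open>A periodic orbit is finite, hence closed, and by density it would be all of the infinite
  space.\<close>

lemma it_free:
  assumes x: "x \<in> topspace X" and n: "it n x = x" shows "n = 0"
proof (rule ccontr)
  assume "n \<noteq> 0"
  define m where "m = \<bar>n\<bar>"
  have m: "0 < m" using \<open>n \<noteq> 0\<close> by (simp add: m_def)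
  have im: "it m x = x" using n it_cancel(1)[OF x, of n] by (auto simp: m_def abs_if)
  have mult: "it (int k * m) x = x" for k
  proof (induction k)
    case (Suc k)
    have "int (Suc k) * m = m + int k * m" by (simp add: algebra_simps)
    then show ?case using Suc im it_add[OF x, of m "int k * m"] by simp
  qed simp
  have "it (j * m) x = x" for j
  proof (cases "0 \<le> j")
    case True
    then show ?thesis using mult[of "nat j"] by simp
  next
    case False
    then have "it (- (j * m)) x = x" using mult[of "nat (- j)"] by simp
    then show ?thesis using it_cancel(2)[OF x, of "j * m"] by simp
  qed
  then have "it k x = it (k mod m) x" for k
    using it_add[OF x, of "k mod m" "k div m * m"] by (metis mod_div_mult_eq)
  then have "range (\<lambda>k. it k x) \<subseteq> (\<lambda>k. it k x) ` {0..<m}" using m by force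
  then have fin: "finite (range (\<lambda>k. it k x))" using finite_subset by blast
  have "range (\<lambda>k. it k x) \<subseteq> topspace X" using x by auto
  then have "topspace X = range (\<lambda>k. it k x)"
    using minimal x closure_of_closedin[OF closedin_finite[OF fin]] unfolding minimal_system_def by metis
  then show False using fin X_infinite by simp
qed

lemma finite_open_neighbourhood:
  assumes "finite A" "x \<in> topspace X"
    and "\<And>a. a \<in> A \<Longrightarrow> \<exists>U. openin X U \<and> x \<in> U \<and> (\<forall>x'\<in>U. Q a x')"
  shows "\<exists>U. openin X U \<and> x \<in> U \<and> (\<forall>a\<in>A. \<forall>x'\<in>U. Q a x')"
  using assms(1,3)
proof (induction A)
  case empty
  then show ?case using assms(2) by blast
next
  case (insert a A)
  obtain U where U: "openin X U" "x \<in> U" "\<forall>a\<in>A. \<forall>x'\<in>U. Q a x'" using insert by blast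
  obtain V where V: "openin X V" "x \<in> V" "\<forall>x'\<in>V. Q a x'" using insert.prems[of a] by blast
  have "openin X (U \<inter> V)" "x \<in> U \<inter> V" "\<forall>b\<in>insert a A. \<forall>x'\<in>U \<inter> V. Q b x'"
    using U V by (auto intro: openin_Int)
  then show ?case by blast
qed

lemma it_visits_open:
  assumes C: "openin X C" "C \<noteq> {}" and x: "x \<in> topspace X" shows "\<exists>n. it n x \<in> C"
proof -
  obtain c where "c \<in> C" using C by blast
  moreover have "c \<in> X closure_of (range (\<lambda>n. it n x))"
    using minimal x C openin_subset \<open>c \<in> C\<close> unfolding minimal_system_def by blast
  ultimately show ?thesis using C(1) by (auto simp: in_closure_of)
qed

text \<open>By minimality the preimages of \<open>C\<close> under all iterates cover the space, and
  by compactness finitely many of them do.\<close>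

lemma bounded_return:
  assumes C: "openin X C" "C \<noteq> {}"
  obtains R :: nat where "\<And>x. x \<in> topspace X \<Longrightarrow> \<exists>n. 1 \<le> n \<and> n \<le> R \<and> it (int n) x \<in> C"
proof -
  define V where "V n = {x \<in> topspace X. it n x \<in> C}" for n
  have "\<forall>U\<in>range V. openin X U" unfolding V_def using openin_it_preimage[OF C(1)] by blast
  moreover have "\<Union>(range V) = topspace X" unfolding V_def using it_visits_open[OF C] by blast
  ultimately obtain \<F> where F: "finite \<F>" "\<F> \<subseteq> range V" "\<Union>\<F> = topspace X"
    using X_compact unfolding compact_space by meson
  obtain A where A: "finite A" "\<F> = V ` A" using F(1,2) by (metis finite_subset_image)
  define B where "B = Max (insert 0 (abs ` A))"
  have B: "\<bar>n\<bar> \<le> B" if "n \<in> A" for n unfolding B_def using A that by (intro Max_ge) auto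
  have B0: "0 \<le> B" unfolding B_def using A by (intro Max_ge) auto
  have "\<exists>n. 1 \<le> n \<and> n \<le> nat (2 * B + 1) \<and> it (int n) x \<in> C" if x: "x \<in> topspace X" for x
  proof -
    \<comment> \<open>Starting \<open>B + 1\<close> steps later makes every visit time
      \<open>n + (B + 1)\<close> positive and at most \<open>2 * B + 1\<close>.\<close>
    have "it (B + 1) x \<in> \<Union>\<F>" using F(3) x by simp
    then obtain n where n: "n \<in> A" "it n (it (B + 1) x) \<in> C" unfolding A V_def by auto
    then have "it (n + (B + 1)) x \<in> C" using it_add[OF x] by simp
    moreover have "1 \<le> n + (B + 1)" "n + (B + 1) \<le> 2 * B + 1" using B[OF n(1)] by auto
    ultimately show ?thesis by (intro exI[of _ "nat (n + (B + 1))"]) auto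
  qed
  then show ?thesis using that by blast
qed

section \<open>Return times, gaps and towers\<close>

definition ret :: "'a set \<Rightarrow> 'a \<Rightarrow> nat" where
  "ret C x = (LEAST n. 1 \<le> n \<and> it (int n) x \<in> C)"

definition clopen_base :: "'a set \<Rightarrow> bool" where
  "clopen_base C \<longleftrightarrow> openin X C \<and> closedin X C \<and> C \<noteq> {}"

lemma clopen_baseD:
  assumes "clopen_base C" shows "openin X C" "closedin X C" "C \<noteq> {}" "x \<in> C \<Longrightarrow> x \<in> topspace X"
  using assms openin_subset by (auto simp: clopen_base_def)

lemma ret:
  assumes C: "clopen_base C" and x: "x \<in> topspace X"
  shows "1 \<le> ret C x" "it (int (ret C x)) x \<in> C"
proof -
  obtain n where "1 \<le> n \<and> it (int n) x \<in> C"
    using bounded_return[OF clopen_baseD(1,3)[OF C]] x by metis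
  then have "1 \<le> ret C x \<and> it (int (ret C x)) x \<in> C" unfolding ret_def by (rule LeastI)
  then show "1 \<le> ret C x" "it (int (ret C x)) x \<in> C" by auto
qed

lemma ret_le: "1 \<le> n \<Longrightarrow> it (int n) x \<in> C \<Longrightarrow> ret C x \<le> n"
  unfolding ret_def by (rule Least_le) auto

lemma ret_bounded:
  assumes C: "clopen_base C"
  obtains R where "\<And>x. x \<in> topspace X \<Longrightarrow> ret C x \<le> R"
proof -
  obtain R where R: "\<And>x. x \<in> topspace X \<Longrightarrow> \<exists>n. 1 \<le> n \<and> n \<le> R \<and> it (int n) x \<in> C"
    using bounded_return[OF clopen_baseD(1,3)[OF C]] by blast
  have "ret C x \<le> R" if "x \<in> topspace X" for x
    using R[OF that] ret_le order_trans by blast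
  then show ?thesis using that by blast
qed

lemma visit_locally_constant:
  assumes C: "clopen_base C" and x: "x \<in> topspace X"
  shows "\<exists>U. openin X U \<and> x \<in> U \<and> (\<forall>x'\<in>U. it n x' \<in> C \<longleftrightarrow> it n x \<in> C)"
proof (cases "it n x \<in> C")
  case True
  then show ?thesis
    using openin_it_preimage[OF clopen_baseD(1)[OF C], of n] x
    by (intro exI[of _ "{x \<in> topspace X. it n x \<in> C}"]) auto
next
  case False
  have "openin X (topspace X - C)" using clopen_baseD(2)[OF C] by blast
  from openin_it_preimage[OF this, of n] show ?thesis
    using False x by (intro exI[of _ "{x' \<in> topspace X. it n x' \<in> topspace X - C}"]) auto
qed

lemma ret_locally_constant:
  assumes C: "clopen_base C" and x: "x \<in> topspace X"
  shows "\<exists>U. openin X U \<and> x \<in> U \<and> (\<forall>x'\<in>U. ret C x' = ret C x)"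
proof -
  have "\<exists>U. openin X U \<and> x \<in> U \<and> (\<forall>n\<in>{0..ret C x}. \<forall>x'\<in>U. it (int n) x' \<in> C \<longleftrightarrow> it (int n) x \<in> C)"
    using visit_locally_constant[OF C x] by (intro finite_open_neighbourhood[OF _ x]) auto
  then obtain U where U: "openin X U" "x \<in> U"
    "\<forall>n\<in>{0..ret C x}. \<forall>x'\<in>U. it (int n) x' \<in> C \<longleftrightarrow> it (int n) x \<in> C" by blast
  have "ret C x' = ret C x" if x': "x' \<in> U" for x'
  proof -
    have xt: "x' \<in> topspace X" using x' U(1) openin_subset by blast
    have U': "it (int n) x' \<in> C \<longleftrightarrow> it (int n) x \<in> C" if "n \<le> ret C x" for n
      using bspec[OF bspec[OF U(3), of n] x'] that by simp
    have le: "ret C x' \<le> ret C x" using ret[OF C x] U'[of "ret C x"] by (intro ret_le) auto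
    have "it (int (ret C x')) x \<in> C" using U'[OF le] ret(2)[OF C xt] by simp
    then have "ret C x \<le> ret C x'" using ret(1)[OF C xt] by (intro ret_le)
    then show ?thesis using le by simp
  qed
  then show ?thesis using U by blast
qed

text \<open>The leaf of \<open>x\<close> meets the transversal \<open>C\<close> at the integer times
  \<open>n\<close> with \<open>it n x\<close> in \<open>C\<close>; \<open>t\<close> lies strictly
  between the visit at time \<open>n\<close> and the next one.\<close>

definition gap :: "'a set \<Rightarrow> 'a \<Rightarrow> real \<Rightarrow> int \<Rightarrow> bool" where
  "gap C x t n \<longleftrightarrow> it n x \<in> C \<and> of_int n < t \<and> t < of_int n + real (ret C (it n x))"

lemma gap_shift:
  assumes "x \<in> topspace X" shows "gap C (it k x) (t - of_int k) n \<longleftrightarrow> gap C x t (n + k)"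
  unfolding gap_def using it_add[OF assms, of n k] by auto

lemma next_visit:
  assumes x: "x \<in> topspace X" and "it n x \<in> C" "it m x \<in> C" "n < m"
  shows "n + int (ret C (it n x)) \<le> m"
proof -
  have "it (int (nat (m - n))) (it n x) = it m x" using it_add[OF x, of "m - n" n] assms by simp
  then have "ret C (it n x) \<le> nat (m - n)" using assms by (intro ret_le) auto
  then show ?thesis using assms by linarith
qed

lemma gap_unique:
  assumes x: "x \<in> topspace X" and n: "gap C x t n" and m: "gap C x t m"
  shows "n = m"
proof -
  have False if "gap C x t n" "gap C x t m" "n < m" for n m
  proof -
    have "n + int (ret C (it n x)) \<le> m" using that by (intro next_visit[OF x]) (auto simp: gap_def)
    then have "of_int n + real (ret C (it n x)) \<le> real_of_int m" by linarith
    then show False using that by (auto simp: gap_def)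
  qed
  then show ?thesis using n m by (metis linorder_neqE_linordered_idom)
qed

lemma gap_cover:
  assumes C: "clopen_base C" and x: "x \<in> topspace X"
  obtains n where "it n x \<in> C" "t = of_int n \<or> gap C x t n"
proof -
  obtain R where R: "\<And>x. x \<in> topspace X \<Longrightarrow> \<exists>n. 1 \<le> n \<and> n \<le> R \<and> it (int n) x \<in> C"
    using bounded_return[OF clopen_baseD(1,3)[OF C]] by blast
  \<comment> \<open>The last visit not after \<open>t\<close> opens the gap; the bound
    \<open>R\<close> makes sure that there is one in this finite range.\<close>
  define A where "A = {n. \<lfloor>t\<rfloor> - int R \<le> n \<and> n \<le> \<lfloor>t\<rfloor> \<and> it n x \<in> C}"
  have "A \<subseteq> {\<lfloor>t\<rfloor> - int R..\<lfloor>t\<rfloor>}" unfolding A_def by auto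
  then have fin: "finite A" using finite_subset by blast
  obtain k where k: "1 \<le> k" "k \<le> R" "it (int k) (it (\<lfloor>t\<rfloor> - int R) x) \<in> C"
    using R[of "it (\<lfloor>t\<rfloor> - int R) x"] x by auto
  then have "int k + (\<lfloor>t\<rfloor> - int R) \<in> A" unfolding A_def using it_add[OF x, of "int k"] by auto
  then have "A \<noteq> {}" by blast
  define n where "n = Max A"
  have n: "n \<in> A" unfolding n_def using fin \<open>A \<noteq> {}\<close> by (rule Max_in)
  let ?m = "n + int (ret C (it n x))"
  have "it ?m x \<in> C" using ret(2)[OF C, of "it n x"] it_add[OF x, of "int (ret C (it n x))" n] x by (simp add: add.commute)
  moreover have "n < ?m" using ret(1)[OF C, of "it n x"] x by simp
  moreover have "?m \<notin> A" using Max_ge[OF fin, of ?m] \<open>n < ?m\<close> by (auto simp flip: n_def)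
  ultimately have "\<lfloor>t\<rfloor> < ?m" using n unfolding A_def by auto
  then have "t < of_int n + real (ret C (it n x))" by linarith
  moreover have "of_int n \<le> t" "it n x \<in> C" using n unfolding A_def by (auto simp: le_floor_iff)
  ultimately show ?thesis using that[of n] unfolding gap_def by (cases "t = of_int n") auto
qed

text \<open>Cutting the suspension along \<open>C\<close> leaves one open segment of length
  \<open>ret C x\<close> over each \<open>x\<close> in \<open>C\<close>. The map acts by
  \<open>f x\<close> on that segment and fixes the cut.\<close>

definition tower :: "'a set \<Rightarrow> ('a \<Rightarrow> real \<Rightarrow> real) \<Rightarrow> 'a \<Rightarrow> real \<Rightarrow> real" where
  "tower C f x t = (if x \<in> topspace X \<and> (\<exists>n. gap C x t n)
     then (let n = (THE n. gap C x t n) in f (it n x) (t - of_int n) + of_int n) else t)"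

lemma tower_gap:
  assumes "x \<in> topspace X" "gap C x t n" shows "tower C f x t = f (it n x) (t - of_int n) + of_int n"
proof -
  have "(THE n. gap C x t n) = n" using assms gap_unique by blast
  then show ?thesis using assms unfolding tower_def by auto
qed

lemma tower_no_gap: "(\<And>n. \<not> gap C x t n) \<Longrightarrow> tower C f x t = t"
  unfolding tower_def by auto

lemma tower_outside: "x \<notin> topspace X \<Longrightarrow> tower C f x t = t"
  unfolding tower_def by auto

definition tower_data :: "'a set \<Rightarrow> ('a \<Rightarrow> real \<Rightarrow> real) \<Rightarrow> bool" where
  "tower_data C f \<longleftrightarrow> (\<forall>x\<in>C. f x \<in> PLD_within 0 (real (ret C x)) \<and>
     (\<exists>U. openin X U \<and> x \<in> U \<and> (\<forall>x'\<in>U \<inter> C. f x' = f x)))"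

lemma tower_dataD:
  assumes "tower_data C f" "x \<in> C"
  shows "f x \<in> PLD_within 0 (real (ret C x))" "f x \<in> PLD"
    "\<exists>U. openin X U \<and> x \<in> U \<and> (\<forall>x'\<in>U \<inter> C. f x' = f x)"
  using assms PLD_withinD unfolding tower_data_def by blast+

lemma PLD_within_fix:
  assumes "f \<in> PLD_within u v" shows "t \<le> u \<Longrightarrow> f t = t" "v \<le> t \<Longrightarrow> f t = t"
proof -
  obtain a b where "u < a" "b < v" "supp_in f a b" using assms unfolding PLD_within_def by blast
  then show "t \<le> u \<Longrightarrow> f t = t" "v \<le> t \<Longrightarrow> f t = t" unfolding supp_in_def by force+
qed

lemma PLD_within_inside:
  assumes f: "f \<in> PLD_within u v" and "u < t" "t < v" shows "u < f t" "f t < v"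
proof -
  have "f u = u" "f v = v" using PLD_within_fix[OF f] by auto
  moreover have "f u < f t" "f t < f v" using assms PLD_withinD[OF f] by auto
  ultimately show "u < f t" "f t < v" by auto
qed

text \<open>\<open>g\<close> maps each segment to itself, so the outer map finds the point in the
  same gap.\<close>

lemma tower_comp:
  assumes g: "tower_data C g"
  shows "tower C (\<lambda>x. f x \<circ> g x) = (\<lambda>x. tower C f x \<circ> tower C g x)"
proof (intro ext)
  fix x t
  show "tower C (\<lambda>x. f x \<circ> g x) x t = (tower C f x \<circ> tower C g x) t"
  proof (cases "x \<in> topspace X \<and> (\<exists>n. gap C x t n)")
    case True
    then obtain n where x: "x \<in> topspace X" and n: "gap C x t n" by blast
    let ?s = "g (it n x) (t - of_int n)"
    have "0 < ?s" "?s < real (ret C (it n x))"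
      using PLD_within_inside[OF tower_dataD(1)[OF g]] n by (auto simp: gap_def)
    then have "gap C x (?s + of_int n) n" using n unfolding gap_def by auto
    then have "tower C f x (?s + of_int n) = f (it n x) ?s + of_int n" using tower_gap[OF x] by simp
    then show ?thesis using tower_gap[OF x n] by simp
  next
    case False
    then have "tower C h x t = t" for h unfolding tower_def by auto
    then show ?thesis by simp
  qed
qed

lemma tower_id: "tower C (\<lambda>x. id) = (\<lambda>x. id)"
proof (intro ext)
  fix x t
  show "tower C (\<lambda>x. id) x t = id t"
    by (cases "x \<in> topspace X \<and> (\<exists>n. gap C x t n)") (auto simp: tower_gap, auto simp: tower_def)
qed

lemma tower_data_comp:
  assumes f: "tower_data C f" and g: "tower_data C g" shows "tower_data C (\<lambda>x. f x \<circ> g x)"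
  unfolding tower_data_def
proof
  fix x assume x: "x \<in> C"
  obtain U where U: "openin X U" "x \<in> U" "\<forall>x'\<in>U \<inter> C. f x' = f x" using tower_dataD(3)[OF f x] by blast
  obtain V where V: "openin X V" "x \<in> V" "\<forall>x'\<in>V \<inter> C. g x' = g x" using tower_dataD(3)[OF g x] by blast
  have "f x' \<circ> g x' = f x \<circ> g x" if "x' \<in> U \<inter> V \<inter> C" for x'
  proof -
    have "f x' = f x" "g x' = g x" using U(3) V(3) that by blast+
    then show ?thesis by metis
  qed
  moreover have "openin X (U \<inter> V)" "x \<in> U \<inter> V" using U V by auto
  moreover have "f x \<circ> g x \<in> PLD_within 0 (real (ret C x))"
    using tower_dataD(1) f g x by (intro PLD_within_comp)
  ultimately show "f x \<circ> g x \<in> PLD_within 0 (real (ret C x)) \<and>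
     (\<exists>U. openin X U \<and> x \<in> U \<and> (\<forall>x'\<in>U \<inter> C. f x' \<circ> g x' = f x \<circ> g x))"
    by blast
qed

lemma tower_data_finv:
  assumes f: "tower_data C f" shows "tower_data C (\<lambda>x. finv (f x))"
  unfolding tower_data_def
proof
  fix x assume x: "x \<in> C"
  obtain U where U: "openin X U" "x \<in> U" "\<forall>x'\<in>U \<inter> C. f x' = f x" using tower_dataD(3)[OF f x] by blast
  have "finv (f x') = finv (f x)" if "x' \<in> U \<inter> C" for x' using U(3) that by metis
  then show "finv (f x) \<in> PLD_within 0 (real (ret C x)) \<and>
     (\<exists>U. openin X U \<and> x \<in> U \<and> (\<forall>x'\<in>U \<inter> C. finv (f x') = finv (f x)))"
    using U(1,2) PLD_within_finv[OF tower_dataD(1)[OF f x]] by blast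
qed

lemma tower_cong:
  assumes "\<And>x. x \<in> C \<Longrightarrow> f x = g x" shows "tower C f = tower C g"
proof (intro ext)
  fix x t
  show "tower C f x t = tower C g x t"
  proof (cases "x \<in> topspace X \<and> (\<exists>n. gap C x t n)")
    case True
    then obtain n where x: "x \<in> topspace X" and n: "gap C x t n" by blast
    have "f (it n x) = g (it n x)" using n by (intro assms) (simp add: gap_def)
    then show ?thesis using tower_gap[OF x n] by simp
  next
    case False
    then show ?thesis unfolding tower_def by auto
  qed
qed

lemma tower_finv_cancel:
  assumes f: "tower_data C f"
  shows "tower C (\<lambda>x. finv (f x)) x (tower C f x t) = t" "tower C f x (tower C (\<lambda>x. finv (f x)) x t) = t"
proof -
  have "tower C (\<lambda>x. finv (f x) \<circ> f x) = tower C (\<lambda>x. id)" "tower C (\<lambda>x. f x \<circ> finv (f x)) = tower C (\<lambda>x. id)"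
    using tower_dataD(2)[OF f] by (intro tower_cong; fastforce)+
  then show "tower C (\<lambda>x. finv (f x)) x (tower C f x t) = t" "tower C f x (tower C (\<lambda>x. finv (f x)) x t) = t"
    using tower_comp[OF f, of "\<lambda>x. finv (f x)"] tower_comp[OF tower_data_finv[OF f], of f]
    unfolding tower_id by (simp_all add: fun_eq_iff)
qed

lemma tower_equivariant: "equivariant (tower C f)"
  unfolding equivariant_def
proof (intro ballI allI)
  fix x k t assume x: "x \<in> topspace X"
  show "tower C f (it k x) (t - of_int k) = tower C f x t - of_int k"
  proof (cases "\<exists>n. gap C x t n")
    case True
    then obtain n where n: "gap C x t n" by blast
    then have "gap C (it k x) (t - of_int k) (n - k)" using gap_shift[OF x] by simp
    then have "tower C f (it k x) (t - of_int k) = f (it (n - k) (it k x)) (t - of_int k - of_int (n - k)) + of_int (n - k)"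
      using x by (intro tower_gap) auto
    then show ?thesis using tower_gap[OF x n] it_add[OF x, of "n - k" k] by simp
  next
    case False
    then have "\<not> gap C (it k x) (t - of_int k) n" for n using gap_shift[OF x] by blast
    then show ?thesis using False by (simp add: tower_no_gap)
  qed
qed

text \<open>Return times are bounded, so finitely many visits decide the values near
  \<open>t\<close>, and the data of each are locally constant in \<open>x\<close>.\<close>

lemma tower_locally_constant:
  assumes C: "clopen_base C" and f: "tower_data C f" and x: "x \<in> topspace X"
  shows "\<exists>U e. openin X U \<and> x \<in> U \<and> 0 < e \<and> (\<forall>x'\<in>U. \<forall>s. \<bar>s - t\<bar> < e \<longrightarrow> tower C f x' s = tower C f x s)"
proof -
  obtain R where R: "\<And>x. x \<in> topspace X \<Longrightarrow> ret C x \<le> R" using ret_bounded[OF C] by blast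
  \<comment> \<open>If \<open>\<bar>s - t\<bar> < 1\<close> and \<open>s\<close> lies in gap
    \<open>n\<close>, then \<open>t - 1 - R < n < t + 1\<close>.\<close>
  define A where "A = {\<lfloor>t\<rfloor> - int R - 2..\<lfloor>t\<rfloor> + 2}"
  let ?Q = "\<lambda>n x'. (it n x' \<in> C \<longleftrightarrow> it n x \<in> C) \<and>
    (it n x \<in> C \<longrightarrow> f (it n x') = f (it n x) \<and> ret C (it n x') = ret C (it n x))"
  have "\<exists>U. openin X U \<and> x \<in> U \<and> (\<forall>n\<in>A. \<forall>x'\<in>U. ?Q n x')"
  proof (rule finite_open_neighbourhood[OF _ x])
    show "finite A" by (simp add: A_def)
    fix n
    obtain U1 where U1: "openin X U1" "x \<in> U1" "\<forall>x'\<in>U1. it n x' \<in> C \<longleftrightarrow> it n x \<in> C"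
      using visit_locally_constant[OF C x] by blast
    obtain U2 where U2: "openin X U2" "it n x \<in> U2" "\<forall>y\<in>U2. ret C y = ret C (it n x)"
      using ret_locally_constant[OF C it_in[OF x]] by blast
    show "\<exists>U. openin X U \<and> x \<in> U \<and> (\<forall>x'\<in>U. ?Q n x')"
    proof (cases "it n x \<in> C")
      case True
      obtain U3 where U3: "openin X U3" "it n x \<in> U3" "\<forall>y\<in>U3 \<inter> C. f y = f (it n x)"
        using tower_dataD(3)[OF f True] by blast
      let ?U = "U1 \<inter> {x' \<in> topspace X. it n x' \<in> U2} \<inter> {x' \<in> topspace X. it n x' \<in> U3}"
      have "openin X ?U" using U1 U2 U3 openin_it_preimage by (intro openin_Int) auto
      moreover have "x \<in> ?U" using x U1 U2 U3 by auto
      moreover have "?Q n x'" if "x' \<in> ?U" for x'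
      proof -
        have "it n x' \<in> C" using U1(3) that True by blast
        then have "f (it n x') = f (it n x)" "ret C (it n x') = ret C (it n x)" using U2(3) U3(3) that by blast+
        then show ?thesis using \<open>it n x' \<in> C\<close> True by blast
      qed
      ultimately show ?thesis by blast
    qed (use U1 in blast)
  qed
  then obtain U where U: "openin X U" "x \<in> U" "\<And>n x'. n \<in> A \<Longrightarrow> x' \<in> U \<Longrightarrow> ?Q n x'" by blast
  have "tower C f x' s = tower C f x s" if x': "x' \<in> U" and s: "\<bar>s - t\<bar> < 1" for x' s
  proof -
    have xt: "x' \<in> topspace X" using x' U(1) openin_subset by blast
    have window: "n \<in> A" if "gap C z s n" "z \<in> topspace X" for n z
    proof -
      have "real (ret C (it n z)) \<le> real R" using R[of "it n z"] that by simp
      then have "of_int n < s" "s < of_int n + real R" using that by (auto simp: gap_def)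
      then show ?thesis using s unfolding A_def by (simp; linarith)
    qed
    have gap_iff: "gap C x' s n \<longleftrightarrow> gap C x s n" if "n \<in> A" for n
      using U(3)[OF that x'] unfolding gap_def by auto
    show ?thesis
    proof (cases "\<exists>n. gap C x s n")
      case True
      then obtain n where n: "gap C x s n" by blast
      then have nA: "n \<in> A" using window x by blast
      have "f (it n x') = f (it n x)" using U(3)[OF nA x'] n unfolding gap_def by blast
      then show ?thesis using tower_gap[OF x n] tower_gap[OF xt, of C s n f] gap_iff[OF nA] n by simp
    next
      case False
      then have "\<not> gap C x' s n" for n using window[OF _ xt] gap_iff by blast
      then show ?thesis using False by (simp add: tower_no_gap)
    qed
  qed
  then show ?thesis using U(1,2) zero_less_one by blast
qed

text \<open>A time in no gap is a visit of \<open>C\<close>, where two segments meet, and the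
  segment maps are the identity near both ends. Bounded return times leave finitely many gaps to
  consider.\<close>

lemma tower_id_near:
  assumes C: "clopen_base C" and f: "tower_data C f" and x: "x \<in> topspace X" and t: "\<And>n. \<not> gap C x t n"
  obtains e where "0 < e" "\<And>s. \<bar>s - t\<bar> < e \<Longrightarrow> tower C f x s = s"
proof -
  obtain R where R: "\<And>x. x \<in> topspace X \<Longrightarrow> ret C x \<le> R" using ret_bounded[OF C] by blast
  define A where "A = {\<lfloor>t\<rfloor> - int R - 2..\<lfloor>t\<rfloor> + 2}"
  have "\<forall>n\<in>A. eventually (\<lambda>s. gap C x s n \<longrightarrow> f (it n x) (s - of_int n) = s - of_int n) (nhds t)"
  proof
    fix n
    show "eventually (\<lambda>s. gap C x s n \<longrightarrow> f (it n x) (s - of_int n) = s - of_int n) (nhds t)"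
    proof (cases "it n x \<in> C")
      case True
      obtain a b where ab: "0 < a" "b < real (ret C (it n x))" "supp_in (f (it n x)) a b"
        using tower_dataD(1)[OF f True] unfolding PLD_within_def by blast
      let ?e = "min a (real (ret C (it n x)) - b)"
      have "t \<le> of_int n \<or> of_int n + real (ret C (it n x)) \<le> t" using t[of n] True unfolding gap_def by auto
      then have "f (it n x) (s - of_int n) = s - of_int n" if "dist s t < ?e" for s
        using that ab(3) unfolding supp_in_def dist_real_def by (auto simp: abs_less_iff)
      moreover have "0 < ?e" using ab by simp
      ultimately show ?thesis unfolding eventually_nhds_metric by blast
    qed (simp add: gap_def)
  qed
  then have "eventually (\<lambda>s. \<forall>n\<in>A. gap C x s n \<longrightarrow> f (it n x) (s - of_int n) = s - of_int n) (nhds t)"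
    by (intro eventually_ball_finite) (auto simp: A_def)
  then obtain d where d: "0 < d" "\<And>s n. dist s t < d \<Longrightarrow> n \<in> A \<Longrightarrow> gap C x s n \<Longrightarrow> f (it n x) (s - of_int n) = s - of_int n"
    unfolding eventually_nhds_metric by blast
  have "tower C f x s = s" if s: "\<bar>s - t\<bar> < min d 1" for s
  proof (cases "\<exists>n. gap C x s n")
    case True
    then obtain n where n: "gap C x s n" by blast
    have "real (ret C (it n x)) \<le> real R" using R[of "it n x"] x by simp
    then have "of_int n < s" "s < of_int n + real R" using n by (auto simp: gap_def)
    then have "n \<in> A" using s unfolding A_def by (simp; linarith)
    then show ?thesis using d(2)[of s n] n s tower_gap[OF x n] by (simp add: dist_real_def)
  qed (simp add: tower_no_gap)
  then show ?thesis using that[of "min d 1"] d(1) by simp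
qed

lemma tower_leaf_maps:
  assumes C: "clopen_base C" and f: "tower_data C f" shows "tower C f \<in> leaf_maps"
proof -
  have "tower C f x \<in> PLD" if x: "x \<in> topspace X" for x
  proof (rule PLD_I)
    show "surj (tower C f x)"
      using tower_finv_cancel(2)[OF f] by (rule surjI)
    fix t
    show "dyadic_germ (tower C f x) t"
    proof (cases "\<exists>n. gap C x t n")
      case True
      then obtain n where n: "gap C x t n" by blast
      then have "it n x \<in> C" by (simp add: gap_def)
      then have "f (it n x) \<in> PLD" using tower_dataD(2)[OF f] by blast
      then have germ: "dyadic_germ (\<lambda>s. f (it n x) (s - of_int n) + of_int n) t"
        by (intro dyadic_germ_shift PLD_germ)
      define d where "d = min (t - of_int n) (of_int n + real (ret C (it n x)) - t)"
      have d: "0 < d" using n by (simp add: gap_def d_def)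
      have "tower C f x s = f (it n x) (s - of_int n) + of_int n" if "\<bar>s - t\<bar> < d" for s
      proof -
        have "gap C x s n" using that n unfolding gap_def d_def by (auto simp: abs_less_iff)
        then show ?thesis by (rule tower_gap[OF x])
      qed
      then show ?thesis by (intro dyadic_germ_cong[OF germ d])
    next
      case False
      then obtain e where "0 < e" "\<And>s. \<bar>s - t\<bar> < e \<Longrightarrow> tower C f x s = s"
        using tower_id_near[OF C f x] by blast
      then show ?thesis by (intro dyadic_germ_cong[OF dyadic_germ_id])
    qed
  qed
  moreover have "tower C f x = id" if "x \<notin> topspace X" for x
    using tower_outside[OF that] by (auto simp: fun_eq_iff)
  ultimately show ?thesis
    unfolding leaf_maps_def using tower_equivariant tower_locally_constant[OF C f]
    by (intro CollectI conjI ballI allI impI)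
qed

section \<open>The groups of maps that are the identity near a point\<close>

text \<open>This is \<open>K\<^sub>y\<close> for \<open>y = [x, 0]\<close>. The condition is imposed
  on the leaf of \<open>x\<close> only; local constancy spreads it to nearby leaves
  (\<open>stab_near\<close>).\<close>

definition stab :: "'a \<Rightarrow> ('a \<Rightarrow> real \<Rightarrow> real) set" where
  "stab x = {F \<in> leaf_maps. \<exists>e>0. \<forall>t. \<bar>t\<bar> < e \<longrightarrow> F x t = t}"

lemma tower_stab:
  assumes C: "clopen_base C" and f: "tower_data C f" and x: "x \<in> C" shows "tower C f \<in> stab x"
proof -
  have xt: "x \<in> topspace X" using clopen_baseD(4)[OF C x] .
  have "\<not> gap C x 0 n" for n
  proof
    assume n: "gap C x 0 n"
    then have "n + int (ret C (it n x)) \<le> 0" using x by (intro next_visit[OF xt]) (auto simp: gap_def)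
    then show False using n unfolding gap_def by linarith
  qed
  then obtain e where "0 < e" "\<And>s. \<bar>s - 0\<bar> < e \<Longrightarrow> tower C f x s = s"
    using tower_id_near[OF C f xt, of 0] by blast
  then show ?thesis unfolding stab_def using tower_leaf_maps[OF C f] by auto
qed

lemma stab_near:
  assumes F: "F \<in> stab x" and x: "x \<in> topspace X"
  obtains U e where "openin X U" "x \<in> U" "0 < e" "\<And>x' t. x' \<in> U \<Longrightarrow> \<bar>t\<bar> < e \<Longrightarrow> F x' t = t"
proof -
  obtain d where d: "0 < d" "\<And>t. \<bar>t\<bar> < d \<Longrightarrow> F x t = t" and FL: "F \<in> leaf_maps" using F unfolding stab_def by blast
  obtain U e where U: "openin X U" "x \<in> U" "0 < e" "\<And>x' s. x' \<in> U \<Longrightarrow> \<bar>s - 0\<bar> < e \<Longrightarrow> F x' s = F x s"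
    using leaf_maps_locally_constant[OF FL x] by blast
  have "F x' t = t" if "x' \<in> U" "\<bar>t\<bar> < min d e" for x' t
  proof -
    have "F x' t = F x t" by (rule U(4)) (use that in auto)
    also have "F x t = t" by (rule d(2)) (use that in auto)
    finally show ?thesis .
  qed
  then show ?thesis using that[of U "min d e"] U(1-3) d(1) by auto
qed

lemma stab_common_base:
  assumes "finite S" "S \<subseteq> stab x" and x: "x \<in> topspace X"
  obtains C e where "clopen_base C" "x \<in> C" "0 < e" "\<And>F x' t. F \<in> S \<Longrightarrow> x' \<in> C \<Longrightarrow> \<bar>t\<bar> < e \<Longrightarrow> F x' t = t"
proof -
  have "\<exists>U e. openin X U \<and> x \<in> U \<and> 0 < e \<and> (\<forall>F\<in>S. \<forall>x'\<in>U. \<forall>t. \<bar>t\<bar> < e \<longrightarrow> F x' t = t)"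
    using assms(1,2)
  proof (induction S)
    case empty
    show ?case by (intro exI[of _ "topspace X"] exI[of _ 1]) (use x in auto)
  next
    case (insert F S)
    obtain U e where U: "openin X U" "x \<in> U" "0 < e" "\<forall>F\<in>S. \<forall>x'\<in>U. \<forall>t. \<bar>t\<bar> < e \<longrightarrow> F x' t = t"
      using insert by auto
    obtain V d where V: "openin X V" "x \<in> V" "0 < d" "\<And>x' t. x' \<in> V \<Longrightarrow> \<bar>t\<bar> < d \<Longrightarrow> F x' t = t"
      using stab_near[OF _ x] insert.prems by blast
    have "G x' t = t" if "G \<in> insert F S" "x' \<in> U \<inter> V" "\<bar>t\<bar> < min e d" for G x' t
      using U(4) V(4)[of x' t] that by (cases "G = F") auto
    moreover have "openin X (U \<inter> V)" "x \<in> U \<inter> V" "0 < min e d" using U(1-3) V(1-3) by auto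
    ultimately show ?case by blast
  qed
  then obtain U e where U: "openin X U" "x \<in> U" "0 < e" "\<forall>F\<in>S. \<forall>x'\<in>U. \<forall>t. \<bar>t\<bar> < e \<longrightarrow> F x' t = t" by blast
  obtain C where C: "openin X C" "closedin X C" "x \<in> C" "C \<subseteq> U" using clopen_neighbourhood[OF U(1,2)] .
  have "clopen_base C" unfolding clopen_base_def using C by blast
  then show ?thesis using that[of C e] U C by blast
qed

text \<open>The segment map of \<open>F\<close> over \<open>x\<close>; on maps that are the identity
  near the cut, \<open>tower\<close> reassembles \<open>F\<close> from these.\<close>

definition cut :: "'a set \<Rightarrow> ('a \<Rightarrow> real \<Rightarrow> real) \<Rightarrow> 'a \<Rightarrow> real \<Rightarrow> real" where
  "cut C F x t = (if t \<le> 0 then t else if t \<le> real (ret C x) then F x t else t)"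

lemma leaf_maps_constant_on_interval:
  assumes F: "F \<in> leaf_maps" and x: "x \<in> topspace X" and "a \<le> b"
  shows "\<exists>U. openin X U \<and> x \<in> U \<and> (\<forall>x'\<in>U. \<forall>t. a \<le> t \<and> t \<le> b \<longrightarrow> F x' t = F x t)"
  using \<open>a \<le> b\<close>
proof (induction rule: Bolzano)
  case (trans a b c)
  obtain U where U: "openin X U" "x \<in> U" "\<forall>x'\<in>U. \<forall>t. a \<le> t \<and> t \<le> b \<longrightarrow> F x' t = F x t" using trans by blast
  obtain V where V: "openin X V" "x \<in> V" "\<forall>x'\<in>V. \<forall>t. b \<le> t \<and> t \<le> c \<longrightarrow> F x' t = F x t" using trans by blast
  have "F x' t = F x t" if "x' \<in> U \<inter> V" "a \<le> t \<and> t \<le> c" for x' t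
  proof (cases "t \<le> b")
    case True
    then show ?thesis using U(3) that by blast
  next
    case False
    then show ?thesis using V(3) that by (metis IntD2 linear)
  qed
  moreover have "openin X (U \<inter> V)" "x \<in> U \<inter> V" using U(1,2) V(1,2) by auto
  ultimately show ?case by blast
next
  case (local t0)
  obtain U e where U: "openin X U" "x \<in> U" "0 < e" "\<And>x' s. x' \<in> U \<Longrightarrow> \<bar>s - t0\<bar> < e \<Longrightarrow> F x' s = F x s"
    using leaf_maps_locally_constant[OF F x] by blast
  have "\<exists>U. openin X U \<and> x \<in> U \<and> (\<forall>x'\<in>U. \<forall>t. a \<le> t \<and> t \<le> b \<longrightarrow> F x' t = F x t)"
    if ab: "a \<le> t0 \<and> t0 \<le> b \<and> b - a < e" for a b
  proof -
    have "F x' t = F x t" if "x' \<in> U" "a \<le> t \<and> t \<le> b" for x' t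
      by (rule U(4)[OF that(1)]) (use that(2) ab in \<open>auto simp: abs_less_iff\<close>)
    then show ?thesis using U(1,2) by blast
  qed
  then show ?case using U(3) by blast
qed

text \<open>A map that is the identity near the cut preserves every segment. Equivariance carries
  the identity near the bottom of a segment to its top, which is the bottom of the next one. The
  uniform margin \<open>e\<close> is what lets the segment maps be squeezed later.\<close>

lemma cut_tower:
  assumes C: "clopen_base C" and F: "F \<in> leaf_maps" and e: "0 < e"
    and id: "\<And>x t. x \<in> C \<Longrightarrow> \<bar>t\<bar> < e \<Longrightarrow> F x t = t"
  shows "tower_data C (cut C F)" "F = tower C (cut C F)"
    "\<And>x t. x \<in> C \<Longrightarrow> t < e \<or> real (ret C x) - e < t \<Longrightarrow> cut C F x t = t"
proof -
  have top: "F x (t + real (ret C x)) = t + real (ret C x)" if x: "x \<in> C" and t: "\<bar>t\<bar> < e" for x t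
  proof -
    have xt: "x \<in> topspace X" using clopen_baseD(4)[OF C x] .
    let ?r = "int (ret C x)"
    have "F x (t + of_int ?r) = F (it ?r x) (t + of_int ?r - of_int ?r) + of_int ?r"
      by (rule equivariant_shift[OF leaf_mapsD(1)[OF F] xt])
    also have "F (it ?r x) (t + of_int ?r - of_int ?r) = t" using id[OF ret(2)[OF C xt], of t] t by simp
    finally show ?thesis by simp
  qed
  show ends: "cut C F x t = t" if x: "x \<in> C" and t: "t < e \<or> real (ret C x) - e < t" for x t
  proof -
    consider "t \<le> 0" | "real (ret C x) < t" | "0 < t" "t \<le> real (ret C x)" "t < e"
      | "0 < t" "t \<le> real (ret C x)" "real (ret C x) - e < t"
      using t by linarith
    then show ?thesis
    proof cases
      case 3
      then show ?thesis using id[OF x, of t] unfolding cut_def by auto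
    next
      case 4
      then show ?thesis using top[OF x, of "t - real (ret C x)"] unfolding cut_def by auto
    qed (auto simp: cut_def)
  qed
  have within: "cut C F x \<in> PLD_within 0 (real (ret C x))" if x: "x \<in> C" for x
  proof -
    have "F x 0 = 0" "F x (real (ret C x)) = real (ret C x)" using id[OF x, of 0] top[OF x, of 0] e by auto
    then have "(\<lambda>t. if t \<le> real (ret C x) then F x t else t) \<in> PLD"
      using leaf_maps_PLD[OF F] by (intro PLD_glue) auto
    then have "(\<lambda>t. if t \<le> 0 then t else if t \<le> real (ret C x) then F x t else t) \<in> PLD"
      using \<open>F x 0 = 0\<close> by (intro PLD_glue[OF PLD_id(2)]) auto
    then have "cut C F x \<in> PLD" unfolding cut_def[abs_def] .
    moreover have "supp_in (cut C F x) (e / 2) (real (ret C x) - e / 2)"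
      unfolding supp_in_def using ends[OF x] e by auto
    moreover have "0 < e / 2" "real (ret C x) - e / 2 < real (ret C x)" using e by auto
    ultimately show ?thesis unfolding PLD_within_def by blast
  qed
  show "tower_data C (cut C F)"
    unfolding tower_data_def
  proof
    fix x assume x: "x \<in> C"
    have xt: "x \<in> topspace X" using clopen_baseD(4)[OF C x] .
    obtain U where U: "openin X U" "x \<in> U" "\<forall>x'\<in>U. \<forall>t. 0 \<le> t \<and> t \<le> real (ret C x) \<longrightarrow> F x' t = F x t"
      using leaf_maps_constant_on_interval[OF F xt, of 0 "real (ret C x)"] by auto
    obtain V where V: "openin X V" "x \<in> V" "\<forall>x'\<in>V. ret C x' = ret C x" using ret_locally_constant[OF C xt] by blast
    have "cut C F x' = cut C F x" if "x' \<in> (U \<inter> V) \<inter> C" for x'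
    proof -
      have r: "ret C x' = ret C x" using V(3) that by blast
      have "F x' t = F x t" if "0 < t" "t \<le> real (ret C x)" for t
        using U(3) \<open>x' \<in> (U \<inter> V) \<inter> C\<close> that by (meson IntD1 less_imp_le)
      then show ?thesis unfolding cut_def[abs_def] r by (intro ext) simp
    qed
    moreover have "openin X (U \<inter> V)" "x \<in> U \<inter> V" using U(1,2) V(1,2) by auto
    ultimately show "cut C F x \<in> PLD_within 0 (real (ret C x)) \<and>
     (\<exists>U. openin X U \<and> x \<in> U \<and> (\<forall>x'\<in>U \<inter> C. cut C F x' = cut C F x))"
      using within[OF x] by blast
  qed
  show "F = tower C (cut C F)"
  proof (intro ext)
    fix x t
    show "F x t = tower C (cut C F) x t"
    proof (cases "x \<in> topspace X")
      case True
      obtain n where n: "it n x \<in> C" "t = of_int n \<or> gap C x t n" using gap_cover[OF C True] .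
      have Fx: "F x t = F (it n x) (t - of_int n) + of_int n"
        by (rule equivariant_shift[OF leaf_mapsD(1)[OF F] True])
      show ?thesis
      proof (cases "\<exists>m. gap C x t m")
        case gap: True
        then obtain m where m: "gap C x t m" by blast
        have "F x t = F (it m x) (t - of_int m) + of_int m"
          by (rule equivariant_shift[OF leaf_mapsD(1)[OF F] True])
        then show ?thesis using tower_gap[OF True m, of "cut C F"] m by (simp add: cut_def gap_def)
      next
        case False
        then have "t = of_int n" using n by blast
        then have "F x t = t" using Fx id[OF n(1), of 0] e by simp
        then show ?thesis using False by (simp add: tower_no_gap)
      qed
    next
      case False
      then show ?thesis using leaf_mapsD(3)[OF F False] by (simp add: tower_outside)
    qed
  qed
qed

end

lemma (in group) commutator_products_mult:
  assumes "w \<in> commutator_products G K" "w' \<in> commutator_products G K" "K \<subseteq> carrier G"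
  shows "w \<otimes> w' \<in> commutator_products G K"
proof -
  have car: "v \<in> carrier G" if "v \<in> commutator_products G K" for v
    using that
  proof induction
    case (step a b w)
    then have "a \<in> carrier G" "b \<in> carrier G" using assms(3) by auto
    then show ?case using step by simp
  qed simp
  show ?thesis
    using assms(1)
  proof induction
    case one
    then show ?case using assms car by simp
  next
    case (step a b w)
    have "a \<in> carrier G" "b \<in> carrier G" "w \<in> carrier G" "w' \<in> carrier G"
      using step car assms by auto
    then have "a \<otimes> b \<otimes> inv a \<otimes> inv b \<otimes> w \<otimes> w' = a \<otimes> b \<otimes> inv a \<otimes> inv b \<otimes> (w \<otimes> w')"
      by (simp add: m_assoc)
    then show ?case using step by (simp add: commutator_products.step)
  qed
qed

lemma disjoint_supports_commute:
  assumes f: "f \<in> PLD" "supp_in f a b" and g: "g \<in> PLD" "supp_in g c d" and "b \<le> c"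
  shows "f \<circ> g = g \<circ> f"
proof
  fix t
  show "(f \<circ> g) t = (g \<circ> f) t"
  proof (cases "t \<le> c")
    case True
    then have "f t \<le> c"
      using f PLD_le_iff[OF f(1), of t c] assms(5) unfolding supp_in_def by auto
    then show ?thesis using True g(2) by (simp add: supp_in_def)
  next
    case False
    then have "g c < g t" using PLD_less_iff[OF g(1), of c t] by simp
    then have "b \<le> g t" "b \<le> t" using g(2) False assms(5) unfolding supp_in_def by auto
    then show ?thesis using f(2) by (simp add: supp_in_def)
  qed
qed

text \<open>All slots lie in \<open>(0, 1)\<close>, hence in every segment whatever its length
  \<open>r\<close>, and their ends \<open>i / 2 ^ N\<close> are dyadic. A dyadic contraction into
  the slot is extended to a map supported inside \<open>(0, r)\<close>.\<close>

lemma squeeze_into_slot: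
  assumes e: "0 < e" "e \<in> D" and r: "1 \<le> (r::nat)" and i: "i < 2 ^ N"
  obtains c where "c \<in> PLD_within 0 (real r)"
    "\<And>t. e \<le> t \<Longrightarrow> t \<le> real r - e \<Longrightarrow> real i / 2 ^ N < c t \<and> c t < real (Suc i) / 2 ^ N"
proof (cases "e \<le> real r - e")
  \<comment> \<open>Here \<open>[e, r - e]\<close> is empty and the slot condition is
    vacuous.\<close>
  case False
  then show ?thesis using that[of id] PLD_within_id by auto
next
  case True
  obtain k where "(1/2::real) ^ k < 1 / (real r * 2 ^ N)"
    using real_arch_pow_inv[of "1 / (real r * 2 ^ N)" "1/2"] r by auto
  then have k: "(1/2) ^ k * real r < 1 / 2 ^ N" using r by (simp add: field_simps)
  define A where "A = (\<lambda>t. 2 powi (- int k) * t + real i * 2 powi (- int N))"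
  have "real i * 2 powi (- int N) \<in> D" by (intro dyadic_rats_mult dyadic_rats_of_nat dyadic_rats_powi)
  then have A: "A \<in> PLD" unfolding A_def by (rule PLD_affine)
  have A_eq: "A t = (1/2) ^ k * t + real i / 2 ^ N" for t
    by (simp add: A_def power_int_minus power_one_over field_simps)
  have slot: "real i / 2 ^ N < A t \<and> A t < real (Suc i) / 2 ^ N" if "0 < t" "t < real r" for t
  proof -
    have "(1/2) ^ k * t < (1/2) ^ k * real r" using that by simp
    then have "(1/2) ^ k * t < 1 / 2 ^ N" using k by linarith
    moreover have "0 < (1/2) ^ k * t" using that by simp
    ultimately show ?thesis unfolding A_eq by (simp add: add_divide_distrib)
  qed
  have e': "e < real r" "0 < real r - e" "real r - e < real r" using True e by auto
  have "0 \<le> real i / 2 ^ N" "real (Suc i) / 2 ^ N \<le> 1"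
  proof -
    have "real (Suc i) \<le> 2 ^ N" using i by (metis Suc_leI of_nat_le_iff of_nat_numeral of_nat_power)
    then show "0 \<le> real i / 2 ^ N" "real (Suc i) / 2 ^ N \<le> 1" by (auto simp: field_simps)
  qed
  moreover have "real i / 2 ^ N < A e" "A (real r - e) < real (Suc i) / 2 ^ N"
    using slot[of e] slot[of "real r - e"] e e' by blast+
  moreover have "1 \<le> real r" using r by simp
  ultimately have pos: "0 < A e" "A (real r - e) < real r" by linarith+
  obtain u where u: "u \<in> D" "0 < u" "u < min e (A e)" using dyadic_rats_between[of 0 "min e (A e)"] e pos by auto
  obtain v where v: "v \<in> D" "max (real r - e) (A (real r - e)) < v" "v < real r"
    using dyadic_rats_between[of "max (real r - e) (A (real r - e))" "real r"] e' pos by auto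
  have rD: "real r - e \<in> D" using e by blast
  have "u < e" "u < A e" "real r - e < v" "A (real r - e) < v" using u v by auto
  then obtain c where c: "c \<in> PLD" "\<And>t. e \<le> t \<Longrightarrow> t \<le> real r - e \<Longrightarrow> c t = A t" "supp_in c u v"
    using PLD_extend[OF A e(2) rD u(1) v(1) _ _ True] by blast
  then have "c \<in> PLD_within 0 (real r)" using u v unfolding PLD_within_def by blast
  moreover have "real i / 2 ^ N < c t \<and> c t < real (Suc i) / 2 ^ N" if "e \<le> t" "t \<le> real r - e" for t
    using c(2)[OF that] slot[of t] that e by simp
  ultimately show ?thesis using that by blast
qed

section \<open>Perfectness and displacement\<close>

context minimal_stone_dynamics
begin

lemma stab_leaf_maps: "stab x \<subseteq> leaf_maps"
  by (auto simp: stab_def)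

lemma subgroup_stab: "subgroup (stab x) leaf_group"
proof (rule group.subgroupI[OF group_leaf_group])
  show "stab x \<subseteq> carrier leaf_group" using stab_leaf_maps by simp
  have "(\<lambda>x. id) \<in> stab x" unfolding stab_def using leaf_maps_id by (auto intro: exI[of _ 1])
  then show "stab x \<noteq> {}" by blast
next
  fix F assume F: "F \<in> stab x"
  then obtain e where e: "0 < e" "\<And>t. \<bar>t\<bar> < e \<Longrightarrow> F x t = t" and FL: "F \<in> leaf_maps" unfolding stab_def by blast
  have "finv (F x) t = t" if "\<bar>t\<bar> < e" for t
    using e(2)[OF that] leaf_maps_PLD[OF FL] by (metis PLD_inv_f)
  then show "inv\<^bsub>leaf_group\<^esub> F \<in> stab x"
    unfolding inv_leaf_group[OF FL] stab_def using leaf_maps_finv[OF FL] e(1) by blast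
next
  fix F G assume "F \<in> stab x" "G \<in> stab x"
  then obtain e d where ed: "0 < e" "\<And>t. \<bar>t\<bar> < e \<Longrightarrow> F x t = t" "0 < d" "\<And>t. \<bar>t\<bar> < d \<Longrightarrow> G x t = t"
    and L: "F \<in> leaf_maps" "G \<in> leaf_maps" unfolding stab_def by blast
  have "(F x \<circ> G x) t = t" if "\<bar>t\<bar> < min e d" for t using ed that by simp
  moreover have "0 < min e d" using ed by simp
  ultimately show "F \<otimes>\<^bsub>leaf_group\<^esub> G \<in> stab x"
    unfolding leaf_group_simps stab_def using leaf_maps_comp[OF L] by blast
qed

lemma inv_tower:
  assumes C: "clopen_base C" and f: "tower_data C f"
  shows "inv\<^bsub>leaf_group\<^esub> (tower C f) = tower C (\<lambda>x. finv (f x))"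
proof (rule group.inv_equality[OF group_leaf_group])
  show "tower C (\<lambda>x. finv (f x)) \<otimes>\<^bsub>leaf_group\<^esub> tower C f = \<one>\<^bsub>leaf_group\<^esub>"
    unfolding leaf_group_simps using tower_finv_cancel(1)[OF f] by (simp add: fun_eq_iff)
qed (simp_all add: tower_leaf_maps C f tower_data_finv)

lemma tower_data_indicator:
  assumes e: "h \<in> PLD_within 0 \<rho>" and D: "\<And>x. x \<in> D' \<Longrightarrow> \<rho> \<le> real (ret C x)"
    and loc: "\<And>x. x \<in> C \<Longrightarrow> \<exists>U. openin X U \<and> x \<in> U \<and> (\<forall>x'\<in>U \<inter> C. x' \<in> D' \<longleftrightarrow> x \<in> D')"
  shows "tower_data C (\<lambda>x. if x \<in> D' then h else id)"
  unfolding tower_data_def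
proof
  fix x assume x: "x \<in> C"
  have "(if x \<in> D' then h else id) \<in> PLD_within 0 (real (ret C x))"
    using e D[of x] PLD_within_mono[of 0 0 \<rho> "real (ret C x)"] PLD_within_id by auto
  moreover obtain U where U: "openin X U" "x \<in> U" "\<forall>x'\<in>U \<inter> C. x' \<in> D' \<longleftrightarrow> x \<in> D'" using loc[OF x] by blast
  moreover have "(if x' \<in> D' then h else id) = (if x \<in> D' then h else id)" if "x' \<in> U \<inter> C" for x'
    using U(3) that by metis
  ultimately show "(if x \<in> D' then h else id) \<in> PLD_within 0 (real (ret C x)) \<and>
     (\<exists>U. openin X U \<and> x \<in> U \<and> (\<forall>x'\<in>U \<inter> C. (if x' \<in> D' then h else id) = (if x \<in> D' then h else id)))"
    by blast
qed

text \<open>Placing a segment map over \<open>D'\<close> and the identity elsewhere is a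
  homomorphism into \<open>stab x0\<close>, so it takes commutators to commutators. The bound
  \<open>\<rho>\<close> makes the entries fit into every segment over \<open>D'\<close>.\<close>

lemma tower_indicator_commutator_products:
  assumes C: "clopen_base C" and x0: "x0 \<in> C"
    and D: "\<And>x. x \<in> D' \<Longrightarrow> \<rho> \<le> real (ret C x)"
    and loc: "\<And>x. x \<in> C \<Longrightarrow> \<exists>U. openin X U \<and> x \<in> U \<and> (\<forall>x'\<in>U \<inter> C. x' \<in> D' \<longleftrightarrow> x \<in> D')"
    and h: "h \<in> commprod (PLD_within 0 \<rho>)"
  shows "tower C (\<lambda>x. if x \<in> D' then h else id) \<in> commutator_products leaf_group (stab x0)"
proof -
  define \<Theta> where "\<Theta> e = tower C (\<lambda>x. if x \<in> D' then e else id)" for e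
  have data: "tower_data C (\<lambda>x. if x \<in> D' then e else id)" if "e \<in> PLD_within 0 \<rho>" for e
    using that D loc by (rule tower_data_indicator)
  have \<Theta>_stab: "\<Theta> e \<in> stab x0" if "e \<in> PLD_within 0 \<rho>" for e
    unfolding \<Theta>_def using C data[OF that] x0 by (rule tower_stab)
  have \<Theta>_comp: "\<Theta> (e \<circ> e') = \<Theta> e \<otimes>\<^bsub>leaf_group\<^esub> \<Theta> e'" if "e' \<in> PLD_within 0 \<rho>" for e e'
  proof -
    have "\<Theta> (e \<circ> e') = tower C (\<lambda>x. (if x \<in> D' then e else id) \<circ> (if x \<in> D' then e' else id))"
      unfolding \<Theta>_def by (rule tower_cong) auto
    then show ?thesis unfolding \<Theta>_def leaf_group_simps tower_comp[OF data[OF that]] .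
  qed
  have \<Theta>_inv: "\<Theta> (finv e) = inv\<^bsub>leaf_group\<^esub> (\<Theta> e)" if "e \<in> PLD_within 0 \<rho>" for e
  proof -
    have "(\<lambda>x. finv (if x \<in> D' then e else id)) = (\<lambda>x. if x \<in> D' then finv e else id)"
      by (intro ext) (simp only: if_distrib[of finv] inv_id split: if_splits)
    then show ?thesis unfolding \<Theta>_def inv_tower[OF C data[OF that]] by simp
  qed
  have within: "w \<in> PLD_within 0 \<rho>" if "w \<in> commprod (PLD_within 0 \<rho>)" for w
    using that
  proof induction
    case (step a b w)
    then show ?case by (intro PLD_within_comp PLD_within_finv)
  qed (rule PLD_within_id)
  have "\<Theta> h \<in> commutator_products leaf_group (stab x0)"
    using h
  proof induction
    case id
    have "\<Theta> id = tower C (\<lambda>x. id)" unfolding \<Theta>_def by (rule tower_cong) simp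
    then have "\<Theta> id = \<one>\<^bsub>leaf_group\<^esub>" by (simp only: tower_id leaf_group_simps)
    then show ?case by (simp only: commutator_products.one)
  next
    case (step a b w)
    have fi: "finv a \<in> PLD_within 0 \<rho>" "finv b \<in> PLD_within 0 \<rho>" "w \<in> PLD_within 0 \<rho>"
      using step within by (auto intro: PLD_within_finv)
    have "\<Theta> (a \<circ> b \<circ> finv a \<circ> finv b \<circ> w) = \<Theta> a \<otimes>\<^bsub>leaf_group\<^esub> \<Theta> b \<otimes>\<^bsub>leaf_group\<^esub>
      inv\<^bsub>leaf_group\<^esub> (\<Theta> a) \<otimes>\<^bsub>leaf_group\<^esub> inv\<^bsub>leaf_group\<^esub> (\<Theta> b) \<otimes>\<^bsub>leaf_group\<^esub> \<Theta> w"
      using step(1,2) fi by (simp only: \<Theta>_comp \<Theta>_inv)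
    then show ?case using step \<Theta>_stab by (simp only: commutator_products.step)
  qed
  then show ?thesis by (simp add: \<Theta>_def)
qed

lemma tower_data_finite_image:
  assumes C: "clopen_base C" and f: "tower_data C f" shows "finite (f ` C)"
proof -
  define \<U> where "\<U> = {U. openin X U \<and> (\<exists>h. \<forall>x'\<in>U \<inter> C. f x' = h)}"
  have "compactin X C" using closedin_compact_space[OF X_compact clopen_baseD(2)[OF C]] .
  moreover have "C \<subseteq> \<Union>\<U>" unfolding \<U>_def using tower_dataD(3)[OF f] by blast
  moreover have "\<forall>U\<in>\<U>. openin X U" unfolding \<U>_def by blast
  ultimately obtain \<F> where F: "finite \<F>" "\<F> \<subseteq> \<U>" "C \<subseteq> \<Union>\<F>" unfolding compactin_def by meson
  have "\<forall>U\<in>\<F>. \<exists>h. \<forall>x'\<in>U \<inter> C. f x' = h" using F(2) unfolding \<U>_def by blast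
  then obtain h where h: "\<forall>U\<in>\<F>. \<forall>x'\<in>U \<inter> C. f x' = h U" by metis
  have "f ` C \<subseteq> h ` \<F>" using F(3) h by blast
  then show ?thesis using F(1) finite_subset by blast
qed

text \<open>By compactness \<open>F\<close> is a tower with finitely many distinct segment maps,
  hence a product of towers carrying a single map each; for these the perfectness of
  \<open>PLD_within\<close> suffices.\<close>

lemma stab_perfect:
  assumes x0: "x0 \<in> topspace X" shows "stab x0 \<subseteq> commutator_products leaf_group (stab x0)"
proof
  fix F assume F: "F \<in> stab x0"
  obtain C e where C: "clopen_base C" "x0 \<in> C" "0 < e" "\<And>G x' t. G \<in> {F} \<Longrightarrow> x' \<in> C \<Longrightarrow> \<bar>t\<bar> < e \<Longrightarrow> G x' t = t"
    using stab_common_base[of "{F}", OF _ _ x0] F by blast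
  have FL: "F \<in> leaf_maps" using F stab_leaf_maps by blast
  define f where "f = cut C F"
  note ct = cut_tower[OF C(1) FL C(3), folded f_def]
  have id: "F x t = t" if "x \<in> C" "\<bar>t\<bar> < e" for x t using C(4)[of F] that by blast
  have f: "tower_data C f" and FT: "F = tower C f" using ct(1,2) id by blast+
  let ?cp = "commutator_products leaf_group (stab x0)"
  let ?T = "\<lambda>H. \<lambda>x. if f x \<in> H then f x else id"
  have locf: "\<exists>U. openin X U \<and> x \<in> U \<and> (\<forall>x'\<in>U \<inter> C. f x' = f x)" if "x \<in> C" for x
    using tower_dataD(3)[OF f that] .
  have dataT: "tower_data C (?T H)" for H
    unfolding tower_data_def
  proof
    fix x assume x: "x \<in> C"
    obtain U where U: "openin X U" "x \<in> U" "\<forall>x'\<in>U \<inter> C. f x' = f x" using locf[OF x] by blast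
    have "?T H x' = ?T H x" if "x' \<in> U \<inter> C" for x'
    proof -
      have "f x' = f x" using U(3) that by blast
      then show ?thesis by simp
    qed
    moreover have "?T H x \<in> PLD_within 0 (real (ret C x))"
      using tower_dataD(1)[OF f x] PLD_within_id by simp
    ultimately show "?T H x \<in> PLD_within 0 (real (ret C x)) \<and>
       (\<exists>U. openin X U \<and> x \<in> U \<and> (\<forall>x'\<in>U \<inter> C. ?T H x' = ?T H x))"
      using U(1,2) by blast
  qed
  have "tower C (?T H) \<in> ?cp" if "finite H" "H \<subseteq> f ` C" for H
    using that
  proof (induction H)
    case empty
    have "tower C (?T {}) = tower C (\<lambda>x. id)" by (rule tower_cong) simp
    then have "tower C (?T {}) = \<one>\<^bsub>leaf_group\<^esub>" by (simp only: tower_id leaf_group_simps)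
    then show ?case by (simp only: commutator_products.one)
  next
    case (insert h H)
    define D' where "D' = {x \<in> C. f x = h}"
    have "\<exists>x. x \<in> D'" unfolding D'_def using insert.prems by auto
    then obtain x1 where x1: "x1 \<in> D'" "\<And>x. x \<in> D' \<Longrightarrow> ret C x1 \<le> ret C x"
      using ex_has_least_nat[of "\<lambda>x. x \<in> D'" _ "ret C"] by blast
    have "h \<in> PLD_within 0 (real (ret C x1))" using tower_dataD(1)[OF f, of x1] x1(1) by (auto simp: D'_def)
    moreover have "0 < real (ret C x1)"
      using ret(1)[OF C(1) clopen_baseD(4)[OF C(1), of x1]] x1(1) by (auto simp: D'_def)
    ultimately have "h \<in> commprod (PLD_within 0 (real (ret C x1)))"
      by (intro PLD_within_perfect) auto
    then have 1: "tower C (\<lambda>x. if x \<in> D' then h else id) \<in> ?cp"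
    proof (rule tower_indicator_commutator_products[OF C(1,2), rotated 2])
      show "real (ret C x1) \<le> real (ret C x)" if "x \<in> D'" for x using x1(2)[OF that] by simp
      fix x assume x: "x \<in> C"
      obtain U where U: "openin X U" "x \<in> U" "\<forall>x'\<in>U \<inter> C. f x' = f x" using locf[OF x] by blast
      have "x' \<in> D' \<longleftrightarrow> x \<in> D'" if "x' \<in> U \<inter> C" for x'
      proof -
        have "f x' = f x" using U(3) that by blast
        then show ?thesis using that x by (simp add: D'_def)
      qed
      then show "\<exists>U. openin X U \<and> x \<in> U \<and> (\<forall>x'\<in>U \<inter> C. x' \<in> D' \<longleftrightarrow> x \<in> D')" using U(1,2) by blast
    qed
    have "tower C (?T (insert h H)) = tower C (\<lambda>x. (if x \<in> D' then h else id) \<circ> ?T H x)"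
      using insert.hyps(2) by (intro tower_cong) (auto simp: D'_def)
    also have "\<dots> = tower C (\<lambda>x. if x \<in> D' then h else id) \<otimes>\<^bsub>leaf_group\<^esub> tower C (?T H)"
      unfolding leaf_group_simps by (rule tower_comp[OF dataT])
    also have "\<dots> \<in> ?cp"
      by (rule group.commutator_products_mult[OF group_leaf_group 1])
        (use insert stab_leaf_maps in auto)
    finally show ?case .
  qed
  then have "tower C (?T (f ` C)) \<in> ?cp" using tower_data_finite_image[OF C(1) f] by blast
  moreover have "tower C (?T (f ` C)) = F" unfolding FT by (rule tower_cong) auto
  ultimately show "F \<in> ?cp" by simp
qed

text \<open>The towers of the slot maps conjugate the segment maps into disjoint slots of every
  segment at once.\<close>

lemma stab_displacement:
  fixes N :: nat
  assumes x0: "x0 \<in> topspace X" and S: "finite S" "S \<subseteq> stab x0"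
  shows "\<exists>t. (\<forall>i<N. t i \<in> carrier leaf_group) \<and>
      (\<forall>i<N. \<forall>j<N. i \<noteq> j \<longrightarrow> (\<forall>a\<in>S. \<forall>b\<in>S.
        (t i \<otimes>\<^bsub>leaf_group\<^esub> a \<otimes>\<^bsub>leaf_group\<^esub> inv\<^bsub>leaf_group\<^esub> t i) \<otimes>\<^bsub>leaf_group\<^esub>
        (t j \<otimes>\<^bsub>leaf_group\<^esub> b \<otimes>\<^bsub>leaf_group\<^esub> inv\<^bsub>leaf_group\<^esub> t j) =
        (t j \<otimes>\<^bsub>leaf_group\<^esub> b \<otimes>\<^bsub>leaf_group\<^esub> inv\<^bsub>leaf_group\<^esub> t j) \<otimes>\<^bsub>leaf_group\<^esub>
        (t i \<otimes>\<^bsub>leaf_group\<^esub> a \<otimes>\<^bsub>leaf_group\<^esub> inv\<^bsub>leaf_group\<^esub> t i)))"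
proof -
  obtain C e0 where C: "clopen_base C" "x0 \<in> C" "0 < e0"
    "\<And>F x' t. F \<in> S \<Longrightarrow> x' \<in> C \<Longrightarrow> \<bar>t\<bar> < e0 \<Longrightarrow> F x' t = t"
    using stab_common_base[OF S x0] by blast
  obtain e where e: "e \<in> D" "0 < e" "e < e0" using dyadic_rats_between[OF C(3)] by blast
  have r1: "1 \<le> ret C x" if "x \<in> C" for x using ret(1)[OF C(1) clopen_baseD(4)[OF C(1) that]] .
  have SL: "F \<in> leaf_maps" if "F \<in> S" for F using S that stab_leaf_maps by blast
  have cutS: "tower_data C (cut C F)" "F = tower C (cut C F)"
    "x \<in> C \<Longrightarrow> supp_in (cut C F x) e (real (ret C x) - e)" if F: "F \<in> S" for F x
  proof -
    note ct = cut_tower[OF C(1) SL[OF F] C(3)]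
    show "tower_data C (cut C F)" "F = tower C (cut C F)" using ct(1,2) C(4)[OF F] by blast+
    have "cut C F x t = t" if "x \<in> C" "t < e0 \<or> real (ret C x) - e0 < t" for t
      by (rule ct(3)[OF _ that]) (rule C(4)[OF F])
    then show "supp_in (cut C F x) e (real (ret C x) - e)" if "x \<in> C"
      unfolding supp_in_def using that e(3) by auto
  qed
  have "\<exists>c. c \<in> PLD_within 0 (real r) \<and>
    (\<forall>t. e \<le> t \<and> t \<le> real r - e \<longrightarrow> real i / 2 ^ N < c t \<and> c t < real (Suc i) / 2 ^ N)"
    if i: "i < N" and r: "1 \<le> r" for i r
  proof -
    have "i < 2 ^ N" using i less_exp[of N] by linarith
    then obtain c where "c \<in> PLD_within 0 (real r)"
      "\<And>t. e \<le> t \<Longrightarrow> t \<le> real r - e \<Longrightarrow> real i / 2 ^ N < c t \<and> c t < real (Suc i) / 2 ^ N"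
      using squeeze_into_slot[OF e(2,1) r] by blast
    then show ?thesis by blast
  qed
  then obtain c where c: "\<And>i r. i < N \<Longrightarrow> 1 \<le> r \<Longrightarrow> c i r \<in> PLD_within 0 (real r) \<and>
    (\<forall>t. e \<le> t \<and> t \<le> real r - e \<longrightarrow> real i / 2 ^ N < c i r t \<and> c i r t < real (Suc i) / 2 ^ N)" by metis
  \<comment> \<open>The slot map depends on \<open>x\<close> only through the return time, hence is
    locally constant.\<close>
  define \<sigma> where "\<sigma> i x = c i (ret C x)" for i x
  have \<sigma>: "tower_data C (\<sigma> i)" if i: "i < N" for i
    unfolding tower_data_def
  proof
    fix x assume x: "x \<in> C"
    obtain U where U: "openin X U" "x \<in> U" "\<forall>x'\<in>U. ret C x' = ret C x"
      using ret_locally_constant[OF C(1) clopen_baseD(4)[OF C(1) x]] by blast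
    have "\<sigma> i x' = \<sigma> i x" if "x' \<in> U \<inter> C" for x'
      using bspec[OF U(3), of x'] that by (simp add: \<sigma>_def)
    moreover have "\<sigma> i x \<in> PLD_within 0 (real (ret C x))" unfolding \<sigma>_def using c[OF i r1[OF x]] by blast
    ultimately show "\<sigma> i x \<in> PLD_within 0 (real (ret C x)) \<and>
     (\<exists>U. openin X U \<and> x \<in> U \<and> (\<forall>x'\<in>U \<inter> C. \<sigma> i x' = \<sigma> i x))" using U(1,2) by blast
  qed
  define \<gamma> where "\<gamma> i F x = \<sigma> i x \<circ> cut C F x \<circ> finv (\<sigma> i x)" for i F x
  have \<gamma>: "tower_data C (\<gamma> i F)" if "i < N" "F \<in> S" for i F
    unfolding \<gamma>_def using \<sigma>[OF that(1)] cutS(1)[OF that(2)]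
    by (intro tower_data_comp tower_data_finv)
  have conj: "tower C (\<sigma> i) \<otimes>\<^bsub>leaf_group\<^esub> F \<otimes>\<^bsub>leaf_group\<^esub> inv\<^bsub>leaf_group\<^esub> (tower C (\<sigma> i)) = tower C (\<gamma> i F)"
    if "i < N" "F \<in> S" for i F
  proof -
    have "tower C (\<gamma> i F) = tower C (\<lambda>x. \<sigma> i x \<circ> cut C F x) \<otimes>\<^bsub>leaf_group\<^esub> tower C (\<lambda>x. finv (\<sigma> i x))"
      unfolding \<gamma>_def leaf_group_simps by (rule tower_comp[OF tower_data_finv[OF \<sigma>[OF that(1)]]])
    also have "tower C (\<lambda>x. \<sigma> i x \<circ> cut C F x) = tower C (\<sigma> i) \<otimes>\<^bsub>leaf_group\<^esub> tower C (cut C F)"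
      unfolding leaf_group_simps by (rule tower_comp[OF cutS(1)[OF that(2)]])
    finally show ?thesis
      unfolding inv_tower[OF C(1) \<sigma>[OF that(1)]] cutS(2)[OF that(2), symmetric] ..
  qed
  have comm: "\<gamma> i F x \<circ> \<gamma> j H x = \<gamma> j H x \<circ> \<gamma> i F x"
    if ij: "i < j" "j < N" and FH: "F \<in> S" "H \<in> S" and x: "x \<in> C" for i j F H x
  proof -
    let ?r = "real (ret C x)"
    have iN: "i < N" using ij by simp
    have \<sigma>P: "\<sigma> i x \<in> PLD" "\<sigma> j x \<in> PLD" using \<sigma>[OF iN] \<sigma>[OF ij(2)] x tower_dataD(2) by blast+
    have sF: "supp_in (\<gamma> i F x) (\<sigma> i x e) (\<sigma> i x (?r - e))"
      unfolding \<gamma>_def by (rule supp_in_conj[OF \<sigma>P(1) cutS(3)[OF FH(1) x]])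
    have sH: "supp_in (\<gamma> j H x) (\<sigma> j x e) (\<sigma> j x (?r - e))"
      unfolding \<gamma>_def by (rule supp_in_conj[OF \<sigma>P(2) cutS(3)[OF FH(2) x]])
    have P: "\<gamma> i F x \<in> PLD" "\<gamma> j H x \<in> PLD"
      using \<gamma>[OF iN FH(1)] \<gamma>[OF ij(2) FH(2)] x tower_dataD(2) by blast+
    show ?thesis
    proof (cases "e \<le> ?r - e")
      case True
      have "\<sigma> i x (?r - e) < real (Suc i) / 2 ^ N" "real j / 2 ^ N < \<sigma> j x e"
        using c[OF iN r1[OF x]] c[OF ij(2) r1[OF x]] True unfolding \<sigma>_def by auto
      moreover have "real (Suc i) / 2 ^ N \<le> real j / 2 ^ N" using ij by (intro divide_right_mono) auto
      ultimately have "\<sigma> i x (?r - e) \<le> \<sigma> j x e" by linarith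
      then show ?thesis by (rule disjoint_supports_commute[OF P(1) sF P(2) sH])
    next
      case False
      then have "\<sigma> i x (?r - e) < \<sigma> i x e" using \<sigma>P(1) by simp
      then have "t \<le> \<sigma> i x e \<or> \<sigma> i x (?r - e) \<le> t" for t by linarith
      then have "\<gamma> i F x t = t" for t using sF unfolding supp_in_def by blast
      then show ?thesis by (auto simp: fun_eq_iff)
    qed
  qed
  show ?thesis
  proof (intro exI[of _ "\<lambda>i. tower C (\<sigma> i)"] conjI allI impI ballI)
    show "tower C (\<sigma> i) \<in> carrier leaf_group" if "i < N" for i
      using tower_leaf_maps[OF C(1) \<sigma>[OF that]] by simp
    fix i j a b assume ij: "i < N" "j < N" "i \<noteq> j" and ab: "a \<in> S" "b \<in> S"
    have "\<gamma> i a x \<circ> \<gamma> j b x = \<gamma> j b x \<circ> \<gamma> i a x" if "x \<in> C" for x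
      using comm[of i j a b x] comm[of j i b a x] ij ab that by (cases "i < j") auto
    then have "tower C (\<lambda>x. \<gamma> i a x \<circ> \<gamma> j b x) = tower C (\<lambda>x. \<gamma> j b x \<circ> \<gamma> i a x)"
      by (rule tower_cong)
    then show "(tower C (\<sigma> i) \<otimes>\<^bsub>leaf_group\<^esub> a \<otimes>\<^bsub>leaf_group\<^esub> inv\<^bsub>leaf_group\<^esub> tower C (\<sigma> i)) \<otimes>\<^bsub>leaf_group\<^esub>
        (tower C (\<sigma> j) \<otimes>\<^bsub>leaf_group\<^esub> b \<otimes>\<^bsub>leaf_group\<^esub> inv\<^bsub>leaf_group\<^esub> tower C (\<sigma> j)) =
        (tower C (\<sigma> j) \<otimes>\<^bsub>leaf_group\<^esub> b \<otimes>\<^bsub>leaf_group\<^esub> inv\<^bsub>leaf_group\<^esub> tower C (\<sigma> j)) \<otimes>\<^bsub>leaf_group\<^esub>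
        (tower C (\<sigma> i) \<otimes>\<^bsub>leaf_group\<^esub> a \<otimes>\<^bsub>leaf_group\<^esub> inv\<^bsub>leaf_group\<^esub> tower C (\<sigma> i))"
      unfolding conj[OF ij(1) ab(1)] conj[OF ij(2) ab(2)] unfolding leaf_group_simps
      using tower_comp[OF \<gamma>[OF ij(2) ab(2)], of "\<gamma> i a"] tower_comp[OF \<gamma>[OF ij(1) ab(1)], of "\<gamma> j b"] by simp
  qed
qed

section \<open>Factorization of leafwise maps\<close>

text \<open>By freeness the first \<open>J\<close> iterates of \<open>y\<close> differ from
  \<open>y\<close>, so a small neighbourhood is disjoint from its first \<open>J\<close> images; the
  finite set \<open>P\<close> is closed and can be removed.\<close>

lemma separating_base:
  assumes y: "y \<in> topspace X" and P: "finite P" "P \<subseteq> topspace X" "y \<notin> P"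
  obtains C where "clopen_base C" "y \<in> C" "C \<inter> P = {}" "\<And>x. x \<in> C \<Longrightarrow> J \<le> ret C x"
proof -
  have "\<exists>U. openin X U \<and> y \<in> U \<and> (\<forall>j\<in>{1..J}. \<forall>x\<in>U. it (int j) x \<notin> U)"
  proof (induction J)
    case 0
    show ?case using y by (intro exI[of _ "topspace X"]) auto
  next
    case (Suc J)
    then obtain U where U: "openin X U" "y \<in> U" "\<forall>j\<in>{1..J}. \<forall>x\<in>U. it (int j) x \<notin> U" by blast
    have "it (int (Suc J)) y \<noteq> y" using it_free[OF y, of "int (Suc J)"] by auto
    then obtain V W where VW: "openin X V" "openin X W" "y \<in> V" "it (int (Suc J)) y \<in> W" "disjnt V W"
      using X_Hausdorff y it_in[OF y] unfolding Hausdorff_space_def by metis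
    let ?U = "U \<inter> V \<inter> {x \<in> topspace X. it (int (Suc J)) x \<in> W}"
    have "openin X ?U" using U VW openin_it_preimage by (intro openin_Int) auto
    moreover have "y \<in> ?U" using U VW y by auto
    moreover have "it (int j) x \<notin> ?U" if j: "j \<in> {1..Suc J}" and x: "x \<in> ?U" for j x
    proof (cases "j = Suc J")
      case True
      then show ?thesis using x VW(5) by (auto simp: disjnt_def)
    next
      case False
      then have "j \<in> {1..J}" using j by auto
      then show ?thesis using U(3) x by blast
    qed
    ultimately show ?case by blast
  qed
  then obtain U where U: "openin X U" "y \<in> U" "\<And>j x. j \<in> {1..J} \<Longrightarrow> x \<in> U \<Longrightarrow> it (int j) x \<notin> U" by blast
  have "openin X (U \<inter> (topspace X - P))" using U closedin_finite[OF P(1,2)] by blast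
  moreover have "y \<in> U \<inter> (topspace X - P)" using U P y by blast
  ultimately obtain C where C: "openin X C" "closedin X C" "y \<in> C" "C \<subseteq> U \<inter> (topspace X - P)"
    using clopen_neighbourhood by metis
  have base: "clopen_base C" unfolding clopen_base_def using C by blast
  have "J \<le> ret C x" if x: "x \<in> C" for x
  proof (rule ccontr)
    assume "\<not> J \<le> ret C x"
    then have "ret C x \<in> {1..J}" using ret(1)[OF base clopen_baseD(4)[OF base x]] by simp
    then have "it (int (ret C x)) x \<notin> U" using U(3) x C(4) by blast
    then show False using ret(2)[OF base clopen_baseD(4)[OF base x]] C(4) by blast
  qed
  then show ?thesis using that[of C] base C by blast
qed

text \<open>A thin tower of height at least \<open>2 * m\<close> is placed with
  \<open>[x, 0]\<close> at height \<open>m\<close>, so that \<open>[x, 0]\<close> and its image both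
  have height in \<open>(0, 2 * m)\<close>. There \<open>k\<close> copies \<open>F\<close> near
  \<open>x\<close>, and \<open>k'\<close> is what remains.\<close>

lemma leaf_maps_factor:
  assumes F: "F \<in> leaf_maps" and x: "x \<in> topspace X" and Z: "finite Z" "Z \<subseteq> topspace X"
    and other: "\<And>z n. z \<in> Z \<Longrightarrow> it n z \<noteq> x"
  shows "\<exists>k. k \<in> leaf_maps \<and> (\<forall>z\<in>Z. k \<in> stab z) \<and> (\<exists>k'\<in>stab x. F = k \<otimes>\<^bsub>leaf_group\<^esub> k')"
proof -
  define m where "m = nat (\<lceil>\<bar>F x 0\<bar>\<rceil> + 1)"
  have m: "\<bar>F x 0\<bar> < real m" "1 \<le> m" unfolding m_def by linarith+
  \<comment> \<open>If \<open>k\<close> moved a point \<open>[z, t]\<close> with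
    \<open>\<bar>t\<bar> < 1\<close>, the visit \<open>n\<close> at the bottom of its segment would
    satisfy \<open>-1 - 2 * m < n < 1\<close>; the base of the tower avoids these iterates of
    \<open>z\<close>.\<close>
  define P where "P = (\<lambda>(n, z). it n z) ` ({- 2 * int m - 1..1} \<times> Z)"
  define y where "y = it (- int m) x"
  have y: "y \<in> topspace X" "it (int m) y = x" using x it_cancel(2)[OF x] by (auto simp: y_def)
  have "finite P" unfolding P_def using Z by auto
  moreover have "P \<subseteq> topspace X" unfolding P_def using Z by auto
  moreover have "y \<notin> P"
  proof
    assume "y \<in> P"
    then obtain n z where z: "z \<in> Z" "y = it n z" unfolding P_def by auto
    then have "it (int m + n) z = x" using y it_add[of z "int m" n] Z by auto
    then show False using other[OF z(1)] by blast
  qed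
  ultimately obtain C where C: "clopen_base C" "y \<in> C" "C \<inter> P = {}" "\<And>x. x \<in> C \<Longrightarrow> 2 * m \<le> ret C x"
    using separating_base[OF y(1), of P "2 * m"] by blast
  \<comment> \<open>\<open>F\<close> on the leaf of \<open>x\<close>, in the time coordinate based
    at \<open>y\<close>, where \<open>x\<close> has height \<open>m\<close>.\<close>
  define G where "G = (\<lambda>t. F x (t - real m) + real m)"
  have G: "G \<in> PLD"
  proof -
    have FP: "F x \<in> PLD" using leaf_maps_PLD[OF F] .
    have "(\<lambda>t. t + real m) \<circ> (F x \<circ> (\<lambda>t. t + (- real m))) \<in> PLD"
      using FP by (intro PLD_comp PLD_translation) auto
    moreover have "(\<lambda>t. t + real m) \<circ> (F x \<circ> (\<lambda>t. t + (- real m))) = G" by (auto simp: G_def)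
    ultimately show ?thesis by simp
  qed
  have Gm: "0 < G (real m)" "G (real m) < 2 * real m" using m unfolding G_def by auto
  have inv0: "finv G 0 < real m" "real m < finv G (2 * real m)"
    using PLD_less_iff[OF G, of "finv G 0" "real m"] PLD_less_iff[OF G, of "real m" "finv G (2 * real m)"] G Gm by auto
  obtain a where a: "a \<in> D" "max 0 (finv G 0) < a" "a < real m"
    using dyadic_rats_between[of "max 0 (finv G 0)" "real m"] inv0 m by auto
  obtain b where b: "b \<in> D" "real m < b" "b < min (2 * real m) (finv G (2 * real m))"
    using dyadic_rats_between[of "real m" "min (2 * real m) (finv G (2 * real m))"] inv0 m by auto
  have Gab: "0 < G a" "G b < 2 * real m"
    using PLD_less_iff[OF G, of "finv G 0" a] PLD_less_iff[OF G, of b "finv G (2 * real m)"] G a b by auto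
  obtain u where u: "u \<in> D" "0 < u" "u < min a (G a)" using dyadic_rats_between[of 0 "min a (G a)"] a Gab by auto
  obtain v where v: "v \<in> D" "max b (G b) < v" "v < 2 * real m"
    using dyadic_rats_between[of "max b (G b)" "2 * real m"] b Gab by auto
  obtain h where h: "h \<in> PLD" "\<And>t. a \<le> t \<Longrightarrow> t \<le> b \<Longrightarrow> h t = G t" "supp_in h u v"
    using PLD_extend[OF G a(1) b(1) u(1) v(1)] u v a b by auto
  have hw: "h \<in> PLD_within 0 (2 * real m)" using h u v unfolding PLD_within_def by blast
  define k where "k = tower C (\<lambda>_. h)"
  have data: "tower_data C (\<lambda>_. h)"
    unfolding tower_data_def
  proof
    fix c assume c: "c \<in> C"
    have "2 * real m \<le> real (ret C c)" using C(4)[OF c] by linarith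
    then have "h \<in> PLD_within 0 (real (ret C c))" using hw PLD_within_mono[of 0 0] by blast
    then show "h \<in> PLD_within 0 (real (ret C c)) \<and> (\<exists>U. openin X U \<and> c \<in> U \<and> (\<forall>x'\<in>U \<inter> C. h = h))"
      using clopen_baseD(1)[OF C(1)] c by blast
  qed
  have kL: "k \<in> leaf_maps" unfolding k_def by (rule tower_leaf_maps[OF C(1) data])
  have kz: "k \<in> stab z" if z: "z \<in> Z" for z
  proof -
    have zt: "z \<in> topspace X" using z Z by blast
    have "k z t = t" if t: "\<bar>t\<bar> < 1" for t
    proof (cases "\<exists>n. gap C z t n")
      case True
      then obtain n where n: "gap C z t n" by blast
      have kt: "k z t = h (t - of_int n) + of_int n" unfolding k_def by (rule tower_gap[OF zt n])
      have "2 * real m \<le> t - of_int n"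
      proof (rule ccontr)
        assume "\<not> 2 * real m \<le> t - of_int n"
        then have "of_int n < t" "t - of_int n < 2 * real m" using n by (auto simp: gap_def)
        then have "n \<in> {- 2 * int m - 1..1}" using t by (simp; linarith)
        then have "it n z \<in> P" unfolding P_def using z by force
        then show False using C(3) n by (auto simp: gap_def)
      qed
      then have "h (t - of_int n) = t - of_int n" using PLD_within_fix(2)[OF hw] by blast
      then show ?thesis using kt by simp
    next
      case False
      then show ?thesis unfolding k_def by (intro tower_no_gap) blast
    qed
    then show ?thesis unfolding stab_def using kL zero_less_one by blast
  qed
  define e where "e = min (real m - a) (b - real m)"
  have e: "0 < e" using a b by (simp add: e_def)
  have kF: "k x t = F x t" if t: "\<bar>t\<bar> < e" for t
  proof -
    have tab: "a \<le> t + real m" "t + real m \<le> b" using t unfolding e_def by linarith+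
    have "2 * real m \<le> real (ret C y)" using C(4)[OF C(2)] by linarith
    then have "gap C x t (- int m)" unfolding gap_def using C(2) tab a b by (auto simp: y_def[symmetric])
    then have "k x t = h (t + real m) - real m" unfolding k_def using tower_gap[OF x] by (simp add: y_def)
    then show ?thesis using h(2)[OF tab] by (simp add: G_def)
  qed
  define k' where "k' = (\<lambda>x. finv (k x) \<circ> F x)"
  have "k' \<in> leaf_maps" unfolding k'_def using leaf_maps_finv[OF kL] F by (rule leaf_maps_comp)
  moreover have "k' x t = t" if "\<bar>t\<bar> < e" for t
    using kF[OF that] leaf_maps_PLD[OF kL] by (simp add: k'_def flip: kF[OF that])
  ultimately have "k' \<in> stab x" unfolding stab_def using e by blast
  moreover have "F = k \<otimes>\<^bsub>leaf_group\<^esub> k'"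
    unfolding leaf_group_simps k'_def using leaf_maps_PLD[OF kL] by (auto simp: fun_eq_iff)
  ultimately show ?thesis using kL kz by blast
qed

section \<open>Three leaves and the conclusion\<close>

text \<open>An isolated point would be reached from every point within a bounded time, which leaves
  only finitely many points. So singletons are nowhere dense, and Baire's theorem excludes countably
  many of them.\<close>

lemma uncountable_X: "uncountable (topspace X)"
proof
  assume count: "countable (topspace X)"
  define \<G> where "\<G> = (\<lambda>x. {x}) ` topspace X"
  have "X interior_of \<Union>\<G> = {}"
  proof (rule Baire_category_alt)
    show "completely_metrizable_space X \<or> locally_compact_space X \<and> regular_space X"
      using X_compact X_Hausdorff
      by (simp add: compact_imp_locally_compact_space compact_Hausdorff_imp_regular_space)
    show "countable \<G>" unfolding \<G>_def using count by blast
    fix T assume "T \<in> \<G>"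
    then obtain x where x: "x \<in> topspace X" "T = {x}" unfolding \<G>_def by blast
    have "\<not> openin X {x}"
    proof
      assume open_x: "openin X {x}"
      obtain R :: nat where R: "\<And>y. y \<in> topspace X \<Longrightarrow> \<exists>n. 1 \<le> n \<and> n \<le> R \<and> it (int n) y \<in> {x}"
        using bounded_return[OF open_x] by blast
      have "topspace X \<subseteq> (\<lambda>n. it (- int n) x) ` {..R}"
      proof
        fix y assume y: "y \<in> topspace X"
        then obtain n where n: "n \<le> R" "it (int n) y = x" using R by blast
        then have "y = it (- int n) x" using it_cancel(1)[OF y] by metis
        then show "y \<in> (\<lambda>n. it (- int n) x) ` {..R}" using n by blast
      qed
      then show False using X_infinite finite_subset by blast
    qed
    moreover have "X interior_of T = {} \<or> X interior_of T = {x}" using interior_of_subset[of X T] x by blast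
    ultimately have "X interior_of T = {}" using openin_interior_of[of X T] by metis
    then show "closedin X T \<and> X interior_of T = {}" using closedin_finite x by simp
  qed
  moreover have "\<Union>\<G> = topspace X" unfolding \<G>_def by blast
  ultimately show False using X_ne by simp
qed

lemma three_orbits:
  obtains xs :: "nat \<Rightarrow> 'a" where "\<And>i. xs i \<in> topspace X"
    "\<And>i j n. i < 3 \<Longrightarrow> j < 3 \<Longrightarrow> i \<noteq> j \<Longrightarrow> it n (xs i) \<noteq> xs j"
proof -
  define orb where "orb x = range (\<lambda>n. it n x)" for x
  have new: "\<exists>z\<in>topspace X. z \<notin> orb x \<union> orb y" for x y
  proof (rule ccontr)
    assume "\<not> (\<exists>z\<in>topspace X. z \<notin> orb x \<union> orb y)"
    then have "topspace X \<subseteq> orb x \<union> orb y" by blast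
    moreover have "countable (orb x \<union> orb y)" unfolding orb_def by auto
    ultimately show False using uncountable_X countable_subset by blast
  qed
  have sym: "x \<in> orb y" if y: "y \<in> orb x" and x: "x \<in> topspace X" for x y
  proof -
    obtain n where "y = it n x" using y unfolding orb_def by blast
    then have "x = it (- n) y" using it_cancel(1)[OF x] by simp
    then show ?thesis unfolding orb_def by blast
  qed
  obtain x0 where x0: "x0 \<in> topspace X" using X_ne by blast
  obtain x1 where x1: "x1 \<in> topspace X" "x1 \<notin> orb x0" using new[of x0 x0] by blast
  obtain x2 where x2: "x2 \<in> topspace X" "x2 \<notin> orb x0" "x2 \<notin> orb x1" using new[of x0 x1] by blast
  define xs where "xs i = (if i = 0 then x0 else if i = 1 then x1 else x2)" for i :: nat
  have "xs j \<notin> orb (xs i)" if ij: "i < 3" "j < 3" "i \<noteq> j" for i j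
  proof -
    have "i = 0 \<or> i = 1 \<or> i = 2" "j = 0 \<or> j = 1 \<or> j = 2" using ij by linarith+
    moreover have "x0 \<notin> orb x1" "x0 \<notin> orb x2" "x1 \<notin> orb x2" using sym x0 x1 x2 by blast+
    ultimately show ?thesis using x0 x1 x2 ij(3) unfolding xs_def by (elim disjE) simp_all
  qed
  then have "it n (xs i) \<noteq> xs j" if "i < 3" "j < 3" "i \<noteq> j" for i j n
    using that unfolding orb_def by (metis rangeI)
  moreover have "xs i \<in> topspace X" for i using x0 x1 x2 by (simp add: xs_def)
  ultimately show ?thesis using that by blast
qed

lemma leaf_group_fixed_point:
  assumes \<beta>: "\<beta> \<in> hom leaf_group (homeo_group circle)"
  shows "\<exists>z\<in>sphere 0 1. \<forall>F\<in>leaf_maps. \<beta> F z = z"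
proof -
  interpret G: group leaf_group by (rule group_leaf_group)
  interpret circle_action leaf_group \<beta> by unfold_locales (rule \<beta>)
  obtain xs :: "nat \<Rightarrow> 'a" where xs: "\<And>i. xs i \<in> topspace X"
    "\<And>i j n. i < 3 \<Longrightarrow> j < 3 \<Longrightarrow> i \<noteq> j \<Longrightarrow> it n (xs i) \<noteq> xs j"
    using three_orbits by blast
  have "\<exists>z\<in>sphere 0 1. \<forall>F\<in>carrier leaf_group. \<beta> F z = z"
  proof (rule fixed_point_if_factored[of "\<lambda>i. stab (xs i)"])
    show "subgroup (stab (xs i)) leaf_group" for i by (rule subgroup_stab)
    show "stab (xs i) \<subseteq> commutator_products leaf_group (stab (xs i))" for i by (rule stab_perfect[OF xs(1)])
    show "\<exists>k\<in>stab (xs i) \<inter> stab (xs j). \<exists>k'\<in>stab (xs l). F = k \<otimes>\<^bsub>leaf_group\<^esub> k'"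
      if F: "F \<in> carrier leaf_group" and ijl: "{i, j, l} = {0, 1, 2}" for F i j l
    proof -
      have "card {i, j, l} = 3" unfolding ijl by simp
      then have ne: "i \<noteq> l" "j \<noteq> l" by (auto simp: card_insert_if split: if_splits)
      have "i \<in> {0, 1, 2}" "j \<in> {0, 1, 2}" "l \<in> {0, 1, 2}" using ijl by blast+
      then have "i < 3" "j < 3" "l < 3" by auto
      then have "\<exists>k. k \<in> leaf_maps \<and> (\<forall>z\<in>{xs i, xs j}. k \<in> stab z) \<and> (\<exists>k'\<in>stab (xs l). F = k \<otimes>\<^bsub>leaf_group\<^esub> k')"
        using F xs ne by (intro leaf_maps_factor) auto
      then show ?thesis by blast
    qed
  qed (rule stab_displacement[OF xs(1)])
  then show ?thesis by simp
qed

end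

theorem theorem4:
  fixes X :: "'a topology" and \<phi> :: "'a \<Rightarrow> 'a"
    and \<alpha> :: "(('a \<times> real) set \<Rightarrow> ('a \<times> real) set) \<Rightarrow> (complex \<Rightarrow> complex)"
  assumes "stone_system X \<phi>"
    and "infinite (topspace X)"
    and "minimal_system X \<phi>"
    and "\<alpha> \<in> hom (T_group X \<phi>) (homeo_group circle)"
  shows "\<exists>z\<in>topspace circle. \<forall>g\<in>carrier (T_group X \<phi>). \<alpha> g z = z"
proof -
  interpret minimal_stone_dynamics X \<phi>
    using assms by unfold_locales
  \<comment> \<open>\<open>flow_map\<close> is a homomorphism onto T(phi), so a fixed point of the
    pulled-back action is fixed by all of T(phi).\<close>
  have "\<alpha> \<circ> flow_map \<in> hom leaf_group (homeo_group circle)"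
    using flow_map_hom assms(4) by (auto simp: hom_def Pi_def)
  then obtain z where z: "z \<in> sphere 0 1" "\<And>F. F \<in> leaf_maps \<Longrightarrow> \<alpha> (flow_map F) z = z"
    using leaf_group_fixed_point by force
  have "\<alpha> g z = z" if "g \<in> carrier (T_group X \<phi>)" for g
  proof -
    have "g \<in> T_carrier X \<phi>" using that by (simp add: T_group_def)
    then obtain F where "F \<in> leaf_maps" "g = flow_map F"
      using T_carrier_flow_map it_free by blast
    then show ?thesis using z(2) by simp
  qed
  moreover have "z \<in> topspace circle" using z(1) by simp
  ultimately show ?thesis by blast
qed

end
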